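(* Let $m\geq1$ be an integer. For all integers $r\geq0$, $$C_{r,m}^1=\mathfrak L_{g,m}^1+r-1,$$ where $g:\mathbb N_{>0}\to\mathbb N$ is given by $g(1)=r$ and $g(i)=i+r-2$ for $i\geq2$. In particular, if $r\geq1$ then $$C_{r,m}^1=A(m-1,C_{r-1,m}^1)\quad\text{and}\quad C_{r,m}^1\leq A(m,r-1)-1,$$ and if $r\geq2$ then $$A(m,r-2)\leq C_{r,m}^1,$$ where $A$ denotes the Ackermann function.
   Context: Notation. $\mathbb N=\{0,1,2,\dots\}$. For $\xi=(u_1,\dots,u_m)\in\mathbb N^m$, $\deg\xi=u_1+\cdots+u_m$. $\Gamma(r)=\{\xi\in\mathbb N^m:\deg\xi\leq r\}$. ${\bf k}\in\mathbb N^m$ is the tuple with $1$ in the $k$-th entry and zeros elsewhere. $\leq$ is the product order on $\mathbb N^m$. An antichain sequence of $\mathbb N^m$ is a finite sequence of pairwise $\leq$-incomparable elements. The number $C_{r,m}^1$. $\mathrm{LUB}(\eta,\tau)$ is the entrywise maximum of $\eta,\tau\in\mathbb N^m$. For an antichain (sequence) $\bar\alpha$ of $\mathbb N^m$, $\gamma(\bar\alpha)=\{\mathrm{LUB}(\eta,\tau):\eta\neq\tau,\ \eta,\tau\in\bar\alpha\}$ and $\Gamma_{\bar\alpha}(p)=\{\alpha\in\bar\alpha:\deg\alpha\leq p\}$. $D_{r,\bar\alpha}$ is the smallest integer $p\geq r$ such that: for every $\tau\in\gamma(\Gamma_{\bar\alpha}(p))\setminus\Gamma(p)$ and $1\leq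 i<j\leq m$ such that $\tau-{\bf i}\geq\beta_1$ and $\tau-{\bf j}\geq\beta_2$ for some $\beta_1,\beta_2\in\Gamma_{\bar\alpha}(p)$, there exists a sequence $\eta_1,\dots,\eta_s$ in $\Gamma_{\bar\alpha}(p)$ and indices $k_1,\dots,k_s\in\{1,\dots,m\}$ with $k_1=i$, $k_s=j$, $\eta_\ell\leq\tau-{\bf k}_\ell$ for all $\ell$ (where ${\bf k}_\ell$ has $1$ in entry $k_\ell$ and zeros elsewhere), and $\deg\mathrm{LUB}(\eta_\ell,\eta_{\ell+1})\leq p$ for $\ell=1,\dots,s-1$. Then $C_{r,m}^1=\max\{D_{r,\bar\alpha}:\bar\alpha\text{ an antichain sequence of }\mathbb N^m\}$. For a nondecreasing function $f:\mathbb N_{>0}\to\mathbb N$, $\mathfrak L_{f,m}^1$ is the maximal length $k$ of an antichain sequence $\alpha_1,\dots,\alpha_k$ of $\mathbb N^m$ with $\deg\alpha_i\leq f(i)$ for $i=1,\dots,k$ (this is finite). Ackermann function $A:\mathbb N\times\mathbb N\to\mathbb N$: $A(0,y)=y+1$; $A(x,0)=A(x-1,1)$ for $x>0$; $A(x,y)=A(x-1,A(x,y-1))$ for $x,y>0$. *)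

theory Defs
  imports Main
begin

text \<open>
  Tuples in $\mathbb{N}^m$ are functions \<open>nat \<Rightarrow> nat\<close> with coordinates indexed by
  \<open>1, \<dots>, m\<close> and value 0 elsewhere. On these, the library's pointwise order \<open>(\<le>)\<close> on functions
  is the product order and the pointwise \<open>sup\<close> is the entrywise maximum (LUB).
\<close>

definition tuples :: "nat \<Rightarrow> (nat \<Rightarrow> nat) set" where
  "tuples m = {\<xi>. \<forall>l. l \<notin> {1..m} \<longrightarrow> \<xi> l = 0}"

definition deg :: "nat \<Rightarrow> (nat \<Rightarrow> nat) \<Rightarrow> nat" where
  "deg m \<xi> = (\<Sum>l = 1..m. \<xi> l)"

definition Gamma :: "nat \<Rightarrow> nat \<Rightarrow> (nat \<Rightarrow> nat) set" where
  "Gamma m r = {\<xi> \<in> tuples m. deg m \<xi> \<le> r}"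

definition unit_tuple :: "nat \<Rightarrow> nat \<Rightarrow> nat" where
  "unit_tuple k = (\<lambda>l. if l = k then 1 else 0)"

text \<open>
  \<open>\<beta> \<le> \<tau> - \<^bold>k\<close>, with the difference taken in the integers: it fails when \<open>\<tau> k = 0\<close>,
  whereas truncated subtraction would give \<open>\<tau>\<close> itself.
\<close>

definition le_minus_unit :: "(nat \<Rightarrow> nat) \<Rightarrow> (nat \<Rightarrow> nat) \<Rightarrow> nat \<Rightarrow> bool" where
  "le_minus_unit \<beta> \<tau> k \<longleftrightarrow> (\<forall>l. int (\<beta> l) \<le> int (\<tau> l) - int (unit_tuple k l))"

definition antichain_seq :: "nat \<Rightarrow> (nat \<Rightarrow> nat) list \<Rightarrow> bool" where
  "antichain_seq m \<alpha> \<longleftrightarrow> set \<alpha> \<subseteq> tuples m \<and>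
     (\<forall>i < length \<alpha>. \<forall>j < length \<alpha>. i \<noteq> j \<longrightarrow> \<not> \<alpha> ! i \<le> \<alpha> ! j)"

definition lubs :: "(nat \<Rightarrow> nat) set \<Rightarrow> (nat \<Rightarrow> nat) set" where
  "lubs S = {sup \<eta> \<tau> | \<eta> \<tau>. \<eta> \<in> S \<and> \<tau> \<in> S \<and> \<eta> \<noteq> \<tau>}"

definition Gamma_in :: "nat \<Rightarrow> (nat \<Rightarrow> nat) list \<Rightarrow> nat \<Rightarrow> (nat \<Rightarrow> nat) set" where
  "Gamma_in m \<alpha> p = {\<xi> \<in> set \<alpha>. deg m \<xi> \<le> p}"

definition D_cond :: "nat \<Rightarrow> (nat \<Rightarrow> nat) list \<Rightarrow> nat \<Rightarrow> bool" where
  "D_cond m \<alpha> p \<longleftrightarrow>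
     (\<forall>\<tau> \<in> lubs (Gamma_in m \<alpha> p) - Gamma m p. \<forall>i j.
        1 \<le> i \<and> i < j \<and> j \<le> m \<and>
        (\<exists>\<beta>1 \<in> Gamma_in m \<alpha> p. \<exists>\<beta>2 \<in> Gamma_in m \<alpha> p.
           le_minus_unit \<beta>1 \<tau> i \<and> le_minus_unit \<beta>2 \<tau> j) \<longrightarrow>
        (\<exists>(s::nat) (\<eta> :: nat \<Rightarrow> nat \<Rightarrow> nat) (k :: nat \<Rightarrow> nat).
           1 \<le> s \<and>
           (\<forall>l \<in> {1..s}. \<eta> l \<in> Gamma_in m \<alpha> p \<and> k l \<in> {1..m} \<and> le_minus_unit (\<eta> l) \<tau> (k l)) \<and>
           k 1 = i \<and> k s = j \<and>
           (\<forall>l \<in> {1..<s}. deg m (sup (\<eta> l) (\<eta> (l + 1))) \<le> p)))"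

definition D_num :: "nat \<Rightarrow> nat \<Rightarrow> (nat \<Rightarrow> nat) list \<Rightarrow> nat" where
  "D_num m r \<alpha> = (LEAST p. r \<le> p \<and> D_cond m \<alpha> p)"

definition D_set :: "nat \<Rightarrow> nat \<Rightarrow> nat set" where
  "D_set r m = {D_num m r \<alpha> | \<alpha>. antichain_seq m \<alpha>}"

definition C_num :: "nat \<Rightarrow> nat \<Rightarrow> nat" where
  "C_num r m = Max (D_set r m)"

text \<open>Bounds \<open>f\<close> are only evaluated at positive arguments; lists are indexed from 0.\<close>

definition antichain_lengths :: "(nat \<Rightarrow> nat) \<Rightarrow> nat \<Rightarrow> nat set" where
  "antichain_lengths f m =
     {length \<alpha> | \<alpha>. antichain_seq m \<alpha> \<and> (\<forall>i \<in> {1..length \<alpha>}. deg m (\<alpha> ! (i - 1)) \<le> f i)}"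

definition L_num :: "(nat \<Rightarrow> nat) \<Rightarrow> nat \<Rightarrow> nat" where
  "L_num f m = Max (antichain_lengths f m)"

definition g_bound :: "nat \<Rightarrow> nat \<Rightarrow> nat" where
  "g_bound r i = (if i = 1 then r else i + r - 2)"

fun ackermann :: "nat \<Rightarrow> nat \<Rightarrow> nat" where
  "ackermann 0 y = y + 1"
| "ackermann (Suc x) 0 = ackermann x 1"
| "ackermann (Suc x) (Suc y) = ackermann x (ackermann (Suc x) y)"

end

theory Submission
  imports Defs
begin

text \<open>
  Replacing the slices of a set of monomials of one degree by lexicographic segments does not enlarge its
  shadow; iterating this gives Macaulay's bound on the growth of an upset. If the bound is attained in some
  degree then it is attained in all later ones (Gotzmann persistence), and a disconnected pair below \<open>\<tau>\<close>
  contradicts this in degree \<open>deg \<tau> - 2\<close>. Hence every degree in which the connectedness condition fails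
  costs at least one monomial with respect to Macaulay's bound, as a new element of an antichain does.

  It remains to see how long a lexicographic segment can go on acquiring new elements. Give its smallest
  element \<open>x\<^sub>1\<^bsup>a\<^esup> x\<^sub>2\<^bsup>b\<^esup> \<dots> x\<^sub>m\<^bsup>c\<^esup>\<close> the weight \<open>A(m-1)\<^bsup>a\<^esup> (A(m-2)\<^bsup>b\<^esup> (\<dots> (A(0)\<^bsup>c\<^esup> 1)))\<close> (iterates of \<open>y \<mapsto> A(k,y)\<close>). It
  exceeds the degree, never increases when an element is added in the next degree, and is constant if that
  element is the largest missing monomial. For the start \<open>x\<^sub>1\<^sup>r, x\<^sub>1\<^bsup>r-1\<^esup> x\<^sub>2\<close> it is \<open>A(m-1)\<^sup>r 0\<close>, the common value of both sides.
\<close>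

section \<open>Monomials and shadows\<close>

text \<open>Macaulay's bound only needs that a compression does not enlarge the shadow. Persistence
  also needs that the second shadow of a set is no larger than that of its compression. This is
  checked slice by slice: a slice of a shadow is a union of two sets, nested for a compressed set,
  and the bad case is where the larger of the two changes between adjacent slices. It is excluded by
  the two-variable case, where a set with minimal shadow is an interval of exponents. Variable sets
  are arbitrary finite sets of indices because the inductions delete variables anywhere. Two
  variables form a base case: closure of a compressed set under moving a factor to a variable of
  smaller index is obtained by holding a third variable fixed. The Ackermann weights fit because
  A(k+1, y) is the (y+1)-fold iterate of A(k, .) at 1. Trading one factor of a variable and b
  factors of the last one for b + 2 factors of the next variable therefore keeps the weight, and
  this trade leads from one extremal generator to the largest missing monomial of the next
  degree.\<close>

definition mon :: "nat set \<Rightarrow> nat \<Rightarrow> (nat \<Rightarrow> nat) set" where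
  "mon V d = {u. (\<forall>l. l \<notin> V \<longrightarrow> u l = 0) \<and> sum u V = d}"

definition mult :: "nat \<Rightarrow> (nat \<Rightarrow> nat) \<Rightarrow> nat \<Rightarrow> nat" where
  "mult k u = u(k := Suc (u k))"

definition dec :: "nat \<Rightarrow> (nat \<Rightarrow> nat) \<Rightarrow> nat \<Rightarrow> nat" where
  "dec k u = u(k := u k - 1)"

definition shadow :: "nat set \<Rightarrow> (nat \<Rightarrow> nat) set \<Rightarrow> (nat \<Rightarrow> nat) set" where
  "shadow V S = {mult k u | k u. k \<in> V \<and> u \<in> S}"

text \<open>The smallest index is the largest variable. All indices are compared, so the order does
  not depend on the set of variables.\<close>

definition lex_less :: "(nat \<Rightarrow> nat) \<Rightarrow> (nat \<Rightarrow> nat) \<Rightarrow> bool" where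
  "lex_less v u \<longleftrightarrow> (\<exists>i. v i < u i \<and> (\<forall>j<i. v j = u j))"

definition lexseg :: "nat set \<Rightarrow> nat \<Rightarrow> (nat \<Rightarrow> nat) set \<Rightarrow> bool" where
  "lexseg V d T \<longleftrightarrow> T \<subseteq> mon V d \<and> (\<forall>u\<in>T. \<forall>v\<in>mon V d. lex_less u v \<longrightarrow> v \<in> T)"

lemma mult_apply: "mult k u l = (if l = k then Suc (u k) else u l)"
  by (simp add: mult_def)

lemma dec_apply: "dec k u l = (if l = k then u k - 1 else u l)"
  by (simp add: dec_def)

lemma dec_mult [simp]: "dec k (mult k u) = u"
  by (auto simp: mult_def dec_def)

lemma mult_dec: "0 < u k \<Longrightarrow> mult k (dec k u) = u"
  by (auto simp: mult_def dec_def)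

lemma mult_commute: "mult i (mult j u) = mult j (mult i u)"
  by (auto simp: mult_def fun_eq_iff)

lemma mult_inject [simp]: "mult k u = mult k v \<longleftrightarrow> u = v"
  by (metis dec_mult)

lemma mult_dec_commute: "k \<noteq> l \<Longrightarrow> mult k (dec l u) = dec l (mult k u)"
  by (auto simp: mult_def dec_def fun_eq_iff)

lemma finite_mon: "finite V \<Longrightarrow> finite (mon V d)"
proof -
  assume V: "finite V"
  have "finite {f. \<forall>x. (x \<in> V \<longrightarrow> f x \<in> {..d}) \<and> (x \<notin> V \<longrightarrow> f x = (0::nat))}"
    by (rule finite_set_of_finite_funs) (auto simp: V)
  moreover have "mon V d \<subseteq> {f. \<forall>x. (x \<in> V \<longrightarrow> f x \<in> {..d}) \<and> (x \<notin> V \<longrightarrow> f x = (0::nat))}"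
    using V by (auto simp: mon_def intro: member_le_sum)
  ultimately show ?thesis by (rule rev_finite_subset)
qed

lemma mon_zero: "u \<in> mon V d \<Longrightarrow> l \<notin> V \<Longrightarrow> u l = 0"
  by (simp add: mon_def)

lemma sum_mult: "finite V \<Longrightarrow> k \<in> V \<Longrightarrow> sum (mult k u) V = Suc (sum u V)"
  by (simp add: mult_def sum.remove[where x = k])

lemma mult_in_mon: "finite V \<Longrightarrow> k \<in> V \<Longrightarrow> u \<in> mon V d \<Longrightarrow> mult k u \<in> mon V (Suc d)"
  using sum_mult[of V k u] by (auto simp: mon_def mult_apply)

lemma dec_in_mon:
  assumes "finite V" "u \<in> mon V (Suc d)" "0 < u k" shows "dec k u \<in> mon V d"
proof -
  have k: "k \<in> V" using assms by (auto simp: mon_def)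
  have "Suc (sum (dec k u) V) = sum u V"
    using sum_mult[OF assms(1) k, of "dec k u"] assms by (simp add: mult_dec)
  then show ?thesis using assms by (auto simp: mon_def dec_apply)
qed

lemma shadow_subset: "finite V \<Longrightarrow> S \<subseteq> mon V d \<Longrightarrow> shadow V S \<subseteq> mon V (Suc d)"
  by (auto simp: shadow_def intro!: mult_in_mon)

lemma shadow_mono: "S \<subseteq> S' \<Longrightarrow> shadow V S \<subseteq> shadow V S'"
  by (auto simp: shadow_def)

lemma shadow_empty [simp]: "shadow V {} = {}"
  by (simp add: shadow_def)

lemma shadowI: "k \<in> V \<Longrightarrow> u \<in> S \<Longrightarrow> mult k u \<in> shadow V S"
  by (auto simp: shadow_def)

lemma shadowI_dec: "k \<in> V \<Longrightarrow> 0 < u k \<Longrightarrow> dec k u \<in> S \<Longrightarrow> u \<in> shadow V S"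
  by (metis shadowI mult_dec)

lemma shadowE:
  assumes "u \<in> shadow V S"
  obtains k where "k \<in> V" "0 < u k" "dec k u \<in> S"
  using assms by (auto simp: shadow_def mult_apply)

lemma card_le_card_shadow:
  assumes "finite V" "S \<subseteq> mon V d" "V \<noteq> {}" shows "card S \<le> card (shadow V S)"
proof -
  obtain k where k: "k \<in> V" using assms by auto
  have "card S = card (mult k ` S)" by (intro card_image[symmetric]) (auto simp: inj_on_def)
  also have "\<dots> \<le> card (shadow V S)"
    by (intro card_mono finite_subset[OF shadow_subset[OF assms(1,2)] finite_mon])
       (auto simp: assms k intro: shadowI)
  finally show ?thesis .
qed

section \<open>The lexicographic order\<close>

lemma lex_less_irrefl [simp]: "\<not> lex_less u u"
  by (auto simp: lex_less_def)

lemma lex_less_trans: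
  assumes "lex_less u v" "lex_less v w" shows "lex_less u w"
proof -
  obtain i where i: "u i < v i" "\<And>j. j < i \<Longrightarrow> u j = v j" using assms by (auto simp: lex_less_def)
  obtain k where k: "v k < w k" "\<And>j. j < k \<Longrightarrow> v j = w j" using assms by (auto simp: lex_less_def)
  have "u (min i k) < w (min i k)" using i k
    by (metis min_def order_le_less order_less_trans linorder_not_le)
  moreover have "\<forall>j<min i k. u j = w j" using i k by simp
  ultimately show ?thesis by (auto simp: lex_less_def)
qed

lemma lex_less_asym: "lex_less u v \<Longrightarrow> \<not> lex_less v u"
  using lex_less_trans lex_less_irrefl by blast

lemma lex_less_linear: "u = v \<or> lex_less u v \<or> lex_less v u"
proof (cases "u = v")
  case False
  define i where "i = (LEAST i. u i \<noteq> v i)"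
  have "\<exists>i. u i \<noteq> v i" using False by (simp add: fun_eq_iff)
  then have "u i \<noteq> v i" unfolding i_def by (rule LeastI_ex)
  moreover have eq: "\<forall>j<i. u j = v j" unfolding i_def using not_less_Least by blast
  ultimately consider "u i < v i" | "v i < u i" by linarith
  then show ?thesis
  proof cases
    case 1
    then have "lex_less u v" unfolding lex_less_def using eq by blast
    then show ?thesis by blast
  next
    case 2
    then have "lex_less v u" unfolding lex_less_def using eq by metis
    then show ?thesis by blast
  qed
qed simp

text \<open>The first index at which \<open>v\<close> and \<open>u\<close> differ is at most
  \<open>i\<close>, and there the weak inequality becomes strict.\<close>

lemma lex_lessI:
  assumes "v i < u i" "\<And>j. j < i \<Longrightarrow> v j \<le> u j" shows "lex_less v u"
proof -
  define k where "k = (LEAST i. v i \<noteq> u i)"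
  have ne: "\<exists>i. v i \<noteq> u i" using assms(1) by (intro exI[of _ i]) simp
  have 1: "v k \<noteq> u k" unfolding k_def by (rule LeastI_ex[OF ne])
  have 2: "\<forall>j<k. v j = u j" unfolding k_def using not_less_Least by blast
  have "k \<le> i" unfolding k_def using assms(1) by (intro Least_le) simp
  then have "v k \<le> u k" using assms by (cases "k = i") auto
  with 1 2 show ?thesis unfolding lex_less_def using order_neq_le_trans by blast
qed

lemma lex_less_mult: "lex_less v u \<Longrightarrow> lex_less (mult k v) (mult k u)"
proof -
  assume "lex_less v u"
  then obtain i where "v i < u i" "\<forall>j<i. v j = u j" by (auto simp: lex_less_def)
  then show ?thesis unfolding lex_less_def mult_apply by (intro exI[of _ i]) auto
qed

lemma lex_less_mult_mult: "i < j \<Longrightarrow> lex_less (mult j u) (mult i u)"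
  unfolding lex_less_def mult_apply by (intro exI[of _ i]) auto

lemma lex_max:
  assumes S: "finite S" "S \<noteq> {}"
  obtains z where "z \<in> S" "\<And>v. v \<in> S \<Longrightarrow> v = z \<or> lex_less v z"
proof -
  have "\<exists>z\<in>S. \<forall>v\<in>S. v = z \<or> lex_less v z" using S
  proof (induction S rule: finite_ne_induct)
    case (insert x F)
    then obtain z where z: "z \<in> F" "\<forall>v\<in>F. v = z \<or> lex_less v z" by auto
    consider "lex_less z x" | "x = z \<or> lex_less x z" using lex_less_linear[of x z] by blast
    then show ?case
    proof cases
      case 1
      then show ?thesis using z by (intro bexI[of _ x]) (auto intro: lex_less_trans)
    next
      case 2
      then show ?thesis using z by (intro bexI[of _ z]) auto
    qed
  qed simp
  then show ?thesis using that by blast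
qed

lemma lex_min:
  assumes S: "finite S" "S \<noteq> {}"
  obtains z where "z \<in> S" "\<And>v. v \<in> S \<Longrightarrow> v = z \<or> lex_less z v"
proof -
  have "\<exists>z\<in>S. \<forall>v\<in>S. v = z \<or> lex_less z v" using S
  proof (induction S rule: finite_ne_induct)
    case (insert x F)
    then obtain z where z: "z \<in> F" "\<forall>v\<in>F. v = z \<or> lex_less z v" by auto
    consider "lex_less x z" | "x = z \<or> lex_less z x" using lex_less_linear[of x z] by blast
    then show ?case
    proof cases
      case 1
      then show ?thesis using z by (intro bexI[of _ x]) (auto intro: lex_less_trans)
    next
      case 2
      then show ?thesis using z by (intro bexI[of _ z]) auto
    qed
  qed simp
  then show ?thesis using that by blast
qed

text \<open>Either \<open>b\<close> is strictly smaller somewhere up to \<open>i\<close>, which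
  decides the order, or \<open>a\<close> lies pointwise below \<open>b\<close> and the equal degrees
  make them the same.\<close>

lemma lex_le_of_prefix:
  assumes V: "finite V" and a: "a \<in> mon V d" and b: "b \<in> mon V d"
    and le: "\<And>j. j \<le> i \<Longrightarrow> b j \<le> a j" and z: "\<And>j. i < j \<Longrightarrow> a j = 0"
  shows "a = b \<or> lex_less b a"
proof (cases "\<exists>j\<le>i. b j < a j")
  case True
  then obtain j where j: "j \<le> i" "b j < a j" by auto
  then show ?thesis using le by (intro disjI2 lex_lessI[of _ j]) auto
next
  case False
  then have le': "a l \<le> b l" for l using z[of l] by (cases "l \<le> i") (auto simp: not_less)
  have "a l = b l" if l: "l \<in> V" for l
  proof (rule ccontr)
    assume "a l \<noteq> b l"
    then have "sum a V < sum b V" using le' l V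
      by (intro sum_strict_mono_ex1) (auto simp: le_less)
    with a b show False by (simp add: mon_def)
  qed
  moreover have "a l = b l" if "l \<notin> V" for l using a b that by (simp add: mon_def)
  ultimately have "a = b" by (intro ext) blast
  then show ?thesis ..
qed

section \<open>Lexicographic segments\<close>

lemma lexsegD: "lexseg V d T \<Longrightarrow> u \<in> T \<Longrightarrow> v \<in> mon V d \<Longrightarrow> u = v \<or> lex_less u v \<Longrightarrow> v \<in> T"
  by (auto simp: lexseg_def)

lemma lexseg_mon: "lexseg V d T \<Longrightarrow> T \<subseteq> mon V d"
  by (simp add: lexseg_def)

lemma lexseg_finite: "finite V \<Longrightarrow> lexseg V d T \<Longrightarrow> finite T"
  using finite_subset[OF lexseg_mon finite_mon] .

lemma lexseg_comparable: "lexseg V d T \<Longrightarrow> lexseg V d T' \<Longrightarrow> T \<subseteq> T' \<or> T' \<subseteq> T"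
proof (rule ccontr)
  assume T: "lexseg V d T" "lexseg V d T'" and "\<not> (T \<subseteq> T' \<or> T' \<subseteq> T)"
  then obtain u v where uv: "u \<in> T" "u \<notin> T'" "v \<in> T'" "v \<notin> T" by blast
  have mon: "u \<in> mon V d" "v \<in> mon V d" using T uv lexseg_mon by blast+
  show False
    using lex_less_linear[of u v] uv lexsegD[OF T(1) uv(1) mon(2)] lexsegD[OF T(2) uv(3) mon(1)] by blast
qed

lemma lexseg_subset:
  assumes "finite V" "lexseg V d T" "lexseg V d T'" "card T \<le> card T'"
  shows "T \<subseteq> T'"
  using lexseg_comparable[OF assms(2,3)] card_seteq[OF lexseg_finite[OF assms(1,2)] _ assms(4)] by auto

lemma lexseg_unique:
  "finite V \<Longrightarrow> lexseg V d T \<Longrightarrow> lexseg V d T' \<Longrightarrow> card T = card T' \<Longrightarrow> T = T'"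
  by (metis lexseg_subset order_refl subset_antisym)

lemma lexseg_empty: "lexseg V d {}"
  by (simp add: lexseg_def)

lemma lexseg_insert:
  assumes V: "finite V" and T: "lexseg V d T" and z: "z \<in> mon V d"
    and max: "\<And>v. v \<in> mon V d \<Longrightarrow> v \<notin> T \<Longrightarrow> v = z \<or> lex_less v z"
  shows "lexseg V d (insert z T)"
proof -
  have "v \<in> insert z T" if u: "u \<in> insert z T" and v: "v \<in> mon V d" and uv: "lex_less u v" for u v
  proof (cases "u = z")
    case True
    then show ?thesis using max[OF v] uv lex_less_asym[OF uv] by blast
  next
    case False
    then show ?thesis using u v uv lexsegD[OF T] by blast
  qed
  then show ?thesis using lexseg_mon[OF T] z unfolding lexseg_def by blast
qed

lemma lexseg_exists:
  assumes V: "finite V" and n: "n \<le> card (mon V d)"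
  shows "\<exists>T. lexseg V d T \<and> card T = n"
  using n
proof (induction n)
  case 0
  then show ?case by (intro exI[of _ "{}"]) (simp add: lexseg_empty)
next
  case (Suc n)
  then obtain T where T: "lexseg V d T" "card T = n" by auto
  have "mon V d - T \<noteq> {}"
    using Suc.prems T lexseg_mon[OF T(1)] card_mono[OF lexseg_finite[OF V T(1)], of "mon V d"] by auto
  then obtain z where z: "z \<in> mon V d - T" "\<And>v. v \<in> mon V d - T \<Longrightarrow> v = z \<or> lex_less v z"
    using lex_max[of "mon V d - T"] finite_mon[OF V] by blast
  then have "lexseg V d (insert z T)" using lexseg_insert[OF V T(1)] by blast
  moreover have "card (insert z T) = Suc n" using z T lexseg_finite[OF V] by simp
  ultimately show ?case by blast
qed

text \<open>By \<open>lexseg_unique\<close> there is only one candidate as long as \<open>n\<close>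
  is at most the number of monomials; beyond that the value is unspecified.\<close>

definition seg :: "nat set \<Rightarrow> nat \<Rightarrow> nat \<Rightarrow> (nat \<Rightarrow> nat) set" where
  "seg V d n = (SOME T. lexseg V d T \<and> card T = n)"

lemma seg:
  assumes "finite V" "n \<le> card (mon V d)"
  shows lexseg_seg: "lexseg V d (seg V d n)" and card_seg: "card (seg V d n) = n"
  using someI_ex[OF lexseg_exists[OF assms]] unfolding seg_def by auto

lemma seg_card: "finite V \<Longrightarrow> lexseg V d T \<Longrightarrow> seg V d (card T) = T"
proof -
  assume V: "finite V" and T: "lexseg V d T"
  have n: "card T \<le> card (mon V d)" using card_mono[OF finite_mon[OF V] lexseg_mon[OF T]] .
  show ?thesis using lexseg_unique[OF V lexseg_seg[OF V n] T card_seg[OF V n]] .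
qed

section \<open>Quotients by the last variable\<close>

definition last_var :: "(nat \<Rightarrow> nat) \<Rightarrow> nat" where
  "last_var u = Max {k. 0 < u k}"

lemma last_var:
  assumes V: "finite V" and u: "u \<in> mon V (Suc d)"
  shows "0 < u (last_var u)" and "last_var u < j \<Longrightarrow> u j = 0"
proof -
  have sub: "{k. 0 < u k} \<subseteq> V" using u by (auto simp: mon_def)
  then have fin: "finite {k. 0 < u k}" using V finite_subset by blast
  have "{k. 0 < u k} \<noteq> {}"
  proof
    assume "{k. 0 < u k} = {}"
    then have "sum u V = 0" by simp
    then show False using u by (simp add: mon_def)
  qed
  with fin have "last_var u \<in> {k. 0 < u k}" unfolding last_var_def by (rule Max_in)
  then show "0 < u (last_var u)" by simp
  show "u j = 0" if "last_var u < j"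
    using that Max_ge[OF fin, of j] unfolding last_var_def by fastforce
qed

lemma last_var_in: "finite V \<Longrightarrow> u \<in> mon V (Suc d) \<Longrightarrow> last_var u \<in> V"
  using last_var(1) mon_zero by fastforce

lemma last_var_ge: "finite V \<Longrightarrow> u \<in> mon V (Suc d) \<Longrightarrow> 0 < u k \<Longrightarrow> k \<le> last_var u"
  using last_var(2) by (metis linorder_not_le less_irrefl)

text \<open>Among the quotients of \<open>w\<close> by one of its variables, the one by the last
  variable is lexicographically largest. A first difference from \<open>mult k u\<close> before that
  variable survives the division.\<close>

lemma dec_last_var_ge:
  assumes V: "finite V" and u: "u \<in> mon V d" and w: "w \<in> mon V (Suc d)" and k: "k \<in> V"
    and le: "w = mult k u \<or> lex_less (mult k u) w"
  shows "dec (last_var w) w = u \<or> lex_less u (dec (last_var w) w)"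
proof -
  define K where "K = last_var w"
  have K: "0 < w K" "\<And>j. K < j \<Longrightarrow> w j = 0" "\<And>j. 0 < w j \<Longrightarrow> j \<le> K"
    using last_var[OF V w] last_var_ge[OF V w] by (auto simp: K_def)
  have mon: "dec K w \<in> mon V d" using dec_in_mon[OF V w] K by simp
  have "dec K w = u \<or> lex_less u (dec K w)" using le
  proof
    assume w': "w = mult k u"
    then have "k \<le> K" using K(3)[of k] by (simp add: mult_apply)
    show ?thesis
    proof (cases "k = K")
      case True
      then show ?thesis using w' by simp
    next
      case False
      with \<open>k \<le> K\<close> have "lex_less u (dec K w)"
        by (intro lex_lessI[of _ k]) (auto simp: w' mult_apply dec_apply)
      then show ?thesis by simp
    qed
  next
    assume "lex_less (mult k u) w"
    then obtain i where i: "mult k u i < w i" "\<And>j. j < i \<Longrightarrow> mult k u j = w j"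
      by (auto simp: lex_less_def)
    have ui: "u i < w i" "\<And>j. j < i \<Longrightarrow> u j \<le> w j"
      using i by (auto simp: mult_apply split: if_splits) (metis Suc_n_not_le_n nat_le_linear)
    have "i \<le> K" using K(3) i(1) by simp
    show ?thesis
    proof (cases "i = K")
      case False
      then have "lex_less u (dec K w)" using ui \<open>i \<le> K\<close>
        by (intro lex_lessI[of _ i]) (auto simp: dec_apply)
      then show ?thesis by simp
    next
      \<comment> \<open>The difference sits in the last variable of \<open>w\<close>, where the
        division may turn it into equality; the equal degrees settle the rest.\<close>
      case True
      show ?thesis
      proof (rule lex_le_of_prefix[OF V mon u, of K])
        show "u j \<le> dec K w j" if "j \<le> K" for j
          using that ui True by (cases "j = K") (auto simp: dec_apply)
        show "dec K w j = 0" if "K < j" for j using that K by (simp add: dec_apply)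
      qed
    qed
  qed
  then show ?thesis by (simp add: K_def)
qed

lemma dec_last_var_in_lexseg:
  assumes V: "finite V" and T: "lexseg V d T" and u: "u \<in> T" and w: "w \<in> mon V (Suc d)" and k: "k \<in> V"
    and le: "w = mult k u \<or> lex_less (mult k u) w"
  shows "dec (last_var w) w \<in> T"
proof -
  have "u \<in> mon V d" using lexseg_mon[OF T] u by blast
  then have "dec (last_var w) w = u \<or> lex_less u (dec (last_var w) w)"
    using dec_last_var_ge[OF V _ w k le] by blast
  moreover have "dec (last_var w) w \<in> mon V d" using dec_in_mon[OF V w] last_var[OF V w] by simp
  ultimately show ?thesis using lexsegD[OF T u] by metis
qed

lemma lexseg_shadow:
  assumes V: "finite V" and T: "lexseg V d T"
  shows "lexseg V (Suc d) (shadow V T)"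
  unfolding lexseg_def
proof (intro conjI ballI impI)
  show "shadow V T \<subseteq> mon V (Suc d)" using shadow_subset[OF V] lexseg_mon[OF T] .
  fix u v assume u: "u \<in> shadow V T" and v: "v \<in> mon V (Suc d)" and uv: "lex_less u v"
  obtain k w where kw: "k \<in> V" "w \<in> T" "u = mult k w" using u by (auto simp: shadow_def)
  have "dec (last_var v) v \<in> T" using dec_last_var_in_lexseg[OF V T kw(2) v kw(1)] uv kw by simp
  then show "v \<in> shadow V T"
    using shadowI_dec[of "last_var v" V v T] last_var_in[OF V v] last_var(1)[OF V v] by blast
qed

text \<open>For a segment a single quotient decides, because the one by the last variable is the
  largest.\<close>

lemma shadow_lexseg_iff:
  assumes V: "finite V" and T: "lexseg V d T" and w: "w \<in> mon V (Suc d)"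
  shows "w \<in> shadow V T \<longleftrightarrow> dec (last_var w) w \<in> T"
proof
  assume "w \<in> shadow V T"
  then obtain k u where "k \<in> V" "u \<in> T" "w = mult k u" by (auto simp: shadow_def)
  then show "dec (last_var w) w \<in> T" using dec_last_var_in_lexseg[OF V T _ w] by blast
next
  assume "dec (last_var w) w \<in> T"
  then show "w \<in> shadow V T"
    using shadowI_dec[of "last_var w" V w T] last_var_in[OF V w] last_var(1)[OF V w] by blast
qed

text \<open>If \<open>z\<close> is below \<open>z0\<close>, their first difference lies before
  \<open>k\<close>: otherwise \<open>z\<close>, being 0 after its last variable, would lie pointwise
  below \<open>z0\<close> in the same degree. Multiplication by variable \<open>k\<close> does not
  disturb it.\<close>

lemma mult_last_var_mono:
  assumes V: "finite V" and z: "z \<in> mon V (Suc d)" and z0: "z0 \<in> mon V (Suc d)"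
    and le: "z = z0 \<or> lex_less z z0" and k: "last_var z \<le> k"
  shows "mult k z = mult (last_var z0) z0 \<or> lex_less (mult k z) (mult (last_var z0) z0)"
  using le
proof
  assume "z = z0"
  then show ?thesis using k lex_less_mult_mult[of "last_var z0" k z0] by (cases "k = last_var z0") auto
next
  assume "lex_less z z0"
  then obtain i where i: "z i < z0 i" "\<And>j. j < i \<Longrightarrow> z j = z0 j" by (auto simp: lex_less_def)
  have "i < k"
  proof (rule ccontr)
    assume "\<not> i < k"
    then have li: "last_var z \<le> i" using k by simp
    have "z = z0 \<or> lex_less z0 z"
    proof (rule lex_le_of_prefix[OF V z z0, of "last_var z"])
      show "z0 j \<le> z j" if "j \<le> last_var z" for j
      proof (cases "j = i")
        case True
        have "sum z V < sum z0 V"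
        proof (rule sum_strict_mono_ex1[OF V])
          show "\<forall>x\<in>V. z x \<le> z0 x"
          proof
            fix x show "z x \<le> z0 x" using i li last_var(2)[OF V z, of x]
              by (cases x i rule: linorder_cases) auto
          qed
          have "i \<in> V" using i(1) z0 mon_zero[of z0 V] by force
          then show "\<exists>a\<in>V. z a < z0 a" using i by blast
        qed
        then show ?thesis using z z0 by (simp add: mon_def)
      next
        case False
        then show ?thesis using that li i by simp
      qed
      show "z j = 0" if "last_var z < j" for j using that last_var(2)[OF V z] by simp
    qed
    then show False using \<open>lex_less z z0\<close> lex_less_asym by auto
  qed
  then have "lex_less (mult k z) (mult (last_var z0) z0)" using i
    by (intro lex_lessI[of _ i]) (auto simp: mult_apply)
  then show ?thesis ..
qed

text \<open>A monomial outside the shadow is its last variable times a monomial missing from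
  \<open>T\<close>, to which \<open>mult_last_var_mono\<close> applies.\<close>

lemma missing_shadow_le:
  assumes V: "finite V" and T: "lexseg V (Suc d) T"
    and z0: "z0 \<in> mon V (Suc d)" and max: "\<And>v. v \<in> mon V (Suc d) \<Longrightarrow> v \<notin> T \<Longrightarrow> v = z0 \<or> lex_less v z0"
    and w: "w \<in> mon V (Suc (Suc d))" "w \<notin> shadow V T"
  shows "w = mult (last_var z0) z0 \<or> lex_less w (mult (last_var z0) z0)"
proof -
  define k where "k = last_var w"
  define z where "z = dec k w"
  have wz: "w = mult k z" using last_var(1)[OF V w(1)] by (simp add: z_def k_def mult_dec)
  have z: "z \<in> mon V (Suc d)" using dec_in_mon[OF V w(1)] last_var(1)[OF V w(1)] by (simp add: z_def k_def)
  have "z \<notin> T" using w shadow_lexseg_iff[OF V T w(1)] by (simp add: z_def k_def)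
  then have "z = z0 \<or> lex_less z z0" using max z by blast
  moreover have "last_var z \<le> k" unfolding k_def
    using last_var_ge[OF V w(1), of "last_var z"] last_var(1)[OF V z] by (simp add: wz mult_apply)
  ultimately show ?thesis unfolding wz using mult_last_var_mono[OF V z z0] by blast
qed

section \<open>Compression\<close>

definition padd :: "(nat \<Rightarrow> nat) \<Rightarrow> (nat \<Rightarrow> nat) \<Rightarrow> nat \<Rightarrow> nat" where
  "padd w v = (\<lambda>l. w l + v l)"

definition fib :: "nat set \<Rightarrow> (nat \<Rightarrow> nat) set \<Rightarrow> (nat \<Rightarrow> nat) \<Rightarrow> (nat \<Rightarrow> nat) set" where
  "fib V S w = {v. (\<forall>l. l \<notin> V \<longrightarrow> v l = 0) \<and> padd w v \<in> S}"

text \<open>Exponent vectors of larger degree have empty fibers in degree \<open>d\<close>, see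
  \<open>fib_empty\<close>.\<close>

definition bases :: "nat set \<Rightarrow> nat \<Rightarrow> (nat \<Rightarrow> nat) set" where
  "bases C d = {w. (\<forall>l. l \<notin> C \<longrightarrow> w l = 0) \<and> sum w C \<le> d}"

text \<open>Compression as in Macaulay's theorem: the fibers keep their sizes while their elements
  move up lexicographically.\<close>

definition compress :: "nat set \<Rightarrow> nat set \<Rightarrow> nat \<Rightarrow> (nat \<Rightarrow> nat) set \<Rightarrow> (nat \<Rightarrow> nat) set" where
  "compress U V d S =
     (\<Union>w\<in>bases (U - V) d. padd w ` seg V (d - sum w (U - V)) (card (fib V S w)))"

definition restr :: "nat set \<Rightarrow> (nat \<Rightarrow> nat) \<Rightarrow> nat \<Rightarrow> nat" where
  "restr V u = (\<lambda>l. if l \<in> V then u l else 0)"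

lemma finite_bases: "finite C \<Longrightarrow> finite (bases C d)"
proof -
  assume C: "finite C"
  have "bases C d = (\<Union>e\<le>d. mon C e)" by (auto simp: bases_def mon_def)
  then show ?thesis using finite_mon[OF C] by simp
qed

lemma padd_inject [simp]: "padd w v = padd w v' \<longleftrightarrow> v = v'"
  by (simp add: padd_def fun_eq_iff)

lemma padd_mult: "padd w (mult k v) = mult k (padd w v)"
  by (auto simp: padd_def mult_apply)

lemma padd_mult_left: "padd (mult k w) v = mult k (padd w v)"
  by (auto simp: padd_def mult_apply)

lemma padd_mult_dec: "0 < w k \<Longrightarrow> padd w v = mult k (padd (dec k w) v)"
  by (metis padd_mult_left mult_dec)

context
  fixes U V :: "nat set" and d :: nat
  assumes U: "finite U" and VU: "V \<subseteq> U"
begin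

lemma finV: "finite V"
  using finite_subset[OF VU U] .

lemma sum_split: "sum u U = sum u (U - V) + sum u V"
  using sum.subset_diff[OF VU U, of u] by simp

lemma sum_padd:
  assumes "\<And>l. l \<notin> U - V \<Longrightarrow> w l = 0" "\<And>l. l \<notin> V \<Longrightarrow> v l = 0"
  shows "sum (padd w v) U = sum w (U - V) + sum v V"
proof -
  have "sum (padd w v) U = sum (padd w v) (U - V) + sum (padd w v) V" by (rule sum_split)
  also have "sum (padd w v) (U - V) = sum w (U - V)" by (rule sum.cong) (auto simp: padd_def assms)
  also have "sum (padd w v) V = sum v V" by (rule sum.cong) (auto simp: padd_def assms)
  finally show ?thesis .
qed

lemma padd_in_mon:
  assumes w: "w \<in> bases (U - V) d" and v: "v \<in> mon V (d - sum w (U - V))"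
  shows "padd w v \<in> mon U d"
proof -
  have "sum (padd w v) U = sum w (U - V) + sum v V"
    using w v by (intro sum_padd) (auto simp: bases_def mon_def)
  then show ?thesis using w v VU by (auto simp: mon_def bases_def padd_def)
qed

lemma fib_subset:
  assumes S: "S \<subseteq> mon U d" and w: "w \<in> bases (U - V) d"
  shows "fib V S w \<subseteq> mon V (d - sum w (U - V))"
proof
  fix v assume v: "v \<in> fib V S w"
  then have "sum (padd w v) U = sum w (U - V) + sum v V"
    using w by (intro sum_padd) (auto simp: bases_def fib_def)
  moreover have "sum (padd w v) U = d" using v S by (auto simp: fib_def mon_def)
  ultimately show "v \<in> mon V (d - sum w (U - V))" using v by (auto simp: fib_def mon_def)
qed

lemma fib_empty:
  assumes S: "S \<subseteq> mon U d" and w: "\<And>l. l \<notin> U - V \<Longrightarrow> w l = 0" "d < sum w (U - V)"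
  shows "fib V S w = {}"
proof (rule ccontr)
  assume "fib V S w \<noteq> {}"
  then obtain v where v: "\<And>l. l \<notin> V \<Longrightarrow> v l = 0" "padd w v \<in> S" by (auto simp: fib_def)
  have "sum (padd w v) U = sum w (U - V) + sum v V" using v w by (intro sum_padd) auto
  moreover have "sum (padd w v) U = d" using v S by (auto simp: mon_def)
  ultimately show False using w by simp
qed

lemma finite_fib: "S \<subseteq> mon U d \<Longrightarrow> w \<in> bases (U - V) d \<Longrightarrow> finite (fib V S w)"
  using finite_subset[OF fib_subset finite_mon[OF finV]] .

lemma restr_bases: "u \<in> mon U d \<Longrightarrow> restr (U - V) u \<in> bases (U - V) d"
  using sum_split[of u] by (auto simp: mon_def bases_def restr_def)

lemma padd_restr: "u \<in> mon U d \<Longrightarrow> padd (restr (U - V) u) (restr V u) = u"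
  using VU by (auto simp: mon_def padd_def restr_def fun_eq_iff)

lemma restr_in_fib: "u \<in> S \<Longrightarrow> S \<subseteq> mon U d \<Longrightarrow> restr V u \<in> fib V S (restr (U - V) u)"
  using padd_restr[of u] by (auto simp: fib_def restr_def)

lemma padd_unique:
  assumes "padd w v = padd w' v'"
    "\<And>l. l \<notin> U - V \<Longrightarrow> w l = 0" "\<And>l. l \<notin> U - V \<Longrightarrow> w' l = 0"
    "\<And>l. l \<notin> V \<Longrightarrow> v l = 0" "\<And>l. l \<notin> V \<Longrightarrow> v' l = 0"
  shows "w = w'"
proof
  fix l
  have "w l + v l = w' l + v' l" using assms(1) by (metis padd_def)
  then show "w l = w' l" using assms(2-)[of l] by (cases "l \<in> V") auto
qed

lemma sum_fibers:
  assumes S: "S \<subseteq> mon U d" and D: "d \<le> D"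
  shows "sum f S = (\<Sum>w\<in>bases (U - V) D. \<Sum>v\<in>fib V S w. f (padd w v))"
proof -
  have fin: "finite (fib V S w)" if "w \<in> bases (U - V) D" for w
  proof (cases "sum w (U - V) \<le> d")
    case True
    then show ?thesis using that by (intro finite_fib[OF S]) (auto simp: bases_def)
  next
    case False
    then show ?thesis using fib_empty[OF S, of w] that by (auto simp: bases_def)
  qed
  have "(\<Sum>w\<in>bases (U - V) D. \<Sum>v\<in>fib V S w. f (padd w v)) =
      (\<Sum>(w, v)\<in>Sigma (bases (U - V) D) (fib V S). f (padd w v))"
    using fin finite_bases[of "U - V" D] U by (intro sum.Sigma) auto
  also have "\<dots> = sum f S"
  proof (rule sum.reindex_bij_witness[where i = "\<lambda>u. (restr (U - V) u, restr V u)" and j = "\<lambda>(w, v). padd w v"])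
    fix a assume a: "a \<in> Sigma (bases (U - V) D) (fib V S)"
    obtain w v where wv: "a = (w, v)" by (cases a)
    with a have 1: "\<And>l. l \<notin> U - V \<Longrightarrow> w l = 0" and 2: "\<And>l. l \<notin> V \<Longrightarrow> v l = 0" and 3: "padd w v \<in> S"
      by (auto simp: bases_def fib_def)
    show "(restr (U - V) (case a of (w, v) \<Rightarrow> padd w v), restr V (case a of (w, v) \<Rightarrow> padd w v)) = a"
      using 1 2 VU by (auto simp: wv restr_def padd_def fun_eq_iff)
    show "(case a of (w, v) \<Rightarrow> padd w v) \<in> S" using 3 by (simp add: wv)
    show "f (case a of (w, v) \<Rightarrow> padd w v) = (case a of (w, v) \<Rightarrow> f (padd w v))" by (simp add: wv)
  next
    fix u assume u: "u \<in> S"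
    then have um: "u \<in> mon U d" using S by blast
    show "(case (restr (U - V) u, restr V u) of (w, v) \<Rightarrow> padd w v) = u" using padd_restr[OF um] by simp
    have "restr (U - V) u \<in> bases (U - V) D" using restr_bases[OF um] D by (simp add: bases_def)
    then show "(restr (U - V) u, restr V u) \<in> Sigma (bases (U - V) D) (fib V S)"
      using restr_in_fib[OF u S] by simp
  qed
  finally show ?thesis by simp
qed

lemma card_fibers:
  assumes "S \<subseteq> mon U d" "d \<le> D"
  shows "card S = (\<Sum>w\<in>bases (U - V) D. card (fib V S w))"
  using sum_fibers[OF assms, of "\<lambda>_. 1::nat"] by simp

lemma card_fib_le:
  assumes S: "S \<subseteq> mon U d" and w: "w \<in> bases (U - V) d"
  shows "card (fib V S w) \<le> card (mon V (d - sum w (U - V)))"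
  using card_mono[OF finite_mon[OF finV] fib_subset[OF S w]] .

lemma seg_fib:
  assumes S: "S \<subseteq> mon U d" and w: "w \<in> bases (U - V) d"
  shows "lexseg V (d - sum w (U - V)) (seg V (d - sum w (U - V)) (card (fib V S w)))"
    and "card (seg V (d - sum w (U - V)) (card (fib V S w))) = card (fib V S w)"
  using lexseg_seg[OF finV card_fib_le[OF S w]] card_seg[OF finV card_fib_le[OF S w]] by auto

lemma compress_subset: assumes S: "S \<subseteq> mon U d" shows "compress U V d S \<subseteq> mon U d"
proof
  fix u assume "u \<in> compress U V d S"
  then obtain w v where w: "w \<in> bases (U - V) d" and v: "v \<in> seg V (d - sum w (U - V)) (card (fib V S w))"
    and u: "u = padd w v" by (auto simp: compress_def)
  have "v \<in> mon V (d - sum w (U - V))" using v lexseg_mon[OF seg_fib(1)[OF S w]] by blast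
  then show "u \<in> mon U d" unfolding u by (rule padd_in_mon[OF w])
qed

lemma fib_compress:
  assumes S: "S \<subseteq> mon U d" and w: "w \<in> bases (U - V) d"
  shows "fib V (compress U V d S) w = seg V (d - sum w (U - V)) (card (fib V S w))"
proof (intro equalityI subsetI)
  fix v assume v: "v \<in> fib V (compress U V d S) w"
  then obtain w' v' where w': "w' \<in> bases (U - V) d"
    and v': "v' \<in> seg V (d - sum w' (U - V)) (card (fib V S w'))" and eq: "padd w v = padd w' v'"
    by (auto simp: compress_def fib_def)
  have mv': "v' \<in> mon V (d - sum w' (U - V))" using v' lexseg_mon[OF seg_fib(1)[OF S w']] by blast
  have "w = w'" using w w' v mv' by (intro padd_unique[OF eq]) (auto simp: bases_def fib_def mon_def)
  then show "v \<in> seg V (d - sum w (U - V)) (card (fib V S w))" using v' eq by simp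
next
  fix v assume v: "v \<in> seg V (d - sum w (U - V)) (card (fib V S w))"
  then have "v \<in> mon V (d - sum w (U - V))" using lexseg_mon[OF seg_fib(1)[OF S w]] by blast
  then show "v \<in> fib V (compress U V d S) w" using v w by (auto simp: fib_def compress_def mon_def)
qed

lemma lexseg_compress:
  assumes S: "S \<subseteq> mon U d" and w: "w \<in> bases (U - V) d"
  shows "lexseg V (d - sum w (U - V)) (fib V (compress U V d S) w)"
    and "card (fib V (compress U V d S) w) = card (fib V S w)"
  using seg_fib[OF S w] by (simp_all add: fib_compress[OF S w])

lemma card_compress: assumes S: "S \<subseteq> mon U d" shows "card (compress U V d S) = card S"
  unfolding card_fibers[OF S order_refl] card_fibers[OF compress_subset[OF S] order_refl]
  by (rule sum.cong) (simp_all add: lexseg_compress[OF S])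

text \<open>A variable of \<open>V\<close> stays in the fiber over \<open>w\<close>. A variable
  \<open>k\<close> outside \<open>V\<close> leads there from the fiber over \<open>dec k w\<close>
  without changing the part in \<open>V\<close>.\<close>

lemma fib_shadow:
  assumes S: "S \<subseteq> mon U d" and w: "\<And>l. l \<notin> U - V \<Longrightarrow> w l = 0"
  shows "fib V (shadow U S) w = shadow V (fib V S w) \<union> (\<Union>k\<in>{k. 0 < w k}. fib V S (dec k w))"
proof (intro equalityI subsetI)
  fix v assume "v \<in> fib V (shadow U S) w"
  then have v: "\<And>l. l \<notin> V \<Longrightarrow> v l = 0" and sh: "padd w v \<in> shadow U S" by (auto simp: fib_def)
  obtain k where k: "k \<in> U" "0 < padd w v k" "dec k (padd w v) \<in> S" using shadowE[OF sh] .
  show "v \<in> shadow V (fib V S w) \<union> (\<Union>k\<in>{k. 0 < w k}. fib V S (dec k w))"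
  proof (cases "k \<in> V")
    case True
    then have wk: "w k = 0" using w by simp
    then have vk: "0 < v k" using k by (simp add: padd_def)
    have "dec k (padd w v) = padd w (dec k v)" using wk by (auto simp: padd_def dec_apply)
    then have "dec k v \<in> fib V S w" using k v by (auto simp: fib_def dec_apply)
    then have "v \<in> shadow V (fib V S w)" using True vk shadowI_dec by blast
    then show ?thesis ..
  next
    case False
    then have vk: "v k = 0" using v by simp
    then have wk: "0 < w k" using k by (simp add: padd_def)
    have "dec k (padd w v) = padd (dec k w) v" using vk by (auto simp: padd_def dec_apply)
    then have "v \<in> fib V S (dec k w)" using k v by (auto simp: fib_def)
    then show ?thesis using wk by blast
  qed
next
  fix v assume "v \<in> shadow V (fib V S w) \<union> (\<Union>k\<in>{k. 0 < w k}. fib V S (dec k w))"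
  then show "v \<in> fib V (shadow U S) w"
  proof
    assume "v \<in> shadow V (fib V S w)"
    then obtain k u where k: "k \<in> V" "u \<in> fib V S w" "v = mult k u" by (auto simp: shadow_def)
    then have "padd w v \<in> shadow U S" using VU by (auto simp: padd_mult fib_def intro: shadowI)
    then show ?thesis using k by (auto simp: fib_def mult_apply)
  next
    assume "v \<in> (\<Union>k\<in>{k. 0 < w k}. fib V S (dec k w))"
    then obtain k where k: "0 < w k" "v \<in> fib V S (dec k w)" by auto
    then have "k \<in> U" using w[of k] by auto
    then have "padd w v \<in> shadow U S" using k by (auto simp: padd_mult_dec fib_def intro: shadowI)
    then show ?thesis using k by (auto simp: fib_def)
  qed
qed

end

text \<open>Segments of one degree form a chain, so a finite union of them is its largest
  member.\<close>

lemma lexseg_Union: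
  assumes V: "finite V" and F: "\<And>X. X \<in> F \<Longrightarrow> lexseg V d X" and ne: "F \<noteq> {}"
  shows "\<Union>F \<in> F"
proof -
  have "F \<subseteq> Pow (mon V d)" using F lexseg_mon by blast
  then have fin: "finite F" using finite_mon[OF V] by (meson finite_Pow_iff finite_subset)
  show ?thesis using fin ne F
  proof (induction F rule: finite_ne_induct)
    case (insert X F)
    then have "\<Union>F \<in> F" "lexseg V d X" by auto
    moreover have "lexseg V d (\<Union>F)" using insert calculation by blast
    ultimately have "X \<subseteq> \<Union>F \<or> \<Union>F \<subseteq> X" by (metis lexseg_comparable)
    then show ?case using \<open>\<Union>F \<in> F\<close> by (metis Sup_insert insertCI sup.absorb_iff1 sup.absorb_iff2)
  qed simp
qed

text \<open>Macaulay's theorem for the variables \<open>V\<close>, as a predicate that can be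
  assumed for smaller sets of variables in the induction.\<close>

definition macaulay :: "nat set \<Rightarrow> bool" where
  "macaulay V \<longleftrightarrow> (\<forall>d S T. S \<subseteq> mon V d \<longrightarrow> lexseg V d T \<longrightarrow> card T \<le> card S \<longrightarrow>
     card (shadow V T) \<le> card (shadow V S))"

lemma macaulayD:
  "macaulay V \<Longrightarrow> S \<subseteq> mon V d \<Longrightarrow> lexseg V d T \<Longrightarrow> card T \<le> card S \<Longrightarrow>
     card (shadow V T) \<le> card (shadow V S)"
  by (simp add: macaulay_def)

text \<open>Gotzmann sets, for which Macaulay's lower bound on the shadow is attained.\<close>

definition gotzmann :: "nat set \<Rightarrow> nat \<Rightarrow> (nat \<Rightarrow> nat) set \<Rightarrow> bool" where
  "gotzmann V d S \<longleftrightarrow> S \<subseteq> mon V d \<and> card (shadow V S) = card (shadow V (seg V d (card S)))"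

context
  fixes U V :: "nat set" and d :: nat
  assumes U: "finite U" and VU: "V \<subseteq> U" and mac: "macaulay V"
begin

text \<open>By \<open>fib_shadow\<close> a fiber of the shadow is a union of pieces. After
  compression the pieces are segments of one degree, so one of them is the whole fiber, and it is no
  larger than the corresponding piece before compression. Equality leaves the other pieces nothing
  to add.\<close>

lemma compress_fiber:
  assumes S: "S \<subseteq> mon U d" and w: "w \<in> bases (U - V) (Suc d)"
  defines "X \<equiv> fib V (shadow U S) w" and "X' \<equiv> fib V (shadow U (compress U V d S)) w"
  shows "lexseg V (Suc d - sum w (U - V)) X'"
    and "card X' \<le> card X"
    and "card X' = card X \<Longrightarrow>
      (X = shadow V (fib V S w) \<and> (w \<in> bases (U - V) d \<longrightarrow> gotzmann V (d - sum w (U - V)) (fib V S w))) \<or>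
      (\<exists>k. 0 < w k \<and> X = fib V S (dec k w))"
proof -
  let ?C = "compress U V d S"
  let ?e = "Suc d - sum w (U - V)"
  have V: "finite V" using finite_subset[OF VU U] .
  have C: "?C \<subseteq> mon U d" using compress_subset[OF U VU S] .
  have w0: "\<And>l. l \<notin> U - V \<Longrightarrow> w l = 0" using w by (auto simp: bases_def)
  define A where "A = shadow V (fib V S w)"
  define A' where "A' = shadow V (fib V ?C w)"
  have X: "X = A \<union> (\<Union>k\<in>{k. 0 < w k}. fib V S (dec k w))"
    unfolding X_def A_def using fib_shadow[OF U VU S w0] by simp
  have X': "X' = \<Union>(insert A' ((\<lambda>k. fib V ?C (dec k w)) ` {k. 0 < w k}))"
    unfolding X'_def A'_def using fib_shadow[OF U VU C w0] by simp
  have "X \<subseteq> mon V ?e" unfolding X_def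
    by (rule fib_subset[OF U VU _ w]) (rule shadow_subset[OF U S])
  then have finX: "finite X" using finite_subset finite_mon[OF V] by blast
  have decw: "dec k w \<in> bases (U - V) d" "d - sum (dec k w) (U - V) = ?e" if k: "0 < w k" for k
  proof -
    have kU: "k \<in> U - V" using w0[of k] k by auto
    have "Suc (sum (dec k w) (U - V)) = sum w (U - V)"
      using sum_mult[of "U - V" k "dec k w"] kU U k by (simp add: mult_dec)
    then show "dec k w \<in> bases (U - V) d" "d - sum (dec k w) (U - V) = ?e"
      using w by (auto simp: bases_def dec_apply)
  qed
  have B: "lexseg V ?e (fib V ?C (dec k w))" "card (fib V ?C (dec k w)) = card (fib V S (dec k w))"
    if k: "0 < w k" for k
    using lexseg_compress[OF U VU S decw(1)[OF k]] by (simp_all add: decw(2)[OF k])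
  have A': "lexseg V ?e A' \<and> card A' \<le> card A \<and>
      (w \<in> bases (U - V) d \<longrightarrow> A' = shadow V (seg V (d - sum w (U - V)) (card (fib V S w))))"
  \<comment> \<open>If \<open>w\<close> already has degree \<open>Suc d\<close>, nothing of
    \<open>S\<close> lies over it and this piece is empty.\<close>
  proof (cases "sum w (U - V) \<le> d")
    case True
    then have w': "w \<in> bases (U - V) d" using w by (simp add: bases_def)
    have "lexseg V (Suc (d - sum w (U - V))) A'" unfolding A'_def
      by (rule lexseg_shadow[OF V lexseg_compress(1)[OF U VU S w']])
    moreover have "card A' \<le> card A" unfolding A_def A'_def
      by (rule macaulayD[OF mac fib_subset[OF U VU S w'] lexseg_compress(1)[OF U VU S w']])
        (simp add: lexseg_compress(2)[OF U VU S w'])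
    ultimately show ?thesis using True by (simp add: Suc_diff_le A'_def fib_compress[OF U VU S w'])
  next
    case False
    then have "fib V ?C w = {}" using fib_empty[OF U VU C w0] by simp
    then show ?thesis using False by (simp add: A'_def lexseg_empty bases_def)
  qed
  have in_F: "X' \<in> insert A' ((\<lambda>k. fib V ?C (dec k w)) ` {k. 0 < w k})"
    unfolding X' using A' B by (intro lexseg_Union[OF V]) auto
  show "lexseg V ?e X'" using in_F A' B by auto
  consider "X' = A'" | k where "0 < w k" "X' = fib V ?C (dec k w)" using in_F by auto
  then have "card X' \<le> card X \<and> (card X' = card X \<longrightarrow>
      (X = A \<and> card A = card A') \<or> (\<exists>k. 0 < w k \<and> X = fib V S (dec k w)))"
  proof cases
    case 1
    have "A \<subseteq> X" unfolding X by blast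
    then have "card A \<le> card X" "card A = card X \<Longrightarrow> A = X"
      using card_mono[OF finX] card_subset_eq[OF finX] by auto
    then show ?thesis using 1 A' by fastforce
  next
    case 2
    have "fib V S (dec k w) \<subseteq> X" unfolding X using 2 by blast
    then have "card (fib V S (dec k w)) \<le> card X"
        "card (fib V S (dec k w)) = card X \<Longrightarrow> fib V S (dec k w) = X"
      using card_mono[OF finX] card_subset_eq[OF finX] by auto
    then show ?thesis using 2 B(2)[OF 2(1)] by auto
  qed
  then show "card X' \<le> card X"
    and "card X' = card X \<Longrightarrow>
      (X = shadow V (fib V S w) \<and> (w \<in> bases (U - V) d \<longrightarrow> gotzmann V (d - sum w (U - V)) (fib V S w))) \<or>
      (\<exists>k. 0 < w k \<and> X = fib V S (dec k w))"
    using A' fib_subset[OF U VU S] by (auto simp: A_def gotzmann_def)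
qed

lemma card_shadow_compress_le:
  assumes S: "S \<subseteq> mon U d"
  shows "card (shadow U (compress U V d S)) \<le> card (shadow U S)"
  unfolding card_fibers[OF U VU shadow_subset[OF U S] order_refl]
    card_fibers[OF U VU shadow_subset[OF U compress_subset[OF U VU S]] order_refl]
  by (rule sum_mono) (rule compress_fiber(2)[OF S])

text \<open>No fiber grows under compression, so equal totals force equality in every fiber.\<close>

lemma card_fib_shadow_compress_eq:
  assumes S: "S \<subseteq> mon U d" and eq: "card (shadow U (compress U V d S)) = card (shadow U S)"
    and w: "w \<in> bases (U - V) (Suc d)"
  shows "card (fib V (shadow U (compress U V d S)) w) = card (fib V (shadow U S) w)"
proof (rule ccontr)
  assume ne: "card (fib V (shadow U (compress U V d S)) w) \<noteq> card (fib V (shadow U S) w)"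
  have fin: "finite (bases (U - V) (Suc d))" using finite_bases U by simp
  have "(\<Sum>w\<in>bases (U - V) (Suc d). card (fib V (shadow U (compress U V d S)) w)) <
      (\<Sum>w\<in>bases (U - V) (Suc d). card (fib V (shadow U S) w))"
    using compress_fiber(2)[OF S] w ne
    by (intro sum_strict_mono_ex1[OF fin]) (auto simp: order_less_le)
  then show False using eq
    unfolding card_fibers[OF U VU shadow_subset[OF U S] order_refl]
      card_fibers[OF U VU shadow_subset[OF U compress_subset[OF U VU S]] order_refl] by simp
qed

lemma fib_shadow_cases:
  assumes S: "S \<subseteq> mon U d" and eq: "card (shadow U (compress U V d S)) = card (shadow U S)"
    and w: "w \<in> bases (U - V) (Suc d)"
  shows "(fib V (shadow U S) w = shadow V (fib V S w) \<and>
        (w \<in> bases (U - V) d \<longrightarrow> gotzmann V (d - sum w (U - V)) (fib V S w))) \<or>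
      (\<exists>k. 0 < w k \<and> fib V (shadow U S) w = fib V S (dec k w))"
  by (rule compress_fiber(3)[OF S w card_fib_shadow_compress_eq[OF S eq w]])

end

lemma gotzmann_lexseg: "finite V \<Longrightarrow> lexseg V d T \<Longrightarrow> gotzmann V d T"
  by (simp add: gotzmann_def seg_card lexseg_mon)

lemma gotzmann_card:
  "finite V \<Longrightarrow> gotzmann V d S \<Longrightarrow> lexseg V d T \<Longrightarrow> card T = card S \<Longrightarrow> card (shadow V S) = card (shadow V T)"
  unfolding gotzmann_def by (metis seg_card)

lemma gotzI:
  assumes V: "finite V" and mac: "macaulay V" and S: "S \<subseteq> mon V d" and T: "lexseg V d T" "card T = card S"
    and le: "card (shadow V S) \<le> card (shadow V T)"
  shows "gotzmann V d S"
  using macaulayD[OF mac S T(1)] T le S seg_card[OF V T(1)] unfolding gotzmann_def by simp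

lemma gotzmann_shadow_le:
  assumes V: "finite V" and mac: "macaulay V" and S: "gotzmann V d S" and S': "S' \<subseteq> mon V d" "card S' = card S"
  shows "card (shadow V S) \<le> card (shadow V S')"
proof -
  have n: "card S \<le> card (mon V d)" using S by (auto simp: gotzmann_def intro: card_mono finite_mon[OF V])
  show ?thesis using macaulayD[OF mac S'(1) lexseg_seg[OF V n]] card_seg[OF V n] S S' by (simp add: gotzmann_def)
qed

text \<open>With at most one variable, each degree has at most one monomial.\<close>

lemma lexseg_small:
  assumes U: "finite U" "card U \<le> 1" and S: "S \<subseteq> mon U d" shows "lexseg U d S"
proof -
  have eq: "u = v" if uv: "u \<in> mon U d" "v \<in> mon U d" for u v
  proof (cases "U = {}")
    case True
    then show ?thesis using uv by (auto simp: mon_def)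
  next
    case False
    then have "card U = 1" using U by (simp add: card_gt_0_iff le_antisym Suc_leI)
    then obtain x where "U = {x}" by (auto simp: card_1_singleton_iff)
    then show ?thesis using uv by (auto simp: mon_def fun_eq_iff) metis
  qed
  show ?thesis unfolding lexseg_def
  proof (intro conjI ballI impI)
    fix u v assume "u \<in> S" "v \<in> mon U d" "lex_less u v"
    then show "v \<in> S" using eq[of u v] S by auto
  qed (rule S)
qed

section \<open>Two variables\<close>

text \<open>In a fixed degree a monomial in two variables is given by one exponent. A set becomes a
  set \<open>N\<close> of numbers, and its shadow becomes \<open>N\<close> together with
  \<open>N\<close> shifted by 1.\<close>

abbreviation exps :: "nat \<Rightarrow> (nat \<Rightarrow> nat) set \<Rightarrow> nat set" where
  "exps l S \<equiv> (\<lambda>u. u l) ` S"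

context
  fixes k l :: nat assumes kl: "k \<noteq> l"
begin

lemma inj_pair: "inj_on (\<lambda>u. u l) (mon {k, l} e)"
proof (rule inj_onI)
  fix u v assume uv: "u \<in> mon {k, l} e" "v \<in> mon {k, l} e" "u l = v l"
  then have "u k = v k" using kl by (simp add: mon_def)
  then have "u i = v i" for i using uv by (cases "i = k"; cases "i = l") (auto simp: mon_def)
  then show "u = v" by (rule ext)
qed

lemma card_pair: "S \<subseteq> mon {k, l} e \<Longrightarrow> card S = card (exps l S)"
  using card_image[OF inj_on_subset[OF inj_pair]] by metis

lemma shadow_pair: "exps l (shadow {k, l} S) = exps l S \<union> Suc ` exps l S"
proof (intro equalityI subsetI)
  fix x assume "x \<in> exps l S \<union> Suc ` exps l S"
  then obtain u where u: "u \<in> S" "x = u l \<or> x = Suc (u l)" by auto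
  have "mult k u \<in> shadow {k, l} S" "mult l u \<in> shadow {k, l} S" using u(1) by (auto intro: shadowI)
  then have "mult k u l \<in> exps l (shadow {k, l} S)" "mult l u l \<in> exps l (shadow {k, l} S)" by blast+
  moreover have "x = mult k u l \<or> x = mult l u l" using kl u(2) by (auto simp: mult_apply)
  ultimately show "x \<in> exps l (shadow {k, l} S)" by blast
qed (use kl in \<open>auto simp: shadow_def mult_apply\<close>)

lemma card_shadow_pair:
  assumes "S \<subseteq> mon {k, l} e"
  shows "card (shadow {k, l} S) = card (exps l S \<union> Suc ` exps l S)"
  using card_pair[OF shadow_subset[OF _ assms]] by (simp add: shadow_pair)

lemma card_shadow_pair_ge:
  assumes S: "S \<subseteq> mon {k, l} e" "S \<noteq> {}"
  shows "Suc (card S) \<le> card (shadow {k, l} S)"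
proof -
  let ?N = "exps l S"
  have fin: "finite ?N" using finite_subset[OF S(1) finite_mon] by simp
  have "Suc (Max ?N) \<notin> ?N" using Max_ge[OF fin] by (meson Suc_n_not_le_n)
  then have "Suc (card ?N) = card (insert (Suc (Max ?N)) ?N)" using fin by simp
  also have "\<dots> \<le> card (?N \<union> Suc ` ?N)" using fin S(2) Max_in[OF fin] by (intro card_mono) auto
  finally show ?thesis using card_shadow_pair[OF S(1)] card_pair[OF S(1)] by simp
qed

text \<open>The hole at \<open>b + 1\<close> is filled by the shift of \<open>b\<close>; with the
  successor of the maximum this makes two new exponents.\<close>

lemma card_shadow_pair_gap:
  assumes S: "S \<subseteq> mon {k, l} e" and u: "u \<in> S" "u l = b" and v: "v \<in> S" "v l = b + 2"
    and no: "\<And>x. x \<in> S \<Longrightarrow> x l \<noteq> b + 1"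
  shows "Suc (Suc (card S)) \<le> card (shadow {k, l} S)"
proof -
  let ?N = "exps l S"
  have fin: "finite ?N" using finite_subset[OF S finite_mon] by simp
  have Nb: "b \<in> ?N" using u by blast
  then have Nmax: "Max ?N \<in> ?N" using Max_in[OF fin] by blast
  have v': "b + 2 \<le> Max ?N" using Max_ge[OF fin imageI[OF v(1)]] v by simp
  have "Suc (Max ?N) \<notin> ?N" using Max_ge[OF fin] by (meson Suc_n_not_le_n)
  moreover have "Suc b \<notin> ?N" using no by (metis Suc_eq_plus1 imageE)
  ultimately have "Suc (Suc (card ?N)) = card (insert (Suc b) (insert (Suc (Max ?N)) ?N))"
    using fin v' by simp
  also have "\<dots> \<le> card (?N \<union> Suc ` ?N)"
    using fin Nb Nmax by (intro card_mono) (auto intro!: imageI)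
  finally show ?thesis using card_shadow_pair[OF S] card_pair[OF S] by simp
qed

text \<open>The exponents of the smaller variable \<open>l\<close> in a segment are closed
  downwards, so the shift adds only the successor of the maximum.\<close>

lemma card_shadow_pair_lexseg:
  assumes T: "lexseg {k, l} e T" and "k < l"
  shows "card (shadow {k, l} T) \<le> Suc (card T)"
proof (cases "T = {}")
  case False
  let ?N = "exps l T"
  have Tm: "T \<subseteq> mon {k, l} e" using lexseg_mon[OF T] .
  have fin: "finite ?N" using finite_subset[OF Tm finite_mon] by simp
  have down: "b' \<in> ?N" if b: "b \<in> ?N" "b' < b" for b b'
  proof -
    obtain u where u: "u \<in> T" "u l = b" using b by auto
    define v where "v = u(l := b', k := u k + (b - b'))"
    have "v \<in> mon {k, l} e" using u Tm b(2) kl by (auto simp: mon_def v_def)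
    moreover have "lex_less u v" using \<open>k < l\<close> b(2)
      by (intro lex_lessI[of _ k]) (auto simp: v_def)
    ultimately have "v \<in> T" using lexsegD[OF T u(1)] by blast
    moreover have "v l = b'" using kl by (simp add: v_def)
    ultimately show ?thesis by blast
  qed
  have "Max ?N \<in> ?N" using Max_in[OF fin] False by simp
  have "Suc ` ?N \<subseteq> insert (Suc (Max ?N)) ?N"
  proof (rule image_subsetI)
    fix x assume x: "x \<in> ?N"
    then have "x \<le> Max ?N" using Max_ge[OF fin] by simp
    then show "Suc x \<in> insert (Suc (Max ?N)) ?N"
      using down[OF \<open>Max ?N \<in> ?N\<close>, of "Suc x"] \<open>Max ?N \<in> ?N\<close> by (cases "x = Max ?N"; cases "Suc x = Max ?N") auto
  qed
  then have "card (?N \<union> Suc ` ?N) \<le> card (insert (Suc (Max ?N)) ?N)" using fin by (intro card_mono) auto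
  also have "\<dots> \<le> Suc (card ?N)" by (simp add: card_insert_if fin)
  finally show ?thesis using card_shadow_pair[OF Tm] card_pair[OF Tm] by simp
qed simp

end

lemma card_shadow_lexseg_pair:
  assumes kl: "k \<noteq> l" and T: "lexseg {k, l} e T" "T \<noteq> {}"
  shows "card (shadow {k, l} T) = Suc (card T)"
proof -
  have "card (shadow {k, l} T) \<le> Suc (card T)"
  proof (cases "k < l")
    case True
    then show ?thesis using card_shadow_pair_lexseg[OF kl T(1)] by simp
  next
    case False
    have kl': "{k, l} = {l, k}" by auto
    show ?thesis unfolding kl' using card_shadow_pair_lexseg[of l k e T] False kl T(1)
      by (simp add: kl')
  qed
  then show ?thesis using card_shadow_pair_ge[OF kl lexseg_mon[OF T(1)] T(2)] by simp
qed

lemma macaulay_pair: assumes kl: "k \<noteq> l" shows "macaulay {k, l}"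
  unfolding macaulay_def
proof (intro allI impI)
  fix d S T assume S: "S \<subseteq> mon {k, l} d" and T: "lexseg {k, l} d T" and le: "card T \<le> card S"
  show "card (shadow {k, l} T) \<le> card (shadow {k, l} S)"
  proof (cases "T = {}")
    case False
    then have "0 < card T" using lexseg_finite[OF _ T] by (simp add: card_gt_0_iff)
    then have "S \<noteq> {}" using le by auto
    then show ?thesis using card_shadow_pair_ge[OF kl S] card_shadow_lexseg_pair[OF kl T False] le by simp
  qed simp
qed

lemma gotzmann_pair_iff:
  assumes kl: "k \<noteq> l" and S: "S \<subseteq> mon {k, l} e" "S \<noteq> {}"
  shows "gotzmann {k, l} e S \<longleftrightarrow> card (shadow {k, l} S) = Suc (card S)"
proof -
  have n: "card S \<le> card (mon {k, l} e)" using card_mono[OF finite_mon S(1)] by simp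
  have "0 < card S" using S finite_subset[OF S(1) finite_mon] by (simp add: card_gt_0_iff)
  then have "seg {k, l} e (card S) \<noteq> {}" using card_seg[OF _ n] by fastforce
  then show ?thesis
    using card_shadow_lexseg_pair[OF kl lexseg_seg[OF _ n]] card_seg[OF _ n] S(1) by (simp add: gotzmann_def)
qed

lemma gotzmann_pair_no_gap:
  assumes kl: "k \<noteq> l" and S: "gotzmann {k, l} e S" and u: "u \<in> S" "u l = b" and v: "v \<in> S" "v l = b + 2"
  shows "\<exists>x\<in>S. x l = b + 1"
proof (rule ccontr)
  assume no: "\<not> ?thesis"
  have Sm: "S \<subseteq> mon {k, l} e" using S by (simp add: gotzmann_def)
  then have "card (shadow {k, l} S) = Suc (card S)" using gotzmann_pair_iff[OF kl] S u(1) by blast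
  then show False using card_shadow_pair_gap[OF kl Sm u v] no by auto
qed

section \<open>Repeated compression\<close>

text \<open>A monomial of \<open>B\<close> outside the segment \<open>T\<close> is lexicographically
  below all of \<open>T\<close>, so exchanging \<open>B - T\<close> for \<open>T - B\<close> along
  any bijection lowers \<open>f\<close> term by term.\<close>

lemma sum_lexseg_le:
  fixes f :: "(nat \<Rightarrow> nat) \<Rightarrow> nat"
  assumes V: "finite V" and B: "B \<subseteq> mon V e" and T: "lexseg V e T" and eq: "card T = card B"
    and f: "\<And>u v. u \<in> mon V e \<Longrightarrow> v \<in> mon V e \<Longrightarrow> lex_less u v \<Longrightarrow> f v < f u"
  shows "sum f T \<le> sum f B" and "T \<noteq> B \<Longrightarrow> sum f T < sum f B"
proof -
  have fin: "finite B" "finite T" using finite_subset[OF B finite_mon[OF V]] lexseg_finite[OF V T] by auto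
  have c: "card (B - T) = card (T - B)" using eq fin
    by (metis card_Diff_subset_Int diff_diff_cancel finite_Int inf.commute)
  obtain h where h: "bij_betw h (B - T) (T - B)"
    using finite_same_card_bij[OF _ _ c] fin by auto
  have lt: "f (h b) < f b" if b: "b \<in> B - T" for b
  proof -
    have hb: "h b \<in> T - B" using h b by (auto simp: bij_betw_def)
    have mon: "h b \<in> mon V e" "b \<in> mon V e" using hb b B lexseg_mon[OF T] by auto
    have "lex_less b (h b)"
      using lex_less_linear[of b "h b"] hb b lexsegD[OF T, of "h b" b] mon by (metis DiffD1 DiffD2)
    then show ?thesis using f mon by blast
  qed
  have sumT: "sum f (T - B) = (\<Sum>b\<in>B - T. f (h b))" using sum.reindex_bij_betw[OF h] by metis
  have B': "sum f B = sum f (B \<inter> T) + sum f (B - T)" using sum.Int_Diff[OF fin(1)] .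
  have T': "sum f T = sum f (B \<inter> T) + sum f (T - B)" using sum.Int_Diff[OF fin(2), of f B] by (simp add: Int_commute)
  have "sum f (T - B) \<le> sum f (B - T)" unfolding sumT using lt by (intro sum_mono) (auto simp: less_imp_le)
  then show "sum f T \<le> sum f B" unfolding B' T' by simp
  assume "T \<noteq> B"
  then have "\<not> B \<subseteq> T" using card_subset_eq[OF fin(2)] eq by metis
  then have "sum f (T - B) < sum f (B - T)" unfolding sumT using lt fin by (intro sum_strict_mono) auto
  then show "sum f T < sum f B" unfolding B' T' by simp
qed

lemma lex_less_padd: "lex_less v v' \<Longrightarrow> lex_less (padd w v) (padd w v')"
proof -
  assume "lex_less v v'"
  then obtain i where "v i < v' i" "\<forall>j<i. v j = v' j" by (auto simp: lex_less_def)
  then show ?thesis unfolding lex_less_def padd_def by (intro exI[of _ i]) auto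
qed

text \<open>The position counted from the top; its sum over a set is the termination measure for
  repeated compression.\<close>

definition rank :: "nat set \<Rightarrow> nat \<Rightarrow> (nat \<Rightarrow> nat) \<Rightarrow> nat" where
  "rank U d u = card {v \<in> mon U d. lex_less u v}"

lemma rank_less:
  assumes U: "finite U" and "v \<in> mon U d" "lex_less u v" shows "rank U d v < rank U d u"
  unfolding rank_def
proof (rule psubset_card_mono)
  show "finite {v \<in> mon U d. lex_less u v}" using finite_mon[OF U] by simp
  have "v \<in> {x \<in> mon U d. lex_less u x} - {x \<in> mon U d. lex_less v x}" using assms by simp
  moreover have "{x \<in> mon U d. lex_less v x} \<subseteq> {x \<in> mon U d. lex_less u x}"
    using assms(3) lex_less_trans by blast
  ultimately show "{x \<in> mon U d. lex_less v x} \<subset> {x \<in> mon U d. lex_less u x}" by blast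
qed

lemma sum_rank_compress:
  assumes U: "finite U" and VU: "V \<subseteq> U" and S: "S \<subseteq> mon U d" and ne: "compress U V d S \<noteq> S"
  shows "sum (rank U d) (compress U V d S) < sum (rank U d) S"
proof -
  let ?C = "compress U V d S"
  have C: "?C \<subseteq> mon U d" using compress_subset[OF U VU S] .
  have V: "finite V" using finite_subset[OF VU U] .
  have f: "rank U d (padd w v') < rank U d (padd w v)"
    if "w \<in> bases (U - V) d" "v' \<in> mon V (d - sum w (U - V))" "lex_less v v'" for w v v'
    using rank_less[OF U padd_in_mon[OF U VU that(1,2)] lex_less_padd[OF that(3)]] .
  note le = sum_lexseg_le[OF V fib_subset[OF U VU S] lexseg_compress(1)[OF U VU S] lexseg_compress(2)[OF U VU S],
      where f = "\<lambda>v. rank U d (padd w v)" for w]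
  have "\<exists>w\<in>bases (U - V) d. fib V ?C w \<noteq> fib V S w"
  proof (rule ccontr)
    assume "\<not> ?thesis"
    then have eq: "fib V ?C w = fib V S w" if "w \<in> bases (U - V) d" for w using that by blast
    have "u \<in> ?C \<longleftrightarrow> u \<in> S" if u: "u \<in> mon U d" for u
    proof -
      have "u \<in> A \<longleftrightarrow> restr V u \<in> fib V A (restr (U - V) u)" for A
        unfolding fib_def using padd_restr[OF U VU u] by (simp add: restr_def)
      then show ?thesis using eq[OF restr_bases[OF U VU u]] by blast
    qed
    then show False using ne S C by blast
  qed
  then obtain w where w: "w \<in> bases (U - V) d" "fib V ?C w \<noteq> fib V S w" by blast
  have fin: "finite (bases (U - V) d)" using finite_bases U by simp
  have "(\<Sum>w\<in>bases (U - V) d. \<Sum>v\<in>fib V ?C w. rank U d (padd w v)) <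
      (\<Sum>w\<in>bases (U - V) d. \<Sum>v\<in>fib V S w. rank U d (padd w v))"
  proof (rule sum_strict_mono_ex1[OF fin])
    show "\<forall>w\<in>bases (U - V) d. (\<Sum>v\<in>fib V ?C w. rank U d (padd w v)) \<le> (\<Sum>v\<in>fib V S w. rank U d (padd w v))"
      using le(1) f by blast
    show "\<exists>w\<in>bases (U - V) d. (\<Sum>v\<in>fib V ?C w. rank U d (padd w v)) < (\<Sum>v\<in>fib V S w. rank U d (padd w v))"
      using le(2)[OF w(1) w(1) w(1)] f w by blast
  qed
  then show ?thesis
    unfolding sum_fibers[OF U VU S order_refl] sum_fibers[OF U VU C order_refl] .
qed

text \<open>Each compression that changes the set lowers the sum of ranks, so repetition ends in a
  set fixed by all compressions that leave out one variable.\<close>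

lemma compress_induct:
  assumes U: "finite U" and S: "S \<subseteq> mon U d"
    and full: "\<And>S. S \<subseteq> mon U d \<Longrightarrow> (\<And>l. l \<in> U \<Longrightarrow> compress U (U - {l}) d S = S) \<Longrightarrow> P S"
    and step: "\<And>S l. S \<subseteq> mon U d \<Longrightarrow> l \<in> U \<Longrightarrow> P (compress U (U - {l}) d S) \<Longrightarrow> P S"
  shows "P S"
  using S
proof (induction "sum (rank U d) S" arbitrary: S rule: less_induct)
  case less
  show ?case
  proof (cases "\<forall>l\<in>U. compress U (U - {l}) d S = S")
    case True
    then show ?thesis using full[OF less.prems] by blast
  next
    case False
    then obtain l where l: "l \<in> U" "compress U (U - {l}) d S \<noteq> S" by blast
    have sub: "U - {l} \<subseteq> U" by blast
    have "P (compress U (U - {l}) d S)"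
      by (rule less.hyps[OF sum_rank_compress[OF U sub less.prems l(2)] compress_subset[OF U sub less.prems]])
    then show ?thesis by (rule step[OF less.prems l(1)])
  qed
qed

abbreviation single :: "nat \<Rightarrow> nat \<Rightarrow> nat \<Rightarrow> nat" where
  "single l c \<equiv> (\<lambda>_. 0)(l := c)"

text \<open>The monomials with exponent \<open>c\<close> in variable \<open>l\<close>, recorded with
  that exponent reset to 0.\<close>

definition slice :: "nat set \<Rightarrow> nat \<Rightarrow> (nat \<Rightarrow> nat) set \<Rightarrow> nat \<Rightarrow> (nat \<Rightarrow> nat) set" where
  "slice U l S c = fib (U - {l}) S (single l c)"

lemma bases_slice: "l \<in> U \<Longrightarrow> single l c \<in> bases (U - (U - {l})) d \<longleftrightarrow> c \<le> d"
  by (simp add: bases_def Diff_Diff_Int)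

lemma sum_slice: "l \<in> U \<Longrightarrow> sum (single l c) (U - (U - {l})) = c"
  by (simp add: Diff_Diff_Int)

lemma in_slice: "v \<in> slice U l S c \<longleftrightarrow> (\<forall>i. i \<notin> U - {l} \<longrightarrow> v i = 0) \<and> v(l := c) \<in> S"
proof -
  have "v l = 0 \<Longrightarrow> padd (single l c) v = v(l := c)" by (auto simp: padd_def)
  then show ?thesis unfolding slice_def fib_def by auto
qed

lemma lexseg_slice:
  assumes U: "finite U" and l: "l \<in> U" and S: "S \<subseteq> mon U d" and eq: "compress U (U - {l}) d S = S" and c: "c \<le> d"
  shows "lexseg (U - {l}) (d - c) (slice U l S c)"
  using lexseg_compress(1)[OF U _ S, of "U - {l}" "single l c"] c
  unfolding bases_slice[OF l] sum_slice[OF l] eq slice_def by blast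

text \<open>With a third variable \<open>l\<close> held fixed, the move from \<open>j\<close> to
  \<open>i\<close> takes place inside one slice, which is a segment.\<close>

lemma compressed_stable:
  assumes U: "finite U" "3 \<le> card U" and S: "S \<subseteq> mon U d"
    and eq: "\<And>l. l \<in> U \<Longrightarrow> compress U (U - {l}) d S = S"
    and u: "u \<in> S" "i \<in> U" "j \<in> U" "i < j" "0 < u j"
  shows "mult i (dec j u) \<in> S"
proof -
  have "\<not> U \<subseteq> {i, j}" using card_mono[of "{i, j}" U] U(2) by (auto simp: card_insert_if split: if_splits)
  then obtain l where l: "l \<in> U" "l \<noteq> i" "l \<noteq> j" by blast
  have um: "u \<in> mon U d" using u S by blast
  have c: "u l \<le> d" using um member_le_sum[of l U u] l U by (simp add: mon_def)
  define v where "v = u(l := 0)"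
  have v: "v \<in> slice U l S (u l)" using um u(1) by (auto simp: in_slice v_def mon_def)
  have seg: "lexseg (U - {l}) (d - u l) (slice U l S (u l))" by (rule lexseg_slice[OF U(1) l(1) S eq[OF l(1)] c])
  have vm: "v \<in> mon (U - {l}) (d - u l)" using lexseg_mon[OF seg] v by blast
  define v' where "v' = mult i (dec j v)"
  have jl: "0 < v j" using u l by (simp add: v_def)
  obtain e where e: "d - u l = Suc e"
  proof (cases "d - u l")
    case 0
    then have "v j = 0" using vm u(3) l U by (simp add: mon_def)
    then show ?thesis using jl by simp
  qed (use that in blast)
  have "v' \<in> mon (U - {l}) (d - u l)" unfolding v'_def e
    using dec_in_mon[OF _ vm[unfolded e] jl] U l u by (intro mult_in_mon) auto
  moreover have "lex_less v v'" using u(4)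
    by (intro lex_lessI[of _ i]) (auto simp: v'_def mult_apply dec_apply)
  ultimately have "v' \<in> slice U l S (u l)" using lexsegD[OF seg v] by blast
  then have "v'(l := u l) \<in> S" by (simp add: in_slice)
  moreover have "v'(l := u l) = mult i (dec j u)" using l u
    by (auto simp: v'_def v_def mult_apply dec_apply fun_eq_iff)
  ultimately show ?thesis by simp
qed

section \<open>Macaulay's bound\<close>

text \<open>Closure under the Borel moves out of the single variable \<open>m\<close>, which will be
  the last one.\<close>

definition stable :: "nat set \<Rightarrow> nat \<Rightarrow> (nat \<Rightarrow> nat) set \<Rightarrow> bool" where
  "stable U m S \<longleftrightarrow> (\<forall>u\<in>S. \<forall>i\<in>U. i < m \<longrightarrow> 0 < u m \<longrightarrow> mult i (dec m u) \<in> S)"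

definition free_of :: "nat \<Rightarrow> (nat \<Rightarrow> nat) set \<Rightarrow> (nat \<Rightarrow> nat) set" where
  "free_of m S = {u \<in> S. u m = 0}"

lemma stableD: "stable U m S \<Longrightarrow> u \<in> S \<Longrightarrow> i \<in> U \<Longrightarrow> i < m \<Longrightarrow> 0 < u m \<Longrightarrow> mult i (dec m u) \<in> S"
  by (simp add: stable_def)

context
  fixes U :: "nat set" and m :: nat
  assumes U: "finite U" and m: "m \<in> U" and max: "\<And>i. i \<in> U \<Longrightarrow> i \<le> m"
begin

lemma free_of_mon: "S \<subseteq> mon U d \<Longrightarrow> free_of m S \<subseteq> mon (U - {m}) d"
  using m U by (auto simp: free_of_def mon_def sum.remove)

lemma free_of_lexseg:
  assumes T: "lexseg U d T" shows "lexseg (U - {m}) d (free_of m T)"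
  unfolding lexseg_def
proof (intro conjI ballI impI)
  show "free_of m T \<subseteq> mon (U - {m}) d" using free_of_mon[OF lexseg_mon[OF T]] .
  fix u v assume u: "u \<in> free_of m T" and v: "v \<in> mon (U - {m}) d" and uv: "lex_less u v"
  have "v \<in> mon U d" "v m = 0" using v m U by (auto simp: mon_def sum.remove)
  then show "v \<in> free_of m T" using lexsegD[OF T, of u v] u uv by (auto simp: free_of_def)
qed

lemma lexseg_stable:
  assumes T: "lexseg U d T" shows "stable U m T"
  unfolding stable_def
proof (intro ballI impI)
  fix u i assume u: "u \<in> T" and i: "i \<in> U" "i < m" "0 < u m"
  have um: "u \<in> mon U d" using u lexseg_mon[OF T] by blast
  obtain e where e: "d = Suc e"
  proof (cases d)
    case 0
    then have "u m = 0" using um m U by (simp add: mon_def)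
    then show ?thesis using i by simp
  qed (use that in blast)
  have "mult i (dec m u) \<in> mon U d" unfolding e
    using dec_in_mon[OF U um[unfolded e] i(3)] by (intro mult_in_mon[OF U i(1)])
  moreover have "lex_less u (mult i (dec m u))" using i
    by (intro lex_lessI[of _ i]) (auto simp: mult_apply dec_apply)
  ultimately show "mult i (dec m u) \<in> T" using lexsegD[OF T u] by blast
qed

text \<open>If \<open>m\<close> divides \<open>u\<close>, then a product of \<open>u\<close> with
  another variable is also \<open>m\<close> times a moved monomial, which stability keeps in
  \<open>S\<close>. The shadow thus splits into a copy of \<open>S\<close> and a shadow in fewer
  variables.\<close>

lemma shadow_stable:
  assumes st: "stable U m S"
  shows "shadow U S = mult m ` S \<union> shadow (U - {m}) (free_of m S)"
proof (intro equalityI subsetI)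
  fix x assume "x \<in> shadow U S"
  then obtain k u where k: "k \<in> U" "u \<in> S" "x = mult k u" by (auto simp: shadow_def)
  show "x \<in> mult m ` S \<union> shadow (U - {m}) (free_of m S)"
  proof (cases "k = m")
    case True
    then show ?thesis using k by blast
  next
    case False
    then have "k < m" using max[OF k(1)] by simp
    show ?thesis
    proof (cases "u m = 0")
      case True
      then show ?thesis using k False by (auto simp: free_of_def intro!: shadowI)
    next
      case 2: False
      have "x = mult m (mult k (dec m u))" using 2 k by (metis mult_commute mult_dec neq0_conv)
      then show ?thesis using stableD[OF st k(2,1) \<open>k < m\<close>] 2 by blast
    qed
  qed
next
  fix x assume "x \<in> mult m ` S \<union> shadow (U - {m}) (free_of m S)"
  then show "x \<in> shadow U S" using m by (auto simp: shadow_def free_of_def)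
qed

lemma card_shadow_stable:
  assumes st: "stable U m S" and S: "S \<subseteq> mon U d"
  shows "card (shadow U S) = card S + card (shadow (U - {m}) (free_of m S))"
proof -
  have fin: "finite S" using finite_subset[OF S finite_mon[OF U]] .
  have fin': "finite (shadow (U - {m}) (free_of m S))"
    using finite_subset[OF shadow_subset[OF _ free_of_mon[OF S]] finite_mon] U by simp
  have "card (shadow U S) = card (mult m ` S) + card (shadow (U - {m}) (free_of m S))"
    unfolding shadow_stable[OF st]
  proof (rule card_Un_disjoint)
    show "mult m ` S \<inter> shadow (U - {m}) (free_of m S) = {}"
      by (auto simp: shadow_def free_of_def mult_def fun_eq_iff split: if_splits)
  qed (use fin fin' in auto)
  also have "card (mult m ` S) = card S" by (intro card_image) (auto simp: inj_on_def)
  finally show ?thesis .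
qed

lemma stable_shadow:
  assumes st: "stable U m S" shows "stable U m (shadow U S)"
  unfolding stable_def
proof (intro ballI impI)
  fix x i assume x: "x \<in> shadow U S" and i: "i \<in> U" "i < m" "0 < x m"
  obtain k u where k: "k \<in> U" "u \<in> S" "x = mult k u" using x by (auto simp: shadow_def)
  show "mult i (dec m x) \<in> shadow U S"
  proof (cases "k = m")
    case True
    then show ?thesis using k i by (auto intro: shadowI)
  next
    case False
    then have um: "0 < u m" using i k by (auto simp: mult_apply)
    have "mult i (dec m x) = mult k (mult i (dec m u))"
      using False k by (simp add: mult_commute[of k i] mult_dec_commute)
    then show ?thesis using stableD[OF st k(2) i(1,2) um] k(1) by (auto intro: shadowI)
  qed
qed

lemma free_of_shadow: "free_of m (shadow U S) = shadow (U - {m}) (free_of m S)"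
proof (intro equalityI subsetI)
  fix x assume "x \<in> free_of m (shadow U S)"
  then obtain k u where k: "k \<in> U" "u \<in> S" "x = mult k u" "mult k u m = 0" by (auto simp: shadow_def free_of_def)
  then have "k \<noteq> m" "u m = 0" by (auto simp: mult_apply split: if_splits)
  then show "x \<in> shadow (U - {m}) (free_of m S)" using k by (auto simp: free_of_def intro!: shadowI)
next
  fix x assume "x \<in> shadow (U - {m}) (free_of m S)"
  then show "x \<in> free_of m (shadow U S)" by (auto simp: shadow_def free_of_def mult_apply)
qed

text \<open>Otherwise \<open>S\<close> would lie strictly inside \<open>T\<close>, because moving all of the last variable to the preceding
  one stays inside \<open>S\<close>.\<close>

lemma free_of_lexseg_subset:
  assumes S: "S \<subseteq> mon U d" and st: "stable U m S" and S0: "lexseg (U - {m}) d (free_of m S)"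
    and T: "lexseg U d T" and le: "card T \<le> card S" and ne: "U - {m} \<noteq> {}"
  shows "free_of m T \<subseteq> free_of m S"
proof (rule ccontr)
  assume "\<not> ?thesis"
  then obtain u where u: "u \<in> free_of m T" "u \<notin> free_of m S" by blast
  define y where "y = Max (U - {m})"
  have fin: "finite (U - {m})" using U by simp
  have y: "y \<in> U" "y \<noteq> m" "y < m" "\<And>i. i \<in> U \<Longrightarrow> i \<noteq> m \<Longrightarrow> i \<le> y"
    using Max_in[OF fin ne] Max_ge[OF fin] max[of y] unfolding y_def by (auto simp: le_less)
  have um: "u \<in> mon (U - {m}) d" using u lexseg_mon[OF free_of_lexseg[OF T]] by blast
  have move: "x \<in> S \<Longrightarrow> x(m := 0, y := x y + x m) \<in> free_of m S" for x
  proof (induction "x m" arbitrary: x)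
    case 0
    then have "x(m := 0, y := x y + x m) = x" by auto
    moreover have "x \<in> free_of m S" using 0 by (simp add: free_of_def)
    ultimately show ?case by (simp only:)
  next
    case (Suc n)
    define x' where "x' = mult y (dec m x)"
    have "x' \<in> S" unfolding x'_def using stableD[OF st Suc.prems y(1,3)] Suc.hyps(2) by simp
    moreover have "n = x' m" using Suc.hyps(2)[symmetric] y by (simp add: x'_def mult_apply dec_apply)
    ultimately have "x'(m := 0, y := x' y + x' m) \<in> free_of m S" using Suc.hyps(1) by blast
    moreover have "x'(m := 0, y := x' y + x' m) = x(m := 0, y := x y + x m)"
      using Suc.hyps(2)[symmetric] y by (auto simp: x'_def mult_apply dec_apply)
    ultimately show ?case by simp
  qed
  have gt: "lex_less u x" if x: "x \<in> S" for x
  proof -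
    define x' where "x' = x(m := 0, y := x y + x m)"
    have x': "x' \<in> free_of m S" unfolding x'_def by (rule move[OF x])
    have x'm: "x' \<in> mon (U - {m}) d" using x' lexseg_mon[OF S0] by blast
    have "lex_less u x'" using lex_less_linear[of u x'] lexsegD[OF S0 x' um] u x' by metis
    then obtain i where i: "u i < x' i" "\<And>j. j < i \<Longrightarrow> u j = x' j" by (auto simp: lex_less_def)
    have "i \<in> U - {m}" using i(1) x'm mon_zero[of x' "U - {m}"] by force
    then have "i \<le> y" using y by simp
    \<comment> \<open>A first difference at the last remaining variable would put \<open>u\<close>
      pointwise below \<open>x'\<close> in the same degree.\<close>
    have "i \<noteq> y"
    proof
      assume "i = y"
      have "sum u (U - {m}) < sum x' (U - {m})"
      proof (rule sum_strict_mono_ex1[OF fin])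
        show "\<forall>j\<in>U - {m}. u j \<le> x' j"
        proof
          fix j assume "j \<in> U - {m}"
          then have "j \<le> i" using y(4) \<open>i = y\<close> by simp
          then show "u j \<le> x' j" using i by (cases "j = i") auto
        qed
        show "\<exists>j\<in>U - {m}. u j < x' j" using i(1) \<open>i \<in> U - {m}\<close> by blast
      qed
      then show False using um x'm by (simp add: mon_def)
    qed
    with \<open>i \<le> y\<close> have "i < y" by simp
    \<comment> \<open>Up to \<open>i\<close> the move has changed nothing, so the comparison holds
      for \<open>x\<close> itself.\<close>
    then have eq: "x' j = x j" if "j \<le> i" for j using that y by (simp add: x'_def)
    show ?thesis using i eq by (intro lex_lessI[of _ i]) auto
  qed
  have uT: "u \<in> T" using u by (simp add: free_of_def)
  have "S \<subseteq> T" using S lexsegD[OF T uT] gt by blast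
  moreover have "u \<notin> S" using gt[of u] by auto
  ultimately have "S \<subset> T" using uT by blast
  then have "card S < card T" using psubset_card_mono[OF lexseg_finite[OF U T]] by blast
  then show False using le by simp
qed

lemma compressed_free_of:
  assumes S: "S \<subseteq> mon U d" and eq: "compress U (U - {m}) d S = S"
  shows "lexseg (U - {m}) d (free_of m S)"
proof -
  have "v m = 0 \<Longrightarrow> v(m := 0) = v" for v :: "nat \<Rightarrow> nat" by (rule fun_upd_idem)
  moreover have "x i = 0" if "x \<in> S" "i \<notin> U" for x i using that S mon_zero by blast
  ultimately have "slice U m S 0 = free_of m S" by (auto simp: in_slice free_of_def)
  then show ?thesis using lexseg_slice[OF U m S eq, of 0] by simp
qed

end

text \<open>Induction on the set of variables. At a set fixed by all compressions,
  \<open>card_shadow_stable\<close> leaves only the shadows of the parts free of the last variable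
  to be compared, and these parts are nested.\<close>

theorem macaulay: "finite U \<Longrightarrow> macaulay U"
proof (induction U rule: finite_psubset_induct)
  case (psubset U)
  note U = psubset.hyps
  consider "card U \<le> 1" | "card U = 2" | "3 \<le> card U" by linarith
  then show ?case
  proof cases
    case 1
    show ?thesis unfolding macaulay_def
    proof (intro allI impI)
      fix d S T assume S: "S \<subseteq> mon U d" and T: "lexseg U d T" and le: "card T \<le> card S"
      have sub: "T \<subseteq> S" using lexseg_subset[OF U T lexseg_small[OF U 1 S] le] .
      have "finite (shadow U S)" using finite_subset[OF shadow_subset[OF U S] finite_mon[OF U]] .
      then show "card (shadow U T) \<le> card (shadow U S)" using card_mono shadow_mono[OF sub] by metis
    qed
  next
    case 2
    then show ?thesis using macaulay_pair by (metis card_2_iff)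
  next
    case 3
    define m where "m = Max U"
    have neU: "U \<noteq> {}" using 3 by auto
    have m: "m \<in> U" "\<And>i. i \<in> U \<Longrightarrow> i \<le> m" using Max_in[OF U neU] Max_ge[OF U] by (auto simp: m_def)
    have "card (U - {m}) = card U - 1" using m U by simp
    then have ne: "U - {m} \<noteq> {}" using 3 by (metis card.empty diff_is_0_eq not_numeral_le_zero numeral_le_one_iff order_trans semiring_norm(70))
    show ?thesis unfolding macaulay_def
    proof (intro allI impI)
      fix d S T assume S: "S \<subseteq> mon U d" and T: "lexseg U d T" and le: "card T \<le> card S"
      show "card (shadow U T) \<le> card (shadow U S)" using le
      proof (induction rule: compress_induct[OF U S])
        case (1 S)
        have st: "stable U m S" unfolding stable_def
          using compressed_stable[OF U 3 1(1,2)] m(1) by blast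
        have S0: "lexseg (U - {m}) d (free_of m S)" using compressed_free_of[OF U m(1) m(2) 1(1) 1(2)] m(1) by blast
        have sub: "free_of m T \<subseteq> free_of m S"
          using free_of_lexseg_subset[OF U m 1(1) st S0 T 1(3) ne] .
        have "finite (shadow (U - {m}) (free_of m S))"
          using finite_subset[OF shadow_subset[OF _ lexseg_mon[OF S0]] finite_mon] U by simp
        then have "card (shadow (U - {m}) (free_of m T)) \<le> card (shadow (U - {m}) (free_of m S))"
          using card_mono shadow_mono[OF sub] by metis
        then show ?case
          using card_shadow_stable[OF U m st 1(1)] 1(3)
            card_shadow_stable[OF U m lexseg_stable[OF U m T] lexseg_mon[OF T]] by simp
      next
        case (2 S l)
        have sub: "U - {l} \<subseteq> U" "U - {l} \<subset> U" using 2 by auto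
        have "card (shadow U (compress U (U - {l}) d S)) \<le> card (shadow U S)"
          by (rule card_shadow_compress_le[OF U sub(1) psubset.IH[OF sub(2)] 2(1)])
        then show ?case using 2(3,4) card_compress[OF U sub(1) 2(1)] by simp
      qed
    qed
  qed
qed

section \<open>Persistence\<close>

text \<open>A minimal shadow means that shifting the exponents adds only the successor of the
  maximum; the same then holds for the enlarged set of exponents.\<close>

lemma gotzmann_shadow_pair:
  assumes kl: "k \<noteq> l" and S: "gotzmann {k, l} d S" shows "gotzmann {k, l} (Suc d) (shadow {k, l} S)"
proof (cases "S = {}")
  case True
  then show ?thesis by (simp add: gotzmann_lexseg lexseg_empty)
next
  case False
  let ?P = "{k, l}"
  let ?N = "exps l S"
  let ?N2 = "?N \<union> Suc ` ?N"
  have Sm: "S \<subseteq> mon ?P d" using S by (simp add: gotzmann_def)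
  have shm: "shadow ?P S \<subseteq> mon ?P (Suc d)" using shadow_subset[OF _ Sm] by simp
  have fin: "finite ?N" using finite_subset[OF Sm finite_mon] by simp
  have cS: "card (shadow ?P S) = Suc (card S)" using gotzmann_pair_iff[OF kl Sm False] S by blast
  then have shne: "shadow ?P S \<noteq> {}" by auto
  have Max: "Max ?N \<in> ?N" using Max_in[OF fin] False by simp
  have cN: "card ?N2 = Suc (card ?N)" using cS card_shadow_pair[OF kl Sm] card_pair[OF kl Sm] by simp
  have "Suc (Max ?N) \<notin> ?N" using Max_ge[OF fin] by (meson Suc_n_not_le_n)
  then have "card (insert (Suc (Max ?N)) ?N) = Suc (card ?N)" using fin by simp
  moreover have "insert (Suc (Max ?N)) ?N \<subseteq> ?N2" using Max by blast
  ultimately have N2: "?N2 = insert (Suc (Max ?N)) ?N"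
    using card_subset_eq[of ?N2 "insert (Suc (Max ?N)) ?N"] fin cN by simp
  have "Suc ` ?N2 \<subseteq> insert (Suc (Suc (Max ?N))) ?N2" using N2 by blast
  then have "card (?N2 \<union> Suc ` ?N2) \<le> card (insert (Suc (Suc (Max ?N))) ?N2)" using fin by (intro card_mono) auto
  also have "\<dots> \<le> Suc (card ?N2)" using fin by (simp add: card_insert_if)
  finally have "card (shadow ?P (shadow ?P S)) \<le> Suc (card (shadow ?P S))"
    using card_shadow_pair[OF kl shm] cN cS card_pair[OF kl Sm] by (simp add: shadow_pair[OF kl])
  then show ?thesis using gotzmann_pair_iff[OF kl shm shne] card_shadow_pair_ge[OF kl shm shne] by simp
qed

text \<open>The shadow of a Gotzmann set is already as small as its size allows, so compression
  cannot shrink it.\<close>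

lemma gotzmann_compress_eq:
  assumes U: "finite U" and VU: "V \<subseteq> U" and S: "gotzmann U d S"
  shows "card (shadow U (compress U V d S)) = card (shadow U S)" and "gotzmann U d (compress U V d S)"
proof -
  have Sm: "S \<subseteq> mon U d" using S by (simp add: gotzmann_def)
  have C: "compress U V d S \<subseteq> mon U d" "card (compress U V d S) = card S"
    using compress_subset[OF U VU Sm] card_compress[OF U VU Sm] .
  have "card (shadow U (compress U V d S)) \<le> card (shadow U S)"
    by (rule card_shadow_compress_le[OF U VU macaulay[OF finite_subset[OF VU U]] Sm])
  then show eq: "card (shadow U (compress U V d S)) = card (shadow U S)"
    using gotzmann_shadow_le[OF U macaulay[OF U] S C] by simp
  then show "gotzmann U d (compress U V d S)" using S C by (simp add: gotzmann_def)
qed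

lemma gotzmann_fib_cases:
  assumes U: "finite U" and VU: "V \<subseteq> U" and S: "gotzmann U d S" and w: "w \<in> bases (U - V) (Suc d)"
  shows "(fib V (shadow U S) w = shadow V (fib V S w) \<and>
        (w \<in> bases (U - V) d \<longrightarrow> gotzmann V (d - sum w (U - V)) (fib V S w))) \<or>
      (\<exists>k. 0 < w k \<and> fib V (shadow U S) w = fib V S (dec k w))"
proof -
  have Sm: "S \<subseteq> mon U d" using S by (simp add: gotzmann_def)
  show ?thesis
    using fib_shadow_cases[OF U VU macaulay[OF finite_subset[OF VU U]] Sm gotzmann_compress_eq(1)[OF U VU S] w] .
qed

text \<open>A gap in a two-variable plane can only be filled from another plane.\<close>

lemma gotzmann_gap:
  assumes U: "finite U" and S: "gotzmann U d S" and kl: "k \<in> U" "l \<in> U" "k \<noteq> l"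
    and x: "x \<in> mon U d" "x \<notin> S" and k: "mult k x \<in> shadow U S" and l: "mult l x \<in> shadow U S"
  shows "\<exists>j\<in>U - {k, l}. 0 < x j \<and> mult k (dec j x) \<in> S \<and> mult l (dec j x) \<in> S"
proof -
  let ?P = "{k, l}"
  have PU: "?P \<subseteq> U" using kl by simp
  define w where "w = restr (U - ?P) x"
  define v where "v = restr ?P x"
  have wv: "padd w v = x" using padd_restr[OF U PU x(1)] by (simp add: w_def v_def)
  have w: "w \<in> bases (U - ?P) d" using restr_bases[OF U PU x(1)] by (simp add: w_def)
  then have w': "w \<in> bases (U - ?P) (Suc d)" by (simp add: bases_def)
  have Sm: "S \<subseteq> mon U d" using S by (simp add: gotzmann_def)
  have v0: "v i = 0" if "i \<notin> ?P" for i using that by (simp add: v_def restr_def)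
  have vm: "v \<in> mon ?P (d - sum w (U - ?P))"
  proof -
    have "v \<in> fib ?P (mon U d) w" using v0 x(1) wv by (simp add: fib_def)
    then show ?thesis using fib_subset[OF U PU order_refl w] by blast
  qed
  have vn: "v \<notin> fib ?P S w" using x(2) wv by (simp add: fib_def)
  have X: "mult k v \<in> fib ?P (shadow U S) w" "mult l v \<in> fib ?P (shadow U S) w"
    using k l wv v0 by (auto simp: fib_def padd_mult mult_apply)
  \<comment> \<open>Either the plane of \<open>x\<close> has a minimal shadow of its own, hence no
    gap, or its part of the shadow comes entirely from one other plane, which then contains both
    required monomials.\<close>
  consider "fib ?P (shadow U S) w = shadow ?P (fib ?P S w)" "gotzmann ?P (d - sum w (U - ?P)) (fib ?P S w)"
    | j where "0 < w j" "fib ?P (shadow U S) w = fib ?P S (dec j w)"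
    using gotzmann_fib_cases[OF U PU S w'] w by blast
  then show ?thesis
  proof cases
    case 1
    have "mult k v \<in> shadow ?P (fib ?P S w)" using X 1 by simp
    then obtain i where "i \<in> ?P" "0 < mult k v i" "dec i (mult k v) \<in> fib ?P S w" by (rule shadowE)
    \<comment> \<open>As \<open>v\<close> itself is absent, the factor removed from
      \<open>mult k v\<close> must be \<open>l\<close>, and likewise \<open>k\<close> is the one
      removed from \<open>mult l v\<close>.\<close>
    then have vl: "0 < v l" "dec l (mult k v) \<in> fib ?P S w" using vn kl by (auto simp: mult_apply split: if_splits)
    have "mult l v \<in> shadow ?P (fib ?P S w)" using X 1 by simp
    then obtain i where "i \<in> ?P" "0 < mult l v i" "dec i (mult l v) \<in> fib ?P S w" by (rule shadowE)
    then have vk: "0 < v k" "dec k (mult l v) \<in> fib ?P S w" using vn kl by (auto simp: mult_apply split: if_splits)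
    have "\<exists>y\<in>fib ?P S w. y l = v l - 1 + 1"
      by (rule gotzmann_pair_no_gap[OF kl(3) 1(2) vl(2) _ vk(2)]) (use kl vl in \<open>auto simp: mult_apply dec_apply\<close>)
    then obtain y where y: "y \<in> fib ?P S w" "y l = v l" using vl by auto
    have "y \<in> mon ?P (d - sum w (U - ?P))" using fib_subset[OF U PU Sm w] y by blast
    then have "y = v" using inj_onD[OF inj_pair[OF kl(3)]] y(2) vm by blast
    then show ?thesis using y vn by simp
  next
    case 2
    then have j: "j \<in> U - ?P" "0 < x j" by (auto simp: w_def restr_def split: if_splits)
    have "padd (dec j w) (mult i v) = mult i (dec j x)" if "i \<in> ?P" for i
      using j that v0[of j] unfolding wv[symmetric] by (auto simp: padd_def mult_apply dec_apply)
    then show ?thesis using X j unfolding 2 by (auto simp: fib_def)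
  qed
qed

lemma slice_shadow:
  assumes U: "finite U" and l: "l \<in> U" and S: "S \<subseteq> mon U d"
  shows "slice U l (shadow U S) c = shadow (U - {l}) (slice U l S c) \<union> (if c = 0 then {} else slice U l S (c - 1))"
proof -
  have 1: "{k. 0 < (single l c) k} = (if c = 0 then {} else {l})" by auto
  have 2: "dec l (single l c) = single l (c - 1)" by (auto simp: dec_apply)
  have "slice U l (shadow U S) c = shadow (U - {l}) (slice U l S c) \<union>
      (\<Union>k\<in>{k. 0 < (single l c) k}. fib (U - {l}) S (dec k (single l c)))"
    unfolding slice_def by (rule fib_shadow[OF U _ S]) (use l in auto)
  then show ?thesis unfolding 1 by (simp add: 2 slice_def)
qed

lemma slice_empty:
  assumes U: "finite U" and l: "l \<in> U" and S: "S \<subseteq> mon U d" and c: "d < c"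
  shows "slice U l S c = {}"
proof -
  have "d < sum (single l c) (U - (U - {l}))" unfolding sum_slice[OF l] by (rule c)
  then show ?thesis unfolding slice_def by (intro fib_empty[OF U _ S]) (use l in auto)
qed

lemma slice_subset:
  assumes U: "finite U" and l: "l \<in> U" and S: "S \<subseteq> mon U d" and c: "c \<le> d"
  shows "slice U l S c \<subseteq> mon (U - {l}) (d - c)"
  using fib_subset[OF U _ S, of "U - {l}" "single l c"] c
  unfolding bases_slice[OF l] sum_slice[OF l] slice_def by blast

lemma slice_cases:
  assumes U: "finite U" and l: "l \<in> U" and S: "gotzmann U d S" and c: "c \<le> Suc d"
  shows "(slice U l (shadow U S) c = shadow (U - {l}) (slice U l S c) \<and>
        (c \<le> d \<longrightarrow> gotzmann (U - {l}) (d - c) (slice U l S c))) \<or>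
      (0 < c \<and> slice U l (shadow U S) c = slice U l S (c - 1))"
proof -
  have dec: "dec l (single l c) = single l (c - 1)" by (auto simp: dec_apply)
  consider "fib (U - {l}) (shadow U S) (single l c) = shadow (U - {l}) (fib (U - {l}) S (single l c)) \<and>
        (c \<le> d \<longrightarrow> gotzmann (U - {l}) (d - c) (fib (U - {l}) S (single l c)))"
    | k where "0 < (single l c) k"
        "fib (U - {l}) (shadow U S) (single l c) = fib (U - {l}) S (dec k (single l c))"
    using gotzmann_fib_cases[OF U _ S, of "U - {l}" "single l c"] c
    unfolding bases_slice[OF l] sum_slice[OF l] by blast
  then show ?thesis
  proof cases
    case 1
    then show ?thesis unfolding slice_def by blast
  next
    case 2
    then have "k = l" "0 < c" by (auto split: if_splits)
    then show ?thesis using 2 unfolding slice_def by (simp add: dec)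
  qed
qed

lemma slice_compress:
  assumes U: "finite U" and l: "l \<in> U" and S: "S \<subseteq> mon U d" and c: "c \<le> d"
  defines "C \<equiv> compress U (U - {l}) d S"
  shows "lexseg (U - {l}) (d - c) (slice U l C c)" and "card (slice U l C c) = card (slice U l S c)"
  using lexseg_compress[OF U _ S, of "U - {l}" "single l c"] c
  unfolding bases_slice[OF l] sum_slice[OF l] slice_def C_def by blast+

lemma slice_shadow_compress:
  assumes U: "finite U" and l: "l \<in> U" and S: "gotzmann U d S" and c: "c \<le> Suc d"
  defines "C \<equiv> compress U (U - {l}) d S"
  shows "lexseg (U - {l}) (Suc d - c) (slice U l (shadow U C) c)"
    and "card (slice U l (shadow U C) c) = card (slice U l (shadow U S) c)"
proof -
  have Sm: "S \<subseteq> mon U d" using S by (simp add: gotzmann_def)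
  have sub: "U - {l} \<subseteq> U" by blast
  have w: "single l c \<in> bases (U - (U - {l})) (Suc d)" using c by (simp add: bases_slice[OF l])
  have mac: "macaulay (U - {l})" using U by (intro macaulay) simp
  show "lexseg (U - {l}) (Suc d - c) (slice U l (shadow U C) c)"
    using compress_fiber(1)[OF U sub mac Sm w] unfolding sum_slice[OF l] slice_def C_def .
  show "card (slice U l (shadow U C) c) = card (slice U l (shadow U S) c)"
    using card_fib_shadow_compress_eq[OF U sub mac Sm gotzmann_compress_eq(1)[OF U sub S] w]
    unfolding slice_def C_def .
qed

text \<open>The two failing inclusions would leave a gap in the plane of \<open>l\<close> and the last variable of the first
  monomial missing from the middle slice.\<close>

lemma gotzmann_slice_pattern:
  assumes U: "finite U" and l: "l \<in> U" and C: "gotzmann U d C" and c: "2 \<le> c" "c \<le> d"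
    and seg: "\<And>c. c \<le> d \<Longrightarrow> lexseg (U - {l}) (d - c) (slice U l C c)"
    and lt: "\<not> shadow (U - {l}) (slice U l C c) \<subseteq> slice U l C (c - 1)"
    and gt: "\<not> slice U l C (c - 2) \<subseteq> shadow (U - {l}) (slice U l C (c - 1))"
  shows False
proof -
  let ?V = "U - {l}"
  have V: "finite ?V" using U by simp
  have e: "d - (c - 1) = Suc (d - c)" "d - (c - 2) = Suc (Suc (d - c))" using c by auto
  have seg0: "lexseg ?V (d - c) (slice U l C c)" using seg c by simp
  have seg1: "lexseg ?V (Suc (d - c)) (slice U l C (c - 1))" using seg[of "c - 1"] c e by simp
  have seg2: "lexseg ?V (Suc (Suc (d - c))) (slice U l C (c - 2))" using seg[of "c - 2"] c e by simp
  have sh0: "lexseg ?V (Suc (d - c)) (shadow ?V (slice U l C c))" using lexseg_shadow[OF V seg0] .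
  \<comment> \<open>The largest monomial missing from the middle slice witnesses both failures:
    divided by its last variable it lies in slice \<open>c\<close>, multiplied by it in slice
    \<open>c - 2\<close>.\<close>
  let ?M = "mon ?V (Suc (d - c)) - slice U l C (c - 1)"
  have "?M \<noteq> {}" using lt lexseg_mon[OF sh0] by blast
  then obtain z where z: "z \<in> ?M" and zmax: "\<And>v. v \<in> ?M \<Longrightarrow> v = z \<or> lex_less v z"
    using lex_max[of ?M] finite_mon[OF V] by blast
  have zm: "z \<in> mon ?V (Suc (d - c))" using z by blast
  obtain y where y: "y \<in> shadow ?V (slice U l C c)" "y \<notin> slice U l C (c - 1)" using lt by blast
  then have "y = z \<or> lex_less y z" using zmax lexseg_mon[OF sh0] by blast
  then have zsh: "z \<in> shadow ?V (slice U l C c)" using lexsegD[OF sh0 y(1) zm] by blast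
  define k where "k = last_var z"
  have k: "k \<in> ?V" "0 < z k" "\<And>j. k < j \<Longrightarrow> z j = 0"
    using last_var_in[OF V zm] last_var[OF V zm] by (auto simp: k_def)
  have down: "dec k z \<in> slice U l C c" using zsh shadow_lexseg_iff[OF V seg0 zm] by (simp add: k_def)
  obtain w where w: "w \<in> slice U l C (c - 2)" "w \<notin> shadow ?V (slice U l C (c - 1))" using gt by blast
  have wm: "w \<in> mon ?V (Suc (Suc (d - c)))" using w lexseg_mon[OF seg2] by blast
  have "w = mult k z \<or> lex_less w (mult k z)"
    unfolding k_def by (rule missing_shadow_le[OF V seg1 zm _ wm w(2)]) (use zmax in blast)
  then have up: "mult k z \<in> slice U l C (c - 2)" using lexsegD[OF seg2 w(1) mult_in_mon[OF V k(1) zm]] by blast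
  define x where "x = z(l := c - 1)"
  have zl: "z l = 0" using mon_zero[OF zm, of l] by simp
  have "x \<in> mon U d"
  proof -
    have "sum x U = x l + sum x ?V" using sum.remove[OF U l] by blast
    also have "sum x ?V = sum z ?V" by (rule sum.cong) (auto simp: x_def)
    finally show ?thesis using zm c l by (auto simp: mon_def x_def)
  qed
  moreover have "x \<notin> C"
  proof
    assume "x \<in> C"
    then have "z \<in> slice U l C (c - 1)" using zm by (auto simp: in_slice x_def mon_def)
    then show False using z by blast
  qed
  moreover have "mult k x \<in> shadow U C"
  proof (rule shadowI_dec[OF l])
    show "0 < mult k x l" using k c by (simp add: x_def mult_apply)
    have "dec l (mult k x) = (mult k z)(l := c - 2)" using k by (auto simp: x_def mult_apply dec_apply fun_eq_iff)
    then show "dec l (mult k x) \<in> C" using up by (simp add: in_slice)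
  qed
  moreover have "mult l x \<in> shadow U C"
  proof (rule shadowI_dec)
    show "k \<in> U" "0 < mult l x k" using k by (auto simp: x_def mult_apply)
    have "dec k (mult l x) = (dec k z)(l := c)" using k c by (auto simp: x_def mult_apply dec_apply fun_eq_iff)
    then show "dec k (mult l x) \<in> C" using down by (simp add: in_slice)
  qed
  ultimately obtain j where j: "j \<in> U - {k, l}" "0 < x j" "mult k (dec j x) \<in> C"
    using gotzmann_gap[OF U C _ l, of k x] k by blast
  \<comment> \<open>The factor has moved from \<open>j\<close> to the last variable
    \<open>k\<close>, so \<open>z'\<close> is lexicographically below \<open>z\<close>, and its
    membership in the segment forces that of \<open>z\<close>.\<close>
  define z' where "z' = mult k (dec j z)"
  have zj: "0 < z j" "j \<noteq> k" "j \<noteq> l" using j by (auto simp: x_def)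
  have jk: "j < k" using k(3)[of j] zj by (cases j k rule: linorder_cases) auto
  have "mult k (dec j x) = z'(l := c - 1)" using zj k by (auto simp: x_def z'_def mult_apply dec_apply fun_eq_iff)
  moreover have z'm: "z' \<in> mon ?V (Suc (d - c))"
    unfolding z'_def using dec_in_mon[OF V zm zj(1)] by (rule mult_in_mon[OF V k(1)])
  ultimately have "z' \<in> slice U l C (c - 1)" using j by (auto simp: in_slice mon_def)
  moreover have "lex_less z' z" using jk zj by (intro lex_lessI[of _ j]) (auto simp: z'_def mult_apply dec_apply)
  ultimately have "z \<in> slice U l C (c - 1)" using lexsegD[OF seg1 _ zm] by blast
  then show False using z by blast
qed

text \<open>It suffices to bound the second shadow of \<open>S\<close> by that of its compression,
  slice by slice. Slice \<open>c\<close> of the second shadow joins the shadow of slice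
  \<open>c\<close> of the first shadow with its slice \<open>c - 1\<close>. In the favourable cases
  one of the two contains the other and its size is controlled; the remaining case passes to the
  compressed set through cardinalities and contradicts
  \<open>gotzmann_slice_pattern\<close>.\<close>

lemma gotzmann_shadow_step:
  assumes U: "finite U" and l: "l \<in> U" and S: "gotzmann U d S"
    and IH: "\<And>e B. gotzmann (U - {l}) e B \<Longrightarrow> gotzmann (U - {l}) (Suc e) (shadow (U - {l}) B)"
    and P: "gotzmann U (Suc d) (shadow U (compress U (U - {l}) d S))"
  shows "gotzmann U (Suc d) (shadow U S)"
proof -
  let ?V = "U - {l}"
  let ?C = "compress U ?V d S"
  have sub: "?V \<subseteq> U" by blast
  have V: "finite ?V" using U by simp
  have Sm: "S \<subseteq> mon U d" using S by (simp add: gotzmann_def)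
  have C: "gotzmann U d ?C" "card (shadow U ?C) = card (shadow U S)" using gotzmann_compress_eq[OF U sub S] by auto
  have Cm: "?C \<subseteq> mon U d" using C by (simp add: gotzmann_def)
  have shS: "shadow U S \<subseteq> mon U (Suc d)" and shC: "shadow U ?C \<subseteq> mon U (Suc d)"
    using shadow_subset[OF U] Sm Cm by auto
  have sh2: "shadow U (shadow U S) \<subseteq> mon U (Suc (Suc d))" "shadow U (shadow U ?C) \<subseteq> mon U (Suc (Suc d))"
    using shadow_subset[OF U] shS shC by auto
  let ?s = "slice U l S" let ?t = "slice U l ?C"
  let ?X = "slice U l (shadow U S)" let ?Y = "slice U l (shadow U ?C)"
  let ?Z = "slice U l (shadow U (shadow U ?C))"
  have finZ: "finite (?Z c)" if "c \<le> Suc (Suc d)" for c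
    using finite_subset[OF slice_subset[OF U l sh2(2) that] finite_mon[OF V]] .
  have YZ: "shadow ?V (?Y c) \<subseteq> ?Z c" "0 < c \<Longrightarrow> ?Y (c - 1) \<subseteq> ?Z c" for c
    unfolding slice_shadow[OF U l shC] by auto
  have pred_le: "card (?X (c - 1)) \<le> card (?Z c)" if "0 < c" "c \<le> Suc (Suc d)" for c
  proof -
    have "card (?X (c - 1)) = card (?Y (c - 1))" using slice_shadow_compress(2)[OF U l S, of "c - 1"] that by simp
    also have "\<dots> \<le> card (?Z c)" using card_mono[OF finZ[OF that(2)] YZ(2)[OF that(1)]] .
    finally show ?thesis .
  qed
  have slices: "card (slice U l (shadow U (shadow U S)) c) \<le> card (?Z c)" if c: "c \<le> Suc (Suc d)" for c
  proof (cases "c = Suc (Suc d)")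
    case True
    have "?X c = {}" using slice_empty[OF U l shS] True by simp
    then show ?thesis using pred_le[of c] True unfolding slice_shadow[OF U l shS] by simp
  next
    case False
    with c have c: "c \<le> Suc d" by simp
    show ?thesis
    proof (cases "0 < c \<and> ?X c = ?s (c - 1)")
      case True
      then have "shadow ?V (?X c) \<subseteq> ?X (c - 1)" unfolding slice_shadow[OF U l Sm, of "c - 1"] by simp
      then have "slice U l (shadow U (shadow U S)) c = ?X (c - 1)"
        unfolding slice_shadow[OF U l shS] using True by auto
      then show ?thesis using pred_le[of c] True c by simp
    next
      case no_down: False
      then have up: "?X c = shadow ?V (?s c)" "c \<le> d \<Longrightarrow> gotzmann ?V (d - c) (?s c)"
        using slice_cases[OF U l S c] by auto
      have upX: "card (shadow ?V (?X c)) \<le> card (?Z c)"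
      proof (cases "c \<le> d")
        case True
        \<comment> \<open>Persistence in fewer variables gives the shadow of \<open>?X c\<close> the
          size of the shadow of the segment \<open>?Y c\<close>.\<close>
        have "gotzmann ?V (Suc (d - c)) (?X c)" unfolding up(1) by (rule IH[OF up(2)[OF True]])
        moreover have "lexseg ?V (Suc (d - c)) (?Y c)" "card (?Y c) = card (?X c)"
          using slice_shadow_compress[OF U l S c] True by (auto simp: Suc_diff_le)
        ultimately have "card (shadow ?V (?X c)) = card (shadow ?V (?Y c))" using gotzmann_card[OF V] by blast
        then show ?thesis using card_mono[OF finZ YZ(1)] c by simp
      next
        case False
        then have "?s c = {}" using slice_empty[OF U l Sm] by simp
        then show ?thesis by (simp add: up(1))
      qed
      show ?thesis
      proof (cases "0 < c \<longrightarrow> ?X (c - 1) \<subseteq> shadow ?V (?X c)")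
        case True
        then have "slice U l (shadow U (shadow U S)) c = shadow ?V (?X c)"
          unfolding slice_shadow[OF U l shS] by auto
        then show ?thesis using upX by simp
      next
        case False
        then have c0: "0 < c" and nsub: "\<not> ?X (c - 1) \<subseteq> shadow ?V (?X c)" by auto
        \<comment> \<open>What remains is a change of dominance: in slice \<open>c\<close> the
          shadow of \<open>?s c\<close> is strictly larger, in slice \<open>c - 1\<close> the set
          \<open>?s (c - 2)\<close> is.\<close>
        have sc: "?s (c - 1) \<subseteq> ?X c" unfolding slice_shadow[OF U l Sm] using c0 by simp
        then have ssub: "shadow ?V (?s (c - 1)) \<subseteq> shadow ?V (?X c)" by (rule shadow_mono)
        have "?s (c - 1) \<noteq> ?X c" using no_down c0 by auto
        with sc have psub: "?s (c - 1) \<subset> ?X c" by blast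
        have cd: "c \<le> d"
        proof (rule ccontr)
          assume "\<not> c \<le> d"
          then have "?s c = {}" using slice_empty[OF U l Sm] by simp
          then have "?X c = {}" by (simp add: up(1))
          then show False using psub by simp
        qed
        have "?X (c - 1) \<noteq> shadow ?V (?s (c - 1))" using nsub ssub by metis
        moreover have "c - 1 \<le> Suc d" using c by simp
        ultimately have "0 < c - 1 \<and> ?X (c - 1) = ?s (c - 1 - 1)"
          using slice_cases[OF U l S, of "c - 1"] by metis
        then have down: "0 < c - 1" "?X (c - 1) = ?s (c - 2)" by (simp_all add: numeral_2_eq_2)
        have c2: "2 \<le> c" using down by simp
        have finX: "finite (?X b)" if "b \<le> Suc d" for b
          using finite_subset[OF slice_subset[OF U l shS that] finite_mon[OF V]] .
        have tY: "?Y c = shadow ?V (?t c) \<union> ?t (c - 1)" unfolding slice_shadow[OF U l Cm] using c0 by simp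
        \<comment> \<open>Slice sizes survive compression and shadows of segments are smallest, so
          both strict inclusions turn into failing inclusions for the compressed slices.\<close>
        have "card (?t (c - 1)) < card (?Y c)"
          using psubset_card_mono[OF finX[OF c] psub] slice_compress(2)[OF U l Sm, of "c - 1"]
            slice_shadow_compress(2)[OF U l S c] c by simp
        then have lt: "\<not> shadow ?V (?t c) \<subseteq> ?t (c - 1)" unfolding tY by (metis less_irrefl sup.absorb2)
        have "shadow ?V (?s (c - 1)) \<subset> ?X (c - 1)"
          using ssub nsub unfolding slice_shadow[OF U l Sm, of "c - 1"] by auto
        moreover have "finite (?X (c - 1))" using finX c by simp
        ultimately have "card (shadow ?V (?s (c - 1))) < card (?s (c - 2))"
          unfolding down(2) by (intro psubset_card_mono)
        moreover have "card (shadow ?V (?t (c - 1))) \<le> card (shadow ?V (?s (c - 1)))"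
          by (rule macaulayD[OF macaulay[OF V] slice_subset[OF U l Sm] slice_compress(1)[OF U l Sm]])
            (use slice_compress(2)[OF U l Sm, of "c - 1"] cd in auto)
        moreover have "card (?t (c - 2)) = card (?s (c - 2))" using slice_compress(2)[OF U l Sm] cd by simp
        ultimately have lt2: "card (shadow ?V (?t (c - 1))) < card (?t (c - 2))" by simp
        have "finite (shadow ?V (?t (c - 1)))"
          using finite_subset[OF shadow_subset[OF V slice_subset[OF U l Cm]] finite_mon[OF V]] cd by simp
        then have gt: "\<not> ?t (c - 2) \<subseteq> shadow ?V (?t (c - 1))" using lt2 card_mono by (metis linorder_not_less)
        have False
          by (rule gotzmann_slice_pattern[OF U l C(1) c2 cd slice_compress(1)[OF U l Sm] lt gt])
        then show ?thesis ..
      qed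
    qed
  qed
  have "card (shadow U (shadow U S)) \<le> card (shadow U (shadow U ?C))"
    unfolding card_fibers[OF U sub sh2(1) order_refl] card_fibers[OF U sub sh2(2) order_refl]
  proof (rule sum_mono)
    fix w assume w: "w \<in> bases (U - ?V) (Suc (Suc d))"
    have UV: "U - ?V = {l}" using l by blast
    have "w = (\<lambda>_. 0)(l := w l)" "w l \<le> Suc (Suc d)" using w unfolding UV by (auto simp: bases_def)
    then show "card (fib ?V (shadow U (shadow U S)) w) \<le> card (fib ?V (shadow U (shadow U ?C)) w)"
      using slices[of "w l"] unfolding slice_def by simp
  qed
  also have "\<dots> = card (shadow U (seg U (Suc d) (card (shadow U S))))" using P C by (simp add: gotzmann_def)
  finally have le: "card (shadow U (shadow U S)) \<le> card (shadow U (seg U (Suc d) (card (shadow U S))))" .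
  have n: "card (shadow U S) \<le> card (mon U (Suc d))" using card_mono[OF finite_mon[OF U] shS] .
  show ?thesis
    by (rule gotzI[OF U macaulay[OF U] shS lexseg_seg[OF U n] card_seg[OF U n] le])
qed

theorem gotzmann_shadow: "finite U \<Longrightarrow> gotzmann U d S \<Longrightarrow> gotzmann U (Suc d) (shadow U S)"
proof (induction U arbitrary: d S rule: finite_psubset_induct)
  case (psubset U)
  note U = psubset.hyps
  have Sm: "S \<subseteq> mon U d" using psubset.prems by (simp add: gotzmann_def)
  consider "card U \<le> 1" | "card U = 2" | "3 \<le> card U" by linarith
  then show ?case
  proof cases
    case 1
    then show ?thesis using gotzmann_lexseg[OF U lexseg_small[OF U]] shadow_subset[OF U Sm] by blast
  next
    case 2
    then show ?thesis using gotzmann_shadow_pair psubset.prems by (metis card_2_iff)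
  next
    case 3
    define m where "m = Max U"
    have neU: "U \<noteq> {}" using 3 by auto
    have m: "m \<in> U" "\<And>i. i \<in> U \<Longrightarrow> i \<le> m" using Max_in[OF U neU] Max_ge[OF U] by (auto simp: m_def)
    have V: "finite (U - {m})" using U by simp
    have "gotzmann U d S \<longrightarrow> gotzmann U (Suc d) (shadow U S)"
    proof (induction rule: compress_induct[OF U Sm])
      case (1 S)
      show ?case
      proof
        assume S: "gotzmann U d S"
        have st: "stable U m S" unfolding stable_def
          using compressed_stable[OF U 3 1(1,2)] m(1) by blast
        have S0: "lexseg (U - {m}) d (free_of m S)" using compressed_free_of[OF U m(1) m(2) 1(1) 1(2)] m(1) by blast
        have n: "card S \<le> card (mon U d)" using card_mono[OF finite_mon[OF U] 1(1)] .
        define T where "T = seg U d (card S)"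
        have T: "lexseg U d T" "card T = card S" using lexseg_seg[OF U n] card_seg[OF U n] by (auto simp: T_def)
        have Tm: "T \<subseteq> mon U d" using lexseg_mon[OF T(1)] .
        have stT: "stable U m T" by (rule lexseg_stable[OF U m T(1)])
        have T0: "lexseg (U - {m}) d (free_of m T)" by (rule free_of_lexseg[OF U m T(1)])
        have eq: "card (shadow U T) = card (shadow U S)" using gotzmann_card[OF U S T] by simp
        have shS: "shadow U S \<subseteq> mon U (Suc d)" and shT: "shadow U T \<subseteq> mon U (Suc d)"
          using shadow_subset[OF U] 1(1) Tm by auto
        have "card (shadow (U - {m}) (free_of m T)) = card (shadow (U - {m}) (free_of m S))"
          using card_shadow_stable[OF U m st 1(1)] card_shadow_stable[OF U m stT Tm] eq T by simp
        \<comment> \<open>Segments of the same degree and size coincide, and by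
          \<open>free_of_shadow\<close> they determine the growth of the next shadow.\<close>
        then have "shadow (U - {m}) (free_of m T) = shadow (U - {m}) (free_of m S)"
          by (rule lexseg_unique[OF V lexseg_shadow[OF V T0] lexseg_shadow[OF V S0]])
        then have "card (shadow U (shadow U S)) = card (shadow U (shadow U T))"
          using card_shadow_stable[OF U m stable_shadow[OF U m st] shS]
            card_shadow_stable[OF U m stable_shadow[OF U m stT] shT] eq
          by (simp add: free_of_shadow[OF U m])
        then show "gotzmann U (Suc d) (shadow U S)"
          by (intro gotzI[OF U macaulay[OF U] shS lexseg_shadow[OF U T(1)] eq]) simp
      qed
    next
      case (2 S l)
      have sub: "U - {l} \<subseteq> U" "U - {l} \<subset> U" using 2 by auto
      show ?case
      proof
        assume S: "gotzmann U d S"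
        show "gotzmann U (Suc d) (shadow U S)"
        proof (rule gotzmann_shadow_step[OF U 2(2) S])
          show "gotzmann U (Suc d) (shadow U (compress U (U - {l}) d S))"
            using 2(3) gotzmann_compress_eq(2)[OF U sub(1) S] by blast
        qed (rule psubset.IH[OF sub(2)])
      qed
    qed
    then show ?thesis using psubset.prems by blast
  qed
qed

declare One_nat_def [simp del] \<comment> \<open>keeps \<open>{1..m}\<close> from becoming \<open>{Suc 0..m}\<close>\<close>

section \<open>Connectedness\<close>

text \<open>The part of degree \<open>e\<close> of the monomial ideal generated by
  \<open>N\<close>.\<close>

definition upset :: "nat \<Rightarrow> (nat \<Rightarrow> nat) set \<Rightarrow> nat \<Rightarrow> (nat \<Rightarrow> nat) set" where
  "upset m N e = {u \<in> mon {1..m} e. \<exists>\<beta>\<in>N. \<beta> \<le> u}"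

lemma mon_tuples: "u \<in> mon {1..m} e \<longleftrightarrow> u \<in> tuples m \<and> deg m u = e"
  by (auto simp: mon_def tuples_def deg_def)

lemma upset_subset: "upset m N e \<subseteq> mon {1..m} e"
  by (auto simp: upset_def)

lemma finite_upset: "finite (upset m N e)"
  by (rule finite_subset[OF upset_subset finite_mon]) simp

lemma deg_mono: "u \<le> v \<Longrightarrow> deg m u \<le> deg m v"
  by (auto simp: deg_def le_fun_def intro: sum_mono)

lemma deg_eq_imp_eq:
  assumes "u \<in> tuples m" "v \<in> tuples m" "u \<le> v" "deg m v \<le> deg m u" shows "u = v"
proof (rule ccontr)
  assume "u \<noteq> v"
  then obtain i where i: "u i \<noteq> v i" by (auto simp: fun_eq_iff)
  then have lt: "u i < v i" using assms(3) by (simp add: le_fun_def order_less_le)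
  then have "i \<in> {1..m}" using assms(2) by (auto simp: tuples_def)
  then have "deg m u < deg m v" unfolding deg_def using assms(3) lt
    by (intro sum_strict_mono_ex1) (auto simp: le_fun_def)
  then show False using assms(4) by simp
qed

lemma sup_tuples: "x \<in> tuples m \<Longrightarrow> y \<in> tuples m \<Longrightarrow> sup x y \<in> tuples m"
  by (simp add: tuples_def)

lemma le_dec: "\<beta> \<le> u \<Longrightarrow> \<beta> k < u k \<Longrightarrow> \<beta> \<le> dec k u"
  by (auto simp: le_fun_def dec_apply)

lemma dec_le: "dec k u \<le> u"
  by (auto simp: le_fun_def dec_apply)

lemma le_mult: "u \<le> mult k u"
  by (auto simp: le_fun_def mult_apply)

lemma upset_Suc:
  assumes N: "N \<subseteq> tuples m"
  shows "upset m N (Suc e) = shadow {1..m} (upset m N e) \<union> {\<beta> \<in> N. deg m \<beta> = Suc e}"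
proof (intro equalityI subsetI)
  fix u assume u: "u \<in> upset m N (Suc e)"
  then obtain \<beta> where b: "\<beta> \<in> N" "\<beta> \<le> u" and um: "u \<in> mon {1..m} (Suc e)" by (auto simp: upset_def)
  show "u \<in> shadow {1..m} (upset m N e) \<union> {\<beta> \<in> N. deg m \<beta> = Suc e}"
  proof (cases "\<beta> = u")
    case True
    then show ?thesis using b um by (auto simp: mon_tuples)
  next
    case False
    then obtain k where k: "\<beta> k < u k" using b(2) by (metis le_fun_def antisym not_le)
    then have kU: "k \<in> {1..m}" using um mon_zero[of u "{1..m}"] by force
    have "dec k u \<in> upset m N e"
      using dec_in_mon[OF _ um] le_dec[OF b(2) k] b(1) k by (auto simp: upset_def)
    then show ?thesis using shadowI_dec[OF kU, of u] k by auto
  qed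
next
  fix u assume "u \<in> shadow {1..m} (upset m N e) \<union> {\<beta> \<in> N. deg m \<beta> = Suc e}"
  then show "u \<in> upset m N (Suc e)"
  proof
    assume "u \<in> shadow {1..m} (upset m N e)"
    then obtain k v where "k \<in> {1..m}" "v \<in> upset m N e" "u = mult k v" by (auto simp: shadow_def)
    then show ?thesis using mult_in_mon[of "{1..m}" k v e] order_trans[OF _ le_mult]
      by (auto simp: upset_def)
  next
    assume "u \<in> {\<beta> \<in> N. deg m \<beta> = Suc e}"
    then show ?thesis using N by (auto simp: upset_def mon_tuples)
  qed
qed

text \<open>A generator in the shadow would be a proper multiple of another one; in an antichain all
  generators of the new degree are therefore additional.\<close>

lemma card_upset_Suc:
  assumes N: "N \<subseteq> tuples m" and anti: "\<And>x y. x \<in> N \<Longrightarrow> y \<in> N \<Longrightarrow> x \<le> y \<Longrightarrow> x = y"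
  shows "card (upset m N (Suc e)) = card (shadow {1..m} (upset m N e)) + card {\<beta> \<in> N. deg m \<beta> = Suc e}"
  unfolding upset_Suc[OF N]
proof (rule card_Un_disjoint)
  have fin: "finite (upset m N (Suc e))" by (rule finite_upset)
  show "finite (shadow {1..m} (upset m N e))" "finite {\<beta> \<in> N. deg m \<beta> = Suc e}"
    using fin unfolding upset_Suc[OF N] by auto
  show "shadow {1..m} (upset m N e) \<inter> {\<beta> \<in> N. deg m \<beta> = Suc e} = {}"
  proof (rule ccontr)
    assume "\<not> ?thesis"
    then obtain k v where v: "v \<in> upset m N e" "mult k v \<in> N" by (auto simp: shadow_def)
    then obtain \<beta> where b: "\<beta> \<in> N" "\<beta> \<le> v" by (auto simp: upset_def)
    then have "\<beta> = mult k v" using anti[OF b(1) v(2)] order_trans[OF b(2) le_mult] by blast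
    then have "mult k v \<le> v" using b by simp
    then show False by (auto simp: le_fun_def mult_apply dest: spec[of _ k])
  qed
qed

text \<open>Edges of the graph whose paths become the sequences in \<open>D_cond\<close>.\<close>

definition link :: "nat \<Rightarrow> (nat \<Rightarrow> nat) set \<Rightarrow> nat \<Rightarrow> (nat \<Rightarrow> nat) \<Rightarrow> ((nat \<Rightarrow> nat) \<times> (nat \<Rightarrow> nat)) set" where
  "link m N p \<tau> = {(x, y). x \<in> N \<and> y \<in> N \<and> x \<le> \<tau> \<and> y \<le> \<tau> \<and> deg m (sup x y) \<le> p}"

lemma link_mono: "\<tau>' \<le> \<tau> \<Longrightarrow> link m N p \<tau>' \<subseteq> link m N p \<tau>"
  by (auto simp: link_def intro: order_trans)

lemma sym_link: "sym (link m N p \<tau>)"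
  by (auto simp: sym_def link_def sup_commute)

text \<open>A disconnected pair below a \<open>\<tau>\<close> of minimal degree produces a gap of the upset in degree
  \<open>deg \<tau> - 2\<close>, where the shadow is still minimal by persistence.\<close>

lemma connected:
  assumes N: "N \<subseteq> tuples m" and dN: "\<And>\<beta>. \<beta> \<in> N \<Longrightarrow> deg m \<beta> \<le> d" and G: "gotzmann {1..m} d (upset m N d)"
  shows "\<tau> \<in> tuples m \<Longrightarrow> \<beta>1 \<in> N \<Longrightarrow> \<beta>2 \<in> N \<Longrightarrow> \<beta>1 \<le> \<tau> \<Longrightarrow> \<beta>2 \<le> \<tau> \<Longrightarrow> (\<beta>1, \<beta>2) \<in> (link m N (Suc d) \<tau>)\<^sup>*"
proof (induction "deg m \<tau>" arbitrary: \<tau> \<beta>1 \<beta>2 rule: less_induct)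
  case less
  let ?U = "{1..m}"
  let ?R = "link m N (Suc d) \<tau>"
  have up_Suc: "upset m N (Suc e) = shadow ?U (upset m N e)" if "d \<le> e" for e
  proof -
    have "{\<beta> \<in> N. deg m \<beta> = Suc e} = {}" using dN that by fastforce
    then show ?thesis using upset_Suc[OF N, of e] by (metis sup_bot.right_neutral)
  qed
  have G': "gotzmann ?U e (upset m N e)" if "d \<le> e" for e
    using that by (induction rule: dec_induct) (use G gotzmann_shadow up_Suc in auto)
  \<comment> \<open>If both lie strictly below \<open>\<tau>\<close> at \<open>i\<close>, so does
    their least upper bound, which then has smaller degree and falls under the induction
    hypothesis.\<close>
  have sup_less: "(x, y) \<in> ?R\<^sup>*" if xy: "x \<in> N" "y \<in> N" "x \<le> \<tau>" "y \<le> \<tau>" and i: "x i < \<tau> i" "y i < \<tau> i" for x y i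
  proof -
    have t: "sup x y \<in> tuples m" using xy N sup_tuples by blast
    have le: "sup x y \<le> \<tau>" using xy by simp
    have "sup x y i < \<tau> i" using i by (simp add: sup_nat_def)
    then have "sup x y \<noteq> \<tau>" by auto
    then have "deg m (sup x y) < deg m \<tau>"
      using deg_eq_imp_eq[OF t less.prems(1) le] deg_mono[OF le] by (metis linorder_not_less)
    then have "(x, y) \<in> (link m N (Suc d) (sup x y))\<^sup>*"
      using less.hyps[OF _ t xy(1,2)] by simp
    then show ?thesis using rtrancl_mono[OF link_mono[OF le]] by blast
  qed
  have sym: "(y, x) \<in> ?R\<^sup>*" if "(x, y) \<in> ?R\<^sup>*" for x y
    using symD[OF sym_rtrancl[OF sym_link] that] .
  show ?case
  proof (rule ccontr)
    assume nc: "(\<beta>1, \<beta>2) \<notin> ?R\<^sup>*"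
    have d\<tau>: "Suc d < deg m \<tau>"
    proof (rule ccontr)
      assume "\<not> Suc d < deg m \<tau>"
      then have "deg m (sup \<beta>1 \<beta>2) \<le> Suc d" using deg_mono[of "sup \<beta>1 \<beta>2" \<tau> m] less.prems by simp
      then have "(\<beta>1, \<beta>2) \<in> ?R" using less.prems by (simp add: link_def)
      then show False using nc by blast
    qed
    then obtain e where e: "deg m \<tau> = Suc (Suc e)" "d \<le> e"
      by (metis Suc_leD Suc_le_D less_eq_Suc_le Suc_le_mono)
    have ex: "\<exists>i. \<beta> i < \<tau> i" if "\<beta> \<in> N" "\<beta> \<le> \<tau>" for \<beta>
    proof (rule ccontr)
      assume "\<nexists>i. \<beta> i < \<tau> i"
      then have "\<tau> \<le> \<beta>" by (simp add: le_fun_def not_less)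
      then show False using deg_mono[of \<tau> \<beta> m] dN[OF that(1)] d\<tau> by simp
    qed
    obtain i j where i: "\<beta>1 i < \<tau> i" and j: "\<beta>2 j < \<tau> j" using ex less.prems by blast
    have ij: "i \<noteq> j" using sup_less[of \<beta>1 \<beta>2 i] nc i j less.prems by blast
    have \<tau>m: "\<tau> \<in> mon ?U (Suc (Suc e))" using less.prems(1) e by (simp add: mon_tuples)
    have iU: "i \<in> ?U" "j \<in> ?U" using i j mon_zero[OF \<tau>m] by force+
    define x where "x = dec i (dec j \<tau>)"
    have djm: "dec j \<tau> \<in> mon ?U (Suc e)" and dim: "dec i \<tau> \<in> mon ?U (Suc e)"
      using dec_in_mon[OF _ \<tau>m] i j by auto
    have xi: "mult i x = dec j \<tau>" and xj: "mult j x = dec i \<tau>"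
      using i j ij by (auto simp: x_def mult_apply dec_apply)
    have xm: "x \<in> mon ?U e" unfolding x_def
      by (rule dec_in_mon[OF _ djm]) (use i ij in \<open>auto simp: dec_apply\<close>)
    have x\<tau>: "x i < \<tau> i" "x j < \<tau> j" "x \<le> \<tau>" using i j by (auto simp: x_def dec_apply le_fun_def)
    \<comment> \<open>A generator below \<open>x\<close> is strictly below \<open>\<tau>\<close> at
      \<open>i\<close>, like \<open>\<beta>1\<close>, and at \<open>j\<close>, like
      \<open>\<beta>2\<close>, so it would connect the pair.\<close>
    have "x \<notin> upset m N e"
    proof
      assume "x \<in> upset m N e"
      then obtain \<beta> where b: "\<beta> \<in> N" "\<beta> \<le> x" by (auto simp: upset_def)
      then have "\<beta> i < \<tau> i" "\<beta> j < \<tau> j" "\<beta> \<le> \<tau>" using x\<tau> by (auto simp: le_fun_def intro: le_less_trans order_trans)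
      then have "(\<beta>1, \<beta>) \<in> ?R\<^sup>*" "(\<beta>, \<beta>2) \<in> ?R\<^sup>*" using sup_less b i j less.prems by blast+
      then show False using nc by (metis rtrancl_trans)
    qed
    moreover have "mult i x \<in> shadow ?U (upset m N e)" unfolding xi up_Suc[OF e(2), symmetric]
      using djm le_dec[OF less.prems(5) j] less.prems by (auto simp: upset_def)
    moreover have "mult j x \<in> shadow ?U (upset m N e)" unfolding xj up_Suc[OF e(2), symmetric]
      using dim le_dec[OF less.prems(4) i] less.prems by (auto simp: upset_def)
    ultimately obtain k where k: "k \<in> ?U - {i, j}" "0 < x k"
        "mult i (dec k x) \<in> upset m N e" "mult j (dec k x) \<in> upset m N e"
      using gotzmann_gap[OF finite_atLeastAtMost G'[OF e(2)] iU ij xm] by blast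
    obtain \<beta> where b: "\<beta> \<in> N" "\<beta> \<le> mult i (dec k x)" using k(3) by (auto simp: upset_def)
    obtain \<beta>' where b': "\<beta>' \<in> N" "\<beta>' \<le> mult j (dec k x)" using k(4) by (auto simp: upset_def)
    have xk: "x k = \<tau> k" "k \<noteq> i" "k \<noteq> j" using k by (auto simp: x_def dec_apply)
    have 1: "mult i (dec k x) \<le> \<tau>" "mult j (dec k x) \<le> \<tau>"
      using i j ij xk by (auto simp: x_def le_fun_def mult_apply dec_apply)
    have 2: "mult i (dec k x) k < \<tau> k" "mult i (dec k x) j < \<tau> j" "mult j (dec k x) k < \<tau> k" "mult j (dec k x) i < \<tau> i"
      using i j ij xk k by (auto simp: x_def mult_apply dec_apply)
    have 3: "\<beta> \<le> \<tau>" "\<beta> k < \<tau> k" "\<beta> j < \<tau> j" "\<beta>' \<le> \<tau>" "\<beta>' k < \<tau> k" "\<beta>' i < \<tau> i"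
      using order_trans[OF b(2) 1(1)] order_trans[OF b'(2) 1(2)] le_less_trans[OF le_funD[OF b(2)] 2(1)]
        le_less_trans[OF le_funD[OF b(2)] 2(2)] le_less_trans[OF le_funD[OF b'(2)] 2(3)]
        le_less_trans[OF le_funD[OF b'(2)] 2(4)] by auto
    \<comment> \<open>Neighbours in \<open>\<beta>1\<close>, \<open>\<beta>'\<close>,
      \<open>\<beta>\<close>, \<open>\<beta>2\<close> are strictly below \<open>\<tau>\<close> at a
      common index, namely \<open>i\<close>, \<open>k\<close> and \<open>j\<close> in turn.\<close>
    have "(\<beta>1, \<beta>') \<in> ?R\<^sup>*" using sup_less[OF less.prems(2) b'(1) less.prems(4) 3(4) i 3(6)] .
    moreover have "(\<beta>', \<beta>) \<in> ?R\<^sup>*" using sup_less[OF b'(1) b(1) 3(4,1,5,2)] .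
    moreover have "(\<beta>, \<beta>2) \<in> ?R\<^sup>*" using sup_less[OF b(1) less.prems(3) 3(1) less.prems(5) 3(3) j] .
    ultimately show False using nc by (metis rtrancl_trans)
  qed
qed

section \<open>From paths to the sequences of the condition\<close>

lemma le_minus_unit_iff: "le_minus_unit \<beta> \<tau> k \<longleftrightarrow> \<beta> \<le> \<tau> \<and> \<beta> k < \<tau> k"
proof
  assume "le_minus_unit \<beta> \<tau> k"
  then have h: "int (\<beta> l) \<le> int (\<tau> l) - int (unit_tuple k l)" for l by (simp add: le_minus_unit_def)
  have "\<beta> l \<le> \<tau> l" for l using h[of l] by simp
  moreover have "\<beta> k < \<tau> k" using h[of k] by (simp add: unit_tuple_def)
  ultimately show "\<beta> \<le> \<tau> \<and> \<beta> k < \<tau> k" by (simp add: le_fun_def)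
next
  assume h: "\<beta> \<le> \<tau> \<and> \<beta> k < \<tau> k"
  then show "le_minus_unit \<beta> \<tau> k"
    unfolding le_minus_unit_def unit_tuple_def le_fun_def by (auto simp: int_ops(6))
qed

text \<open>The conclusion also records \<open>\<eta> s = \<beta>\<close>, which the induction along
  the path needs in order to append the next element.\<close>

lemma link_sequence:
  assumes path: "(\<beta>1, \<beta>) \<in> (link m N p \<tau>)\<^sup>*" and N: "\<And>\<beta>. \<beta> \<in> N \<Longrightarrow> deg m \<beta> \<le> p" and \<tau>: "\<tau> \<in> tuples m" "p < deg m \<tau>"
    and b1: "\<beta>1 \<in> N" "le_minus_unit \<beta>1 \<tau> i"
    and j: "le_minus_unit \<beta> \<tau> j"
  shows "\<exists>(s::nat) \<eta> k. 1 \<le> s \<and>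
           (\<forall>l \<in> {1..s}. \<eta> l \<in> N \<and> k l \<in> {1..m} \<and> le_minus_unit (\<eta> l) \<tau> (k l)) \<and>
           k 1 = i \<and> k s = j \<and> \<eta> s = \<beta> \<and>
           (\<forall>l \<in> {1..<s}. deg m (sup (\<eta> l) (\<eta> (l + 1))) \<le> p)"
  using path j
proof (induction arbitrary: j)
  have idx: "i \<in> {1..m}" if "le_minus_unit \<beta> \<tau> i" for \<beta> i
    using that \<tau> unfolding le_minus_unit_iff tuples_def by force
  {
    case base
    \<comment> \<open>One element can carry two directions: \<open>\<beta>1\<close> is repeated,
      first with \<open>i\<close>, then with \<open>j\<close>, and its own degree is at most
      \<open>p\<close>.\<close>
    show ?case
      using base b1 N idx
      by (intro exI[of _ 2] exI[of _ "\<lambda>_. \<beta>1"] exI[of _ "\<lambda>l. if l = 1 then i else j"]) auto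
  next
    case (step \<beta> \<beta>')
    have b: "\<beta> \<in> N" "\<beta>' \<in> N" "\<beta> \<le> \<tau>" "deg m (sup \<beta> \<beta>') \<le> p" using step.hyps(2) by (auto simp: link_def)
    \<comment> \<open>Any direction serves at an intermediate element; one exists because the degree
      of \<open>\<beta>\<close> is below that of \<open>\<tau>\<close>.\<close>
    have "\<not> \<tau> \<le> \<beta>" using deg_mono[of \<tau> \<beta> m] N[OF b(1)] \<tau> by auto
    then obtain i' where "\<beta> i' < \<tau> i'" by (auto simp: le_fun_def not_le)
    then have "le_minus_unit \<beta> \<tau> i'" using b by (simp add: le_minus_unit_iff)
    then obtain s \<eta> k where h: "(1::nat) \<le> s"
      "\<forall>l \<in> {1..s}. \<eta> l \<in> N \<and> k l \<in> {1..m} \<and> le_minus_unit (\<eta> l) \<tau> (k l)"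
      "k 1 = i" "k s = i'" "\<eta> s = \<beta>" "\<forall>l \<in> {1..<s}. deg m (sup (\<eta> l) (\<eta> (l + 1))) \<le> p"
      using step.IH by blast
    show ?case
    proof (intro exI[of _ "Suc s"] exI[of _ "\<eta>(Suc s := \<beta>')"] exI[of _ "k(Suc s := j)"] conjI ballI)
      fix l assume "l \<in> {1..Suc s}"
      then have "l = Suc s \<or> l \<in> {1..s}" by auto
      then show "(\<eta>(Suc s := \<beta>')) l \<in> N" "(k(Suc s := j)) l \<in> {1..m}"
          "le_minus_unit ((\<eta>(Suc s := \<beta>')) l) \<tau> ((k(Suc s := j)) l)"
        using h(2) b(2) step.prems idx by auto
    next
      fix l assume "l \<in> {1..<Suc s}"
      then have "l = s \<or> l \<in> {1..<s}" by auto
      then show "deg m (sup ((\<eta>(Suc s := \<beta>')) l) ((\<eta>(Suc s := \<beta>')) (l + 1))) \<le> p"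
        using h b(4) by auto
    qed (use h in auto)
  }
qed

lemma antichain_seqD: "antichain_seq m \<alpha> \<Longrightarrow> x \<in> set \<alpha> \<Longrightarrow> y \<in> set \<alpha> \<Longrightarrow> x \<le> y \<Longrightarrow> x = y"
  unfolding antichain_seq_def by (metis in_set_conv_nth)

text \<open>Without generators of degree \<open>Suc d\<close>, the generators up to that degree are
  those of degree at most \<open>d\<close>, and \<open>connected\<close> gives paths with bound
  \<open>Suc d\<close>.\<close>

lemma D_cond_of_gotzmann:
  assumes N: "antichain_seq m \<alpha>" and no: "\<And>\<beta>. \<beta> \<in> set \<alpha> \<Longrightarrow> deg m \<beta> \<noteq> Suc d"
    and G: "gotzmann {1..m} d (upset m (set \<alpha>) d)"
  shows "D_cond m \<alpha> (Suc d)"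
  unfolding D_cond_def
proof (intro ballI allI impI, elim conjE bexE)
  let ?N = "Gamma_in m \<alpha> (Suc d)"
  fix \<tau> i j \<beta>1 \<beta>2
  assume t: "\<tau> \<in> lubs ?N - Gamma m (Suc d)" and b: "\<beta>1 \<in> ?N" "\<beta>2 \<in> ?N"
    "le_minus_unit \<beta>1 \<tau> i" "le_minus_unit \<beta>2 \<tau> j"
  have Nt: "?N \<subseteq> tuples m" using N by (auto simp: Gamma_in_def antichain_seq_def)
  have Nd: "deg m \<beta> \<le> d" if "\<beta> \<in> ?N" for \<beta> using that no by (fastforce simp: Gamma_in_def)
  have up: "upset m ?N d = upset m (set \<alpha>) d"
  proof -
    have "deg m \<beta> \<le> Suc d" if "\<beta> \<le> u" "u \<in> mon {1..m} d" for \<beta> u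
      using deg_mono[OF that(1), of m] that(2) by (simp add: mon_tuples)
    then show ?thesis unfolding upset_def Gamma_in_def by blast
  qed
  have tt: "\<tau> \<in> tuples m" using t Nt sup_tuples unfolding lubs_def by blast
  have dt: "Suc d < deg m \<tau>" using t tt by (auto simp: Gamma_def)
  have path: "(\<beta>1, \<beta>2) \<in> (link m ?N (Suc d) \<tau>)\<^sup>*"
    by (rule connected[OF Nt Nd _ tt]) (use b up G in \<open>auto simp: le_minus_unit_iff\<close>)
  have "deg m \<beta> \<le> Suc d" if "\<beta> \<in> ?N" for \<beta> using Nd[OF that] by simp
  then show "\<exists>(s::nat) \<eta> k. 1 \<le> s \<and>
           (\<forall>l \<in> {1..s}. \<eta> l \<in> ?N \<and> k l \<in> {1..m} \<and> le_minus_unit (\<eta> l) \<tau> (k l)) \<and>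
           k 1 = i \<and> k s = j \<and>
           (\<forall>l \<in> {1..<s}. deg m (sup (\<eta> l) (\<eta> (l + 1))) \<le> Suc d)"
    using link_sequence[OF path _ tt dt b(1,3,4)] by blast
qed

lemma card_upset_growth:
  assumes N: "antichain_seq m \<alpha>" and D: "\<not> D_cond m \<alpha> (Suc d)"
    and T: "lexseg {1..m} d T" "card T = card (upset m (set \<alpha>) d)"
  shows "Suc (card (shadow {1..m} T)) \<le> card (upset m (set \<alpha>) (Suc d))"
proof -
  have Nt: "set \<alpha> \<subseteq> tuples m" using N by (simp add: antichain_seq_def)
  have le: "card (shadow {1..m} T) \<le> card (shadow {1..m} (upset m (set \<alpha>) d))"
    using macaulayD[OF macaulay upset_subset T(1)] T(2) by simp
  have eq: "card (upset m (set \<alpha>) (Suc d)) =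
      card (shadow {1..m} (upset m (set \<alpha>) d)) + card {\<beta> \<in> set \<alpha>. deg m \<beta> = Suc d}"
    using card_upset_Suc[OF Nt antichain_seqD[OF N]] .
  show ?thesis
  proof (cases "\<exists>\<beta>\<in>set \<alpha>. deg m \<beta> = Suc d")
    case True
    then have "0 < card {\<beta> \<in> set \<alpha>. deg m \<beta> = Suc d}" by (auto simp: card_gt_0_iff)
    then show ?thesis using eq le by simp
  next
    case False
    then have "\<not> gotzmann {1..m} d (upset m (set \<alpha>) d)" using D_cond_of_gotzmann[OF N] D by blast
    then have "\<not> card (shadow {1..m} (upset m (set \<alpha>) d)) \<le> card (shadow {1..m} T)"
      using gotzI[OF _ macaulay upset_subset T] by auto
    then show ?thesis using eq by simp
  qed
qed

section \<open>The Ackermann weight of a monomial\<close>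

lemma ackermann_strict_mono_gt: "y < ackermann x y \<and> ackermann x y < ackermann x (Suc y)"
proof (induction x arbitrary: y)
  case (Suc x)
  have lt: "y' < ackermann x y'" for y' using Suc by blast
  have mono: "a < b \<Longrightarrow> ackermann x a < ackermann x b" for a b
    by (rule lift_Suc_mono_less[of "ackermann x"]) (use Suc in auto)
  have gt: "y < ackermann (Suc x) y" for y
  proof (induction y)
    case 0
    show ?case using lt[of 1] by simp
  next
    case IH: (Suc y)
    show ?case using lt[of "ackermann (Suc x) y"] IH by simp
  qed
  show ?case using gt lt[of "ackermann (Suc x) y"] by simp
qed simp

lemma ackermann_gt: "y < ackermann x y"
  using ackermann_strict_mono_gt by blast

lemma ackermann_less: "a < b \<Longrightarrow> ackermann x a < ackermann x b"
  by (rule lift_Suc_mono_less[of "ackermann x"]) (use ackermann_strict_mono_gt in auto)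

lemma ackermann_mono: "a \<le> b \<Longrightarrow> ackermann x a \<le> ackermann x b"
  using ackermann_less[of a b x] by (cases "a = b") auto

lemma ackermann_Suc_ge: "ackermann x y \<le> ackermann (Suc x) y"
proof (cases y)
  case 0
  then show ?thesis using ackermann_mono[of 0 1 x] by simp
next
  case (Suc y')
  have "Suc y' \<le> ackermann (Suc x) y'" using ackermann_gt[of y' "Suc x"] by simp
  then show ?thesis using Suc ackermann_mono by simp
qed

lemma ackermann_mono_left: "x \<le> x' \<Longrightarrow> ackermann x y \<le> ackermann x' y"
  by (rule lift_Suc_mono_le[of "\<lambda>x. ackermann x y"]) (rule ackermann_Suc_ge)

text \<open>The exchange rate behind the weight: one application at level \<open>Suc x\<close> is
  worth \<open>Suc y\<close> applications at level \<open>x\<close> started at 1.\<close>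

lemma ackermann_funpow: "ackermann (Suc x) y = (ackermann x ^^ Suc y) 1"
  by (induction y) auto

lemma funpow_ge: "y + n \<le> (ackermann x ^^ n) y"
proof (induction n)
  case (Suc n)
  then show ?case using ackermann_gt[of "(ackermann x ^^ n) y" x] by simp
qed simp

lemma funpow_mono_arg: "y \<le> y' \<Longrightarrow> (ackermann x ^^ n) y \<le> (ackermann x ^^ n) y'"
  by (induction n) (auto intro: ackermann_mono)

lemma funpow_mono_left: "x \<le> x' \<Longrightarrow> (ackermann x ^^ n) y \<le> (ackermann x' ^^ n) y"
proof (induction n)
  case (Suc n)
  then show ?case
    using ackermann_mono[of "(ackermann x ^^ n) y" "(ackermann x' ^^ n) y" x] ackermann_mono_left[of x x' "(ackermann x' ^^ n) y"]
    by simp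
qed simp

lemma funpow_mono_count: "n \<le> n' \<Longrightarrow> (ackermann x ^^ n) y \<le> (ackermann x ^^ n') y"
proof (rule lift_Suc_mono_le[of "\<lambda>n. (ackermann x ^^ n) y"])
  fix n show "(ackermann x ^^ n) y \<le> (ackermann x ^^ Suc n) y"
    using ackermann_gt[of "(ackermann x ^^ n) y" x] by simp
qed

text \<open>Stage \<open>n\<close> sees only the last \<open>n\<close> variables; the initial value
  1 keeps every stage above the degree of that part.\<close>

primrec weight :: "nat \<Rightarrow> (nat \<Rightarrow> nat) \<Rightarrow> nat \<Rightarrow> nat" where
  "weight m w 0 = 1"
| "weight m w (Suc n) = (ackermann n ^^ w (m - n)) (weight m w n)"

lemma deg_tail: "deg m w = (\<Sum>k<m. w (m - k))"
  unfolding deg_def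
  by (rule sum.reindex_bij_witness[of _ "\<lambda>k. m - k" "\<lambda>i. m - i"]) auto

lemma weight_ge: "Suc (\<Sum>k<n. w (m - k)) \<le> weight m w n"
proof (induction n)
  case (Suc n)
  then show ?case using funpow_ge[of "weight m w n" "w (m - n)" n] by simp
qed simp

lemma weight_gt_deg: "deg m w < weight m w m"
  using weight_ge[of w m m] by (simp add: deg_tail)

text \<open>Every application is replaced by one at the highest level \<open>k\<close>.\<close>

lemma weight_le: "n \<le> Suc k \<Longrightarrow> weight m w n \<le> (ackermann k ^^ (\<Sum>j<n. w (m - j))) 1"
proof (induction n)
  case (Suc n)
  have "weight m w (Suc n) \<le> (ackermann k ^^ w (m - n)) (weight m w n)"
    using funpow_mono_left[of n k] Suc.prems by simp
  also have "\<dots> \<le> (ackermann k ^^ w (m - n)) ((ackermann k ^^ (\<Sum>j<n. w (m - j))) 1)"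
    using Suc by (intro funpow_mono_arg) simp
  also have "\<dots> = (ackermann k ^^ (w (m - n) + (\<Sum>j<n. w (m - j)))) 1" by (simp add: funpow_add)
  finally show ?case by (simp add: add.commute)
qed simp

lemma weight_mono: "v \<le> w \<Longrightarrow> weight m v n \<le> weight m w n"
proof (induction n)
  case (Suc n)
  have "weight m v (Suc n) \<le> (ackermann n ^^ v (m - n)) (weight m w n)"
    using funpow_mono_arg[OF Suc.IH[OF Suc.prems]] by simp
  also have "\<dots> \<le> weight m w (Suc n)" using funpow_mono_count Suc.prems by (simp add: le_fun_def)
  finally show ?case .
qed simp

text \<open>Equal exponents from stage \<open>n\<close> on apply the same monotone maps to both
  sides.\<close>

lemma weight_mono_prefix:
  assumes "weight m v n \<le> weight m w n" "\<And>k. n \<le> k \<Longrightarrow> k < n' \<Longrightarrow> v (m - k) = w (m - k)" "n \<le> n'"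
  shows "weight m v n' \<le> weight m w n'"
  using assms(3,2)
proof (induction n' rule: dec_induct)
  case base
  then show ?case using assms(1) by simp
next
  case (step k)
  then show ?case using funpow_mono_arg by simp
qed

text \<open>A lexicographic descent at position \<open>m - n\<close> frees one application of \<open>ackermann n\<close>, which
  outgrows everything the later variables can contribute.\<close>

lemma weight_descent:
  assumes v: "v \<in> mon {1..m} (Suc d)" and w: "w \<in> mon {1..m} d" and m: "1 \<le> m"
    and lt: "lex_less v (mult m w)"
  shows "weight m v m \<le> weight m w m"
proof -
  have wm: "mult m w \<in> mon {1..m} (Suc d)" using w m by (intro mult_in_mon) auto
  obtain i where i: "v i < mult m w i" "\<And>j. j < i \<Longrightarrow> v j = mult m w j" using lt by (auto simp: lex_less_def)
  have iU: "i \<in> {1..m}" using i(1) mon_zero[OF wm, of i] by force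
  have "i \<noteq> m"
  proof
    assume im: "i = m"
    have "sum v {1..m} < sum (mult m w) {1..m}"
    proof (rule sum_strict_mono_ex1)
      show "\<forall>j\<in>{1..m}. v j \<le> mult m w j"
      proof
        fix j assume "j \<in> {1..m}"
        then show "v j \<le> mult m w j" using i im by (cases "j = m") auto
      qed
      show "\<exists>j\<in>{1..m}. v j < mult m w j" using i(1) iU by blast
    qed simp
    then show False using v wm by (simp add: mon_def)
  qed
  then have im: "i < m" using iU by simp
  define n where "n = m - i"
  have n: "1 \<le> n" "n < m" "i = m - n" using im iU by (auto simp: n_def)
  have lti: "v i < w i" using i(1) im by (simp add: mult_apply)
  have eqj: "v (m - k) = w (m - k)" if "n < k" "k < m" for k
    using i(2)[of "m - k"] that n by (auto simp: mult_apply)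
  define \<delta> where "\<delta> = w i - v i"
  have \<delta>: "1 \<le> \<delta>" "w i = v i + \<delta>" using lti by (auto simp: \<delta>_def)
  let ?t = "\<lambda>u. \<Sum>k<n. u (m - k)"
  have split: "deg m u = ?t u + u i + (\<Sum>k\<in>{Suc n..<m}. u (m - k))" for u
  proof -
    have "{..<m} = {..<Suc n} \<union> {Suc n..<m}" using n by auto
    moreover have "(\<Sum>k\<in>{..<Suc n} \<union> {Suc n..<m}. u (m - k)) =
        (\<Sum>k<Suc n. u (m - k)) + (\<Sum>k\<in>{Suc n..<m}. u (m - k))"
      by (rule sum.union_disjoint) auto
    ultimately show ?thesis unfolding deg_tail by (simp add: n(3))
  qed
  have "(\<Sum>k\<in>{Suc n..<m}. v (m - k)) = (\<Sum>k\<in>{Suc n..<m}. w (m - k))"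
    using eqj by (intro sum.cong) auto
  \<comment> \<open>The variables before \<open>i\<close> agree, so the later ones of
    \<open>v\<close> receive the \<open>\<delta>\<close> factors lost at \<open>i\<close> and the
    additional degree.\<close>
  then have tv: "?t v = ?t w + \<delta> + 1"
    using split[of v] split[of w] v w \<delta> by (simp add: mon_tuples)
  obtain n' where n': "n = Suc n'" using n(1) by (cases n) auto
  have t: "?t v = Suc (?t w + \<delta>)" using tv by simp
  \<comment> \<open>All later applications are bounded by level \<open>n'\<close>; that many of
    them, started at 1, make one application of \<open>ackermann n\<close>.\<close>
  have "weight m v n \<le> (ackermann n' ^^ ?t v) 1" by (rule weight_le) (simp add: n')
  also have "\<dots> = ackermann n (?t w + \<delta>)" unfolding t unfolding n' by (rule ackermann_funpow[symmetric])
  \<comment> \<open>The other \<open>\<delta> - 1\<close> applications freed at \<open>i\<close>,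
    started at the tail weight of \<open>w\<close>, already reach the argument.\<close>
  also have "\<dots> \<le> ackermann n ((ackermann n ^^ (\<delta> - 1)) (weight m w n))"
  proof (rule ackermann_mono)
    show "?t w + \<delta> \<le> (ackermann n ^^ (\<delta> - 1)) (weight m w n)"
      using funpow_ge[of "weight m w n" "\<delta> - 1" n] weight_ge[of w m n] \<delta>(1) by simp
  qed
  also have "\<dots> = (ackermann n ^^ Suc (\<delta> - 1)) (weight m w n)" by simp
  also have "Suc (\<delta> - 1) = \<delta>" using \<delta> by simp
  finally have "weight m v n \<le> (ackermann n ^^ \<delta>) (weight m w n)" .
  then have "(ackermann n ^^ v i) (weight m v n) \<le> (ackermann n ^^ v i) ((ackermann n ^^ \<delta>) (weight m w n))"
    by (rule funpow_mono_arg)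
  then have "weight m v (Suc n) \<le> weight m w (Suc n)"
    using n(3) \<delta>(2) by (simp add: funpow_add)
  then show ?thesis using eqj n by (intro weight_mono_prefix[of m v "Suc n" w m]) auto
qed

text \<open>Multiplication by a power of the last variable, which gives the least element of an
  iterated shadow by \<open>lex_least_shadow\<close>.\<close>

definition raise :: "nat \<Rightarrow> nat \<Rightarrow> (nat \<Rightarrow> nat) \<Rightarrow> nat \<Rightarrow> nat" where
  "raise m t w = w(m := w m + t)"

lemma raise_0 [simp]: "raise m 0 w = w"
  by (simp add: raise_def)

lemma raise_Suc: "raise m (Suc t) w = mult m (raise m t w)"
  by (auto simp: raise_def mult_def)

lemma raise_Suc': "raise m (Suc t) w = raise m t (mult m w)"
  by (auto simp: raise_def mult_def)

lemma raise_in_mon: "1 \<le> m \<Longrightarrow> w \<in> mon {1..m} d \<Longrightarrow> raise m t w \<in> mon {1..m} (d + t)"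
  by (induction t) (auto simp: raise_Suc intro!: mult_in_mon)

lemma lex_less_raise: "lex_less v w \<Longrightarrow> lex_less (raise m t v) (raise m t w)"
  by (induction t) (auto simp: raise_Suc intro: lex_less_mult)

lemma weight_raise_descent:
  assumes m: "1 \<le> m" and v: "v \<in> mon {1..m} (Suc d)" and w: "w \<in> mon {1..m} d" and lt: "lex_less v (mult m w)"
  shows "weight m (raise m t v) m \<le> weight m (raise m t w) m"
proof (rule weight_descent[OF _ raise_in_mon[OF m w] m])
  show "raise m t v \<in> mon {1..m} (Suc (d + t))" using raise_in_mon[OF m v, of t] by simp
  show "lex_less (raise m t v) (mult m (raise m t w))"
    using lex_less_raise[OF lt, of m t] by (simp add: raise_Suc[symmetric] raise_Suc'[symmetric])
qed

text \<open>A descent within one degree pays for an additional factor of variable \<open>m\<close>: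
  \<open>weight_raise_descent\<close> is applied to \<open>mult m v\<close>.\<close>

lemma weight_lex_mono:
  assumes m: "1 \<le> m" and v: "v \<in> mon {1..m} d" and w: "w \<in> mon {1..m} d" and lt: "lex_less v w"
  shows "weight m (raise m (Suc t) v) m \<le> weight m (raise m t w) m"
    and "weight m (raise m t v) m \<le> weight m (raise m t w) m"
proof -
  show 1: "weight m (raise m (Suc t) v) m \<le> weight m (raise m t w) m"
    unfolding raise_Suc' by (rule weight_raise_descent[OF m mult_in_mon w lex_less_mult[OF lt]]) (use v m in auto)
  show "weight m (raise m t v) m \<le> weight m (raise m t w) m"
    by (rule order_trans[OF weight_mono 1]) (simp add: raise_def le_fun_def)
qed

section \<open>Least elements of segments\<close>

definition lex_least :: "(nat \<Rightarrow> nat) set \<Rightarrow> (nat \<Rightarrow> nat) \<Rightarrow> bool" where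
  "lex_least L w \<longleftrightarrow> w \<in> L \<and> (\<forall>v\<in>L. v = w \<or> lex_less w v)"

lemma lex_least_exists: "finite L \<Longrightarrow> L \<noteq> {} \<Longrightarrow> \<exists>w. lex_least L w"
  unfolding lex_least_def using lex_min by metis

lemma lex_least_subset: "lex_least L w \<Longrightarrow> lex_least L' w' \<Longrightarrow> L' \<subseteq> L \<Longrightarrow> w' = w \<or> lex_less w w'"
  by (auto simp: lex_least_def)

lemma lex_least_shadow:
  assumes m: "1 \<le> m" and L: "lex_least L w" shows "lex_least (shadow {1..m} L) (mult m w)"
  unfolding lex_least_def
proof (intro conjI ballI)
  show "mult m w \<in> shadow {1..m} L" using L m by (intro shadowI) (auto simp: lex_least_def)
  fix v assume "v \<in> shadow {1..m} L"
  then obtain k u where k: "k \<in> {1..m}" "u \<in> L" "v = mult k u" by (auto simp: shadow_def)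
  have 1: "mult m u = mult m w \<or> lex_less (mult m w) (mult m u)"
    using L k lex_less_mult[of w u m] by (auto simp: lex_least_def)
  have 2: "v = mult m u \<or> lex_less (mult m u) v"
    using k lex_less_mult_mult[of k m u] by (cases "k = m") auto
  show "v = mult m w \<or> lex_less (mult m w) v" using 1 2 by (auto intro: lex_less_trans)
qed

text \<open>Each of the \<open>n\<close> additional elements pushes the least element down and so
  pays for one more factor of variable \<open>m\<close>.\<close>

lemma weight_lexseg:
  assumes m: "1 \<le> m"
  shows "lexseg {1..m} d L \<Longrightarrow> lexseg {1..m} d L' \<Longrightarrow> lex_least L w \<Longrightarrow> lex_least L' w' \<Longrightarrow>
    card L' + n \<le> card L \<Longrightarrow> weight m (raise m (t + n) w) m \<le> weight m (raise m t w') m"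
proof (induction n arbitrary: L w)
  case 0
  have sub: "L' \<subseteq> L" by (rule lexseg_subset[OF _ 0(2,1)]) (use 0 in auto)
  have mon: "w \<in> mon {1..m} d" "w' \<in> mon {1..m} d"
    using 0 lexseg_mon by (auto simp: lex_least_def)
  have "w' = w \<or> lex_less w w'" using lex_least_subset[OF 0(3,4) sub] .
  then show ?case using weight_lex_mono(2)[OF m mon] by auto
next
  case (Suc n)
  have V: "finite {1..m}" by simp
  have finL: "finite L" using lexseg_finite[OF V Suc.prems(1)] .
  have wL: "w \<in> L" "\<And>v. v \<in> L \<Longrightarrow> v = w \<or> lex_less w v" using Suc.prems(3) by (auto simp: lex_least_def)
  have Lm: "L \<subseteq> mon {1..m} d" using lexseg_mon[OF Suc.prems(1)] .
  let ?M = "L - {w}"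
  have M: "lexseg {1..m} d ?M" unfolding lexseg_def
  proof (intro conjI ballI impI)
    fix u v assume u: "u \<in> ?M" and v: "v \<in> mon {1..m} d" and uv: "lex_less u v"
    have "v \<in> L" using lexsegD[OF Suc.prems(1)] u v uv by blast
    moreover have "v \<noteq> w" using uv wL(2)[of u] u lex_less_asym by blast
    ultimately show "v \<in> ?M" by simp
  qed (use Lm in blast)
  have cM: "card L' + n \<le> card ?M" using Suc.prems(5) finL wL by simp
  have "L' \<noteq> {}" using Suc.prems(4) by (auto simp: lex_least_def)
  then have "0 < card L'" using lexseg_finite[OF V Suc.prems(2)] by (simp add: card_gt_0_iff)
  then have "0 < card ?M" using cM by linarith
  then have "?M \<noteq> {}" by (metis card.empty less_irrefl)
  then obtain w2 where w2: "lex_least ?M w2" using lex_least_exists finL by blast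
  have w2L: "w2 \<in> L" "lex_less w w2" using w2 wL(2)[of w2] by (auto simp: lex_least_def)
  have "weight m (raise m (Suc (t + n)) w) m \<le> weight m (raise m (t + n) w2) m"
    using weight_lex_mono(1)[OF m _ _ w2L(2)] Lm wL w2L by blast
  also have "\<dots> \<le> weight m (raise m t w') m" by (rule Suc.IH[OF M Suc.prems(2) w2 Suc.prems(4) cM])
  finally show ?case by simp
qed

text \<open>The second largest monomial of degree \<open>r\<close>, hence the least element of the
  segment of size 2.\<close>

definition start :: "nat \<Rightarrow> nat \<Rightarrow> nat" where
  "start r = (\<lambda>_. 0)(1 := r - 1, 2 := 1)"

definition limit :: "nat \<Rightarrow> nat \<Rightarrow> nat" where
  "limit m r = (ackermann (m - 1) ^^ r) 0"

lemma start_in_mon: assumes "2 \<le> m" "1 \<le> r" shows "start r \<in> mon {1..m} r"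
proof -
  have "sum (start r) {1..m} = sum (start r) {1, 2}"
    using assms by (intro sum.mono_neutral_right) (auto simp: start_def)
  also have "\<dots> = r" using assms by (simp add: start_def)
  finally show ?thesis using assms by (auto simp: mon_def start_def)
qed

text \<open>The single factor of variable 2 contributes
  \<open>ackermann (m - 2) 1 = ackermann (m - 1) 0\<close>, which completes the \<open>r - 1\<close>
  applications at level \<open>m - 1\<close> to \<open>r\<close> applications from 0.\<close>

lemma weight_start: assumes m: "2 \<le> m" and r: "1 \<le> r" shows "weight m (start r) m = limit m r"
proof -
  obtain m' where m': "m = Suc (Suc m')" using m by (metis add_2_eq_Suc le_Suc_ex)
  have "weight m (start r) n = 1" if "n \<le> m'" for n
    using that by (induction n) (auto simp: start_def m')
  then have "weight m (start r) (Suc m') = ackermann m' 1" by (simp add: start_def m' One_nat_def)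
  then have "weight m (start r) (Suc (Suc m')) = (ackermann (Suc m') ^^ (r - 1)) (ackermann (Suc m') 0)"
    by (simp add: start_def m')
  also have "\<dots> = (ackermann (Suc m') ^^ Suc (r - 1)) 0" by (simp add: funpow_swap1)
  finally show ?thesis using r by (simp add: limit_def m')
qed

lemma pure_in_mon: "1 \<le> m \<Longrightarrow> single 1 r \<in> mon {1..m} r"
  by (auto simp: mon_def sum.delta)

lemma start_less_pure: "1 \<le> r \<Longrightarrow> lex_less (start r) (single 1 r)"
  by (intro lex_lessI[of _ 1]) (auto simp: start_def)

lemma start_less_imp:
  assumes m: "2 \<le> m" and r: "1 \<le> r" and v: "v \<in> mon {1..m} r" and lt: "lex_less (start r) v"
  shows "v = single 1 r"
proof
  obtain i where i: "start r i < v i" "\<And>j. j < i \<Longrightarrow> start r j = v j" using lt by (auto simp: lex_less_def)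
  have le: "sum v A \<le> r" if "A \<subseteq> {1..m}" for A
    using sum_mono2[of "{1..m}" A v] that v by (simp add: mon_def)
  have iU: "i \<in> {1..m}" using i(1) mon_zero[OF v, of i] by force
  have "i = 1"
  proof (rule ccontr)
    assume "i \<noteq> 1"
    then have "1 < i" using iU by auto
    then have v1: "v 1 = r - 1" using i(2)[of 1] by (simp add: start_def)
    show False
    proof (cases "i = 2")
      case True
      then show False using le[of "{1, 2}"] v1 i(1) m r by (simp add: start_def)
    next
      case False
      then have "2 < i" using \<open>1 < i\<close> by simp
      then have "v 2 = 1" using i(2)[of 2] by (simp add: start_def)
      then show False using le[of "{1, 2, i}"] v1 i(1) iU m r \<open>2 < i\<close> by (simp add: start_def)
    qed
  qed
  then have v1: "r \<le> v 1" using i(1) r by (simp add: start_def)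
  fix j
  show "v j = (single 1 r) j"
  proof (cases "j = 1 \<or> j \<notin> {1..m}")
    case True
    then show ?thesis using v1 le[of "{1}"] m v mon_zero[OF v] by auto
  next
    case False
    then show ?thesis using v1 le[of "{1, j}"] m by auto
  qed
qed

lemma start_seg:
  assumes m: "2 \<le> m" and r: "1 \<le> r"
  shows "\<exists>L. lexseg {1..m} r L \<and> card L = 2 \<and> lex_least L (start r)"
proof -
  define x :: "nat \<Rightarrow> nat" where "x = single 1 r"
  have mon: "start r \<in> mon {1..m} r" using start_in_mon[OF m r] .
  have xm: "x \<in> mon {1..m} r" using pure_in_mon[of m r] m by (simp add: x_def)
  have lt: "lex_less (start r) x" using start_less_pure[OF r] by (simp add: x_def)
  have "lexseg {1..m} r {start r, x}" unfolding lexseg_def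
  proof (intro conjI ballI impI)
    fix u v assume u: "u \<in> {start r, x}" and v: "v \<in> mon {1..m} r" and uv: "lex_less u v"
    have "lex_less (start r) v" using u uv lt lex_less_trans by blast
    then show "v \<in> {start r, x}" using start_less_imp[OF m r v] by (simp add: x_def)
  qed (use mon xm in auto)
  moreover have "start r \<noteq> x" using lt by auto
  ultimately show ?thesis using lt by (intro exI[of _ "{start r, x}"]) (auto simp: lex_least_def)
qed

text \<open>\<open>c p\<close> counts the generators of degree at most \<open>p\<close>. A surplus over the required \<open>p - r + 2\<close> generators is
  credited as multiplication of the last monomial by powers of the last variable.\<close>

lemma accounting:
  assumes m: "2 \<le> m" and r: "1 \<le> r" and rq: "r \<le> q"
    and T: "\<And>p. r \<le> p \<Longrightarrow> p \<le> q \<Longrightarrow> lexseg {1..m} p (T p)"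
    and start: "c r \<le> card (T r)"
    and step: "\<And>p. r \<le> p \<Longrightarrow> p < q \<Longrightarrow> card (shadow {1..m} (T p)) + c (Suc p) \<le> card (T (Suc p)) + c p"
    and mono: "\<And>p. r \<le> p \<Longrightarrow> p < q \<Longrightarrow> c p \<le> c (Suc p)"
    and c: "\<And>p. r \<le> p \<Longrightarrow> p \<le> q \<Longrightarrow> p + 2 \<le> c p + r"
  shows "c q + r \<le> Suc (limit m r)"
proof -
  have m1: "1 \<le> m" using m by simp
  have V: "finite {1..m}" by simp
  have inv: "\<exists>w. lex_least (T p) w \<and> weight m (raise m (c p + r - p - 2) w) m \<le> limit m r"
    if "r \<le> p" "p \<le> q" for p
    using that
  proof (induction p rule: dec_induct)
    case base
    obtain L where L: "lexseg {1..m} r L" "card L = 2" "lex_least L (start r)" using start_seg[OF m r] by blast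
    have cr: "2 \<le> c r" using c[OF order_refl rq] by simp
    then have "T r \<noteq> {}" using assms(5) by auto
    then obtain w where w: "lex_least (T r) w" using lex_least_exists lexseg_finite[OF V T[OF order_refl rq]] by blast
    \<comment> \<open>Beyond the segment of size 2, the other \<open>c r - 2\<close> elements become
      credit.\<close>
    have "weight m (raise m (0 + (c r - 2)) w) m \<le> weight m (raise m 0 (start r)) m"
      by (rule weight_lexseg[OF m1 T[OF order_refl rq] L(1) w L(3)]) (use L(2) assms(5) cr in simp)
    then show ?case using w weight_start[OF m r] by auto
  next
    case (step p)
    then have pq: "p < q" by simp
    obtain w where w: "lex_least (T p) w" "weight m (raise m (c p + r - p - 2) w) m \<le> limit m r"
      using step by auto
    define t where "t = c p + r - p - 2"
    have seg: "lexseg {1..m} (Suc p) (T (Suc p))" "lexseg {1..m} p (T p)" using T[of "Suc p"] T[of p] step by auto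
    have sh: "lexseg {1..m} (Suc p) (shadow {1..m} (T p))" by (rule lexseg_shadow[OF V seg(2)])
    have least: "lex_least (shadow {1..m} (T p)) (mult m w)" by (rule lex_least_shadow[OF m1 w(1)])
    have le: "card (shadow {1..m} (T p)) + (c (Suc p) - c p) \<le> card (T (Suc p))"
      using assms(6)[of p] mono[of p] step pq by simp
    have fin: "finite (shadow {1..m} (T p))" "finite (T (Suc p))" using lexseg_finite[OF V] sh seg by auto
    have "0 < card (shadow {1..m} (T p))" using least fin by (auto simp: lex_least_def card_gt_0_iff)
    then have "T (Suc p) \<noteq> {}" using le by auto
    then obtain w2 where w2: "lex_least (T (Suc p)) w2" using lex_least_exists fin by blast
    have wm: "w \<in> mon {1..m} p" using w(1) lexseg_mon[OF seg(2)] by (auto simp: lex_least_def)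
    show ?case
    proof (cases "c (Suc p) = c p")
      case True
      \<comment> \<open>Without a new generator the credit drops by one; the released factor is the
        one by which the shadow multiplies its least element.\<close>
      then have "1 \<le> t" using c[of "Suc p"] step by (simp add: t_def)
      then obtain t' where t': "t = Suc t'" by (cases t) auto
      have "weight m (raise m (t' + 0) w2) m \<le> weight m (raise m t' (mult m w)) m"
        by (rule weight_lexseg[OF m1 seg(1) sh w2 least]) (use le True in simp)
      also have "raise m t' (mult m w) = raise m t w" by (simp add: t' raise_Suc')
      also have "weight m (raise m t w) m \<le> limit m r" using w(2) by (simp add: t_def)
      finally have "weight m (raise m t' w2) m \<le> limit m r" by simp
      moreover have "c (Suc p) + r - Suc p - 2 = t'" using True t' by (simp add: t_def)
      ultimately show ?thesis using w2 by auto
    next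
      case False
      then obtain n where n: "c (Suc p) = c p + Suc n" using mono[of p] step pq
        by (metis add_Suc_right le_Suc_ex add_0_right not0_implies_Suc)
      \<comment> \<open>One new element pays for the strict descent below \<open>mult m w\<close>;
        the remaining \<open>n\<close> go to the credit.\<close>
      have "Suc (card (shadow {1..m} (T p))) \<le> card (mon {1..m} (Suc p))"
        using le n card_mono[OF finite_mon[OF V] lexseg_mon[OF seg(1)]] by simp
      then obtain L where L: "lexseg {1..m} (Suc p) L" "card L = Suc (card (shadow {1..m} (T p)))"
        using lexseg_exists[OF V] by blast
      have finL: "finite L" using lexseg_finite[OF V L(1)] .
      have "L \<noteq> {}" using L(2) by auto
      then obtain w3 where w3: "lex_least L w3" using lex_least_exists finL by blast
      have sub: "shadow {1..m} (T p) \<subseteq> L" by (rule lexseg_subset[OF V sh L(1)]) (simp add: L(2))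
      have "lex_less w3 (mult m w)"
      proof (rule ccontr)
        assume "\<not> lex_less w3 (mult m w)"
        then have eq: "w3 = mult m w" using lex_least_subset[OF w3 least sub] by auto
        have "L \<subseteq> shadow {1..m} (T p)"
        proof
          fix v assume v: "v \<in> L"
          then have "v = w3 \<or> lex_less w3 v" "v \<in> mon {1..m} (Suc p)"
            using w3 lexseg_mon[OF L(1)] by (auto simp: lex_least_def)
          then show "v \<in> shadow {1..m} (T p)"
            using lexsegD[OF sh, of "mult m w" v] least unfolding eq lex_least_def by auto
        qed
        then have "card L \<le> card (shadow {1..m} (T p))" using card_mono[OF fin(1)] by blast
        then show False using L(2) by simp
      qed
      moreover have "w3 \<in> mon {1..m} (Suc p)" using w3 lexseg_mon[OF L(1)] by (auto simp: lex_least_def)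
      ultimately have 1: "weight m (raise m t w3) m \<le> weight m (raise m t w) m"
        using weight_raise_descent[OF m1 _ wm] by blast
      have "weight m (raise m (t + n) w2) m \<le> weight m (raise m t w3) m"
        by (rule weight_lexseg[OF m1 seg(1) L(1) w2 w3]) (use le n L(2) in simp)
      then have "weight m (raise m (t + n) w2) m \<le> limit m r" using 1 w(2) by (simp add: t_def)
      moreover have "c (Suc p) + r - Suc p - 2 = t + n" using n c[of p] step by (simp add: t_def)
      ultimately show ?thesis using w2 by auto
    qed
  qed
  obtain w where w: "lex_least (T q) w" "weight m (raise m (c q + r - q - 2) w) m \<le> limit m r"
    using inv[OF rq order_refl] by blast
  have "w \<in> mon {1..m} q" using w(1) lexseg_mon[OF T[OF rq order_refl]] by (auto simp: lex_least_def)
  \<comment> \<open>The raised monomial has degree \<open>c q + r - 2\<close>, and the weight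
    exceeds the degree.\<close>
  then have "raise m (c q + r - q - 2) w \<in> mon {1..m} (q + (c q + r - q - 2))" by (rule raise_in_mon[OF m1])
  then have "q + (c q + r - q - 2) < limit m r"
    using weight_gt_deg[of m "raise m (c q + r - q - 2) w"] w(2) by (simp add: mon_tuples)
  then show ?thesis using c[OF rq order_refl] by simp
qed

section \<open>Upper bounds\<close>

definition count :: "nat \<Rightarrow> (nat \<Rightarrow> nat) set \<Rightarrow> nat \<Rightarrow> nat" where
  "count m N p = card {\<beta> \<in> N. deg m \<beta> \<le> p}"

lemma count_Suc: "finite N \<Longrightarrow> count m N (Suc p) = count m N p + card {\<beta> \<in> N. deg m \<beta> = Suc p}"
proof -
  assume N: "finite N"
  have "{\<beta> \<in> N. deg m \<beta> \<le> Suc p} = {\<beta> \<in> N. deg m \<beta> \<le> p} \<union> {\<beta> \<in> N. deg m \<beta> = Suc p}" by auto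
  then show ?thesis unfolding count_def using N by (simp add: card_Un_disjoint disjoint_iff)
qed

lemma count_le_card_upset:
  assumes m: "1 \<le> m" and \<alpha>: "antichain_seq m \<alpha>"
  shows "count m (set \<alpha>) p \<le> card (upset m (set \<alpha>) p)"
proof (induction p)
  case 0
  have "{\<beta> \<in> set \<alpha>. deg m \<beta> \<le> 0} \<subseteq> upset m (set \<alpha>) 0"
    using \<alpha> by (auto simp: upset_def mon_tuples antichain_seq_def)
  then show ?case unfolding count_def by (rule card_mono[OF finite_upset])
next
  case (Suc p)
  have "card (upset m (set \<alpha>) p) \<le> card (shadow {1..m} (upset m (set \<alpha>) p))"
    by (rule card_le_card_shadow[OF _ upset_subset]) (use m in auto)
  then show ?case
    using Suc card_upset_Suc[OF _ antichain_seqD[OF \<alpha>]] \<alpha> by (simp add: count_Suc antichain_seq_def)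
qed

lemma seg_upset:
  "lexseg {1..m} p (seg {1..m} p (card (upset m N p)))"
  "card (seg {1..m} p (card (upset m N p))) = card (upset m N p)"
proof -
  have "card (upset m N p) \<le> card (mon {1..m} p)"
    by (rule card_mono[OF finite_mon upset_subset]) simp
  then show "lexseg {1..m} p (seg {1..m} p (card (upset m N p)))"
    "card (seg {1..m} p (card (upset m N p))) = card (upset m N p)"
    using lexseg_seg card_seg by auto
qed

lemma limit_ge: "r \<le> limit m r"
  using funpow_ge[of 0 r "m - 1"] by (simp add: limit_def)

text \<open>If the condition failed in all degrees from \<open>r\<close> to
  \<open>limit m r\<close>, each failure would act as one generator in
  \<open>accounting\<close>.\<close>

lemma D_cond_exists:
  assumes m: "2 \<le> m" and r: "1 \<le> r" and \<alpha>: "antichain_seq m \<alpha>"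
  shows "\<exists>p. r \<le> p \<and> p \<le> limit m r \<and> D_cond m \<alpha> p"
proof (rule ccontr)
  assume "\<not> ?thesis"
  then have no: "\<not> D_cond m \<alpha> p" if "r \<le> p" "p \<le> limit m r" for p using that by blast
  define T where "T = (\<lambda>p. seg {1..m} p (card (upset m (set \<alpha>) p)))"
  have T: "lexseg {1..m} p (T p)" "card (T p) = card (upset m (set \<alpha>) p)" for p
    using seg_upset unfolding T_def by auto
  have "lubs (Gamma_in m \<alpha> r) \<noteq> {}" using no[OF order_refl limit_ge] by (auto simp: D_cond_def)
  then obtain x y where xy: "x \<in> Gamma_in m \<alpha> r" "y \<in> Gamma_in m \<alpha> r" "x \<noteq> y" by (auto simp: lubs_def)
  have "card {x, y} \<le> count m (set \<alpha>) r" unfolding count_def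
    using xy by (intro card_mono) (auto simp: Gamma_in_def)
  then have two: "2 \<le> card (upset m (set \<alpha>) r)"
    using xy(3) count_le_card_upset[OF _ \<alpha>, of r] m by simp
  \<comment> \<open>The function \<open>p + 2 - r\<close> counts two fictitious generators in degree
    \<open>r\<close> and one in each later failing degree.\<close>
  have "limit m r + 2 - r + r \<le> Suc (limit m r)"
  proof (rule accounting[OF m r limit_ge, where T = T and c = "\<lambda>p. p + 2 - r"])
    show "lexseg {1..m} p (T p)" for p by (rule T)
    show "r + 2 - r \<le> card (T r)" using two T(2) by simp
    show "card (shadow {1..m} (T p)) + (Suc p + 2 - r) \<le> card (T (Suc p)) + (p + 2 - r)"
      if "r \<le> p" "p < limit m r" for p
      using card_upset_growth[OF \<alpha> no T(1) T(2), of p] that T(2)[of "Suc p"] by simp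
  qed auto
  then show False using limit_ge[of r m] by simp
qed

lemma D_num_le:
  assumes "2 \<le> m" "1 \<le> r" "antichain_seq m \<alpha>" shows "D_num m r \<alpha> \<le> limit m r"
proof -
  obtain p where p: "r \<le> p \<and> D_cond m \<alpha> p" "p \<le> limit m r" using D_cond_exists[OF assms] by blast
  have "D_num m r \<alpha> \<le> p" unfolding D_num_def by (rule Least_le) (rule p(1))
  then show ?thesis using p(2) by simp
qed

lemma antichain_seq_distinct: "antichain_seq m \<alpha> \<Longrightarrow> distinct \<alpha>"
  unfolding antichain_seq_def distinct_conv_nth by (metis order_refl)

lemma antichain_length_le:
  assumes m: "2 \<le> m" and r: "1 \<le> r" and \<alpha>: "antichain_seq m \<alpha>"
    and g: "\<And>i. i \<in> {1..length \<alpha>} \<Longrightarrow> deg m (\<alpha> ! (i - 1)) \<le> g_bound r i" and n: "2 \<le> length \<alpha>"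
  shows "length \<alpha> + r \<le> Suc (limit m r)"
proof -
  \<comment> \<open>The degree that \<open>g_bound\<close> allows for the last element; the first
    \<open>p + 2 - r\<close> elements have degree at most \<open>p\<close>.\<close>
  define q where "q = length \<alpha> + r - 2"
  have rq: "r \<le> q" using n by (simp add: q_def)
  define T where "T = (\<lambda>p. seg {1..m} p (card (upset m (set \<alpha>) p)))"
  have T: "lexseg {1..m} p (T p)" "card (T p) = card (upset m (set \<alpha>) p)" for p
    using seg_upset unfolding T_def by auto
  have dist: "distinct \<alpha>" by (rule antichain_seq_distinct[OF \<alpha>])
  have low: "p + 2 \<le> count m (set \<alpha>) p + r" if p: "r \<le> p" "p \<le> q" for p
  proof -
    have l: "p + 2 - r \<le> length \<alpha>" using p n by (simp add: q_def)
    have "set (take (p + 2 - r) \<alpha>) \<subseteq> {\<beta> \<in> set \<alpha>. deg m \<beta> \<le> p}"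
    proof
      fix \<beta> assume "\<beta> \<in> set (take (p + 2 - r) \<alpha>)"
      then obtain i where i: "i < p + 2 - r" "i < length \<alpha>" "\<beta> = \<alpha> ! i"
        by (auto simp: in_set_conv_nth)
      have "deg m \<beta> \<le> g_bound r (Suc i)" using g[of "Suc i"] i by simp
      also have "\<dots> \<le> p" using i p r by (auto simp: g_bound_def)
      finally show "\<beta> \<in> {\<beta> \<in> set \<alpha>. deg m \<beta> \<le> p}" using i by simp
    qed
    then have "card (set (take (p + 2 - r) \<alpha>)) \<le> count m (set \<alpha>) p"
      unfolding count_def by (intro card_mono) auto
    then show ?thesis using distinct_card[OF distinct_take[OF dist]] l by simp
  qed
  have "count m (set \<alpha>) q + r \<le> Suc (limit m r)"
  proof (rule accounting[OF m r rq, where T = T and c = "count m (set \<alpha>)"])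
    show "lexseg {1..m} p (T p)" for p by (rule T)
    show "count m (set \<alpha>) r \<le> card (T r)" using count_le_card_upset[OF _ \<alpha>] m T(2) by simp
    show "count m (set \<alpha>) p \<le> count m (set \<alpha>) (Suc p)" for p by (simp add: count_Suc)
    show "p + 2 \<le> count m (set \<alpha>) p + r" if "r \<le> p" "p \<le> q" for p by (rule low[OF that])
    show "card (shadow {1..m} (T p)) + count m (set \<alpha>) (Suc p) \<le> card (T (Suc p)) + count m (set \<alpha>) p" for p
    proof -
      have "card (shadow {1..m} (T p)) \<le> card (shadow {1..m} (upset m (set \<alpha>) p))"
        using macaulayD[OF macaulay upset_subset T(1)] T(2) by simp
      then show ?thesis
        using card_upset_Suc[OF _ antichain_seqD[OF \<alpha>]] \<alpha> T(2)[of "Suc p"] by (simp add: count_Suc antichain_seq_def)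
    qed
  qed
  moreover have "length \<alpha> \<le> count m (set \<alpha>) q" using low[OF rq order_refl] n by (simp add: q_def)
  ultimately show ?thesis by simp
qed

section \<open>The extremal antichain\<close>

text \<open>The last variable before \<open>m\<close> that occurs in \<open>w\<close>; unspecified
  if there is none.\<close>

definition pivot :: "nat \<Rightarrow> (nat \<Rightarrow> nat) \<Rightarrow> nat" where
  "pivot m w = Max {j \<in> {1..<m}. 0 < w j}"

text \<open>The lexicographic predecessor of \<open>mult m w\<close> in its degree: one factor
  leaves the pivot and, together with the \<open>w m + 1\<close> factors of variable
  \<open>m\<close>, is collected in the variable after the pivot.\<close>

definition next_gen :: "nat \<Rightarrow> (nat \<Rightarrow> nat) \<Rightarrow> nat \<Rightarrow> nat" where
  "next_gen m w = (\<lambda>l. if l < pivot m w then w l else if l = pivot m w then w l - 1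
     else if l = Suc (pivot m w) then w m + 2 else 0)"

lemma pivot:
  assumes "\<exists>j\<in>{1..<m}. 0 < w j"
  shows "1 \<le> pivot m w" "pivot m w < m" "0 < w (pivot m w)"
    and "pivot m w < l \<Longrightarrow> l < m \<Longrightarrow> w l = 0"
proof -
  have fin: "finite {j \<in> {1..<m}. 0 < w j}" by simp
  have "pivot m w \<in> {j \<in> {1..<m}. 0 < w j}" unfolding pivot_def using assms by (intro Max_in) auto
  then show p: "1 \<le> pivot m w" "pivot m w < m" "0 < w (pivot m w)" by auto
  show "w l = 0" if l: "pivot m w < l" "l < m"
  proof (rule ccontr)
    assume "w l \<noteq> 0"
    then have "l \<le> pivot m w" unfolding pivot_def using l p by (intro Max_ge) auto
    then show False using l by simp
  qed
qed

lemma sum_last: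
  fixes f :: "nat \<Rightarrow> nat"
  assumes "1 \<le> p" shows "sum f {1..p} = f p + sum f {1..<p}"
proof -
  have "{1..p} = insert p {1..<p}" using assms by auto
  then show ?thesis by simp
qed

lemma weight_const:
  assumes "\<And>k. a \<le> k \<Longrightarrow> k < b \<Longrightarrow> w (m - k) = 0" "a \<le> b" shows "weight m w b = weight m w a"
  using assms(2,1) by (induction b rule: dec_induct) auto

lemma funpow_ackermann_0: "(ackermann 0 ^^ n) y = y + n"
  by (induction n) auto

lemma weight_1: "weight m w 1 = Suc (w m)"
  by (simp add: One_nat_def funpow_ackermann_0)

text \<open>As the weight stays equal to \<open>limit m r\<close> along \<open>gen\<close>, a power
  of the last variable can occur there only in degree \<open>limit m r - 1\<close>; until then a
  pivot exists.\<close>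

lemma weight_pure:
  assumes m: "1 \<le> m" and w: "w \<in> mon {1..m} d" and z: "\<And>j. j \<in> {1..<m} \<Longrightarrow> w j = 0"
  shows "weight m w m = Suc d"
proof -
  have "weight m w m = weight m w 1" using m z by (intro weight_const) auto
  moreover have "sum w {1..m} = w m" using m z by (simp add: sum.remove[of "{1..m}" m])
  ultimately show ?thesis using w by (simp add: weight_1 mon_def)
qed

context
  fixes m :: nat and w :: "nat \<Rightarrow> nat" and d :: nat
  assumes w: "w \<in> mon {1..m} d" and ex: "\<exists>j\<in>{1..<m}. 0 < w j"
begin

lemma next_gen_split:
  "deg m u = sum u {1..pivot m w} + sum u {Suc (pivot m w)..m}"
proof -
  have "{1..m} = {1..pivot m w} \<union> {Suc (pivot m w)..m}" using pivot[OF ex] by auto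
  then show ?thesis unfolding deg_def by (simp add: sum.union_disjoint)
qed

lemma next_gen_in_mon: "next_gen m w \<in> mon {1..m} (Suc d)"
proof -
  let ?p = "pivot m w"
  note p = pivot[OF ex]
  have "sum w {1..?p} = w ?p + sum w {1..<?p}" by (rule sum_last[OF p(1)])
  moreover have "sum (next_gen m w) {1..?p} = w ?p - 1 + sum w {1..<?p}"
  proof -
    have "sum (next_gen m w) {1..?p} = next_gen m w ?p + sum (next_gen m w) {1..<?p}"
      by (rule sum_last[OF p(1)])
    moreover have "sum (next_gen m w) {1..<?p} = sum w {1..<?p}"
      by (rule sum.cong) (auto simp: next_gen_def)
    ultimately show ?thesis by (simp add: next_gen_def)
  qed
  moreover have "sum w {Suc ?p..m} = w m"
    using p by (simp add: sum.remove[of "{Suc ?p..m}" m])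
  moreover have "sum (next_gen m w) {Suc ?p..m} = w m + 2"
    using p by (simp add: sum.remove[of "{Suc ?p..m}" "Suc ?p"] next_gen_def)
  ultimately have "deg m (next_gen m w) = Suc (deg m w)"
    using p next_gen_split[of w] next_gen_split[of "next_gen m w"] by simp
  moreover have "next_gen m w \<in> tuples m"
    using p w by (auto simp: next_gen_def mon_tuples tuples_def)
  ultimately show ?thesis using w by (simp add: mon_tuples)
qed

lemma next_gen_less: "lex_less (next_gen m w) (mult m w)"
  using pivot[OF ex] by (intro lex_lessI[of _ "pivot m w"]) (auto simp: next_gen_def mult_apply)

text \<open>With \<open>n = m - Suc ?p\<close>, removing a factor at the pivot loses one application
  of \<open>ackermann (Suc n)\<close> to \<open>Suc (w m)\<close>. The \<open>w m + 2\<close>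
  applications of \<open>ackermann n\<close> to 1 give exactly this value back.\<close>

lemma weight_next_gen: "weight m (next_gen m w) m = weight m w m"
proof -
  let ?p = "pivot m w"
  let ?v = "next_gen m w"
  note p = pivot[OF ex]
  define n where "n = m - Suc ?p"
  have n: "m - Suc n = ?p" "m - n = Suc ?p" "n < m" "Suc n < m" using p by (auto simp: n_def)
  have "weight m w (Suc n) = weight m w 1" using p n by (intro weight_const) auto
  then have w1: "weight m w (Suc n) = Suc (w m)" by (simp add: weight_1)
  have "weight m ?v n = weight m ?v 0" using p n by (intro weight_const) (auto simp: next_gen_def)
  then have v1: "weight m ?v (Suc n) = ackermann (Suc n) (Suc (w m))"
    using n by (simp add: next_gen_def ackermann_funpow del: ackermann.simps)
  obtain b where b: "w ?p = Suc b" using p(3) by (cases "w ?p") auto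
  have eq: "weight m ?v (Suc (Suc n)) = weight m w (Suc (Suc n))"
    unfolding weight.simps(2)[of m _ "Suc n"] w1 v1 n(1) using b by (simp add: next_gen_def funpow_swap1)
  have same: "?v (m - k) = w (m - k)" if "Suc (Suc n) \<le> k" "k < m" for k
    using that n by (auto simp: next_gen_def)
  show ?thesis
    using weight_mono_prefix[of m ?v "Suc (Suc n)" w m] weight_mono_prefix[of m w "Suc (Suc n)" ?v m] eq same n
    by (intro antisym) auto
qed

end

text \<open>The least multiple of \<open>u\<close> in a given degree arises by multiplication with
  variable \<open>m\<close> alone.\<close>

lemma raise_le_lex:
  assumes m: "1 \<le> m" and u: "u \<in> mon {1..m} d" and v: "v \<in> mon {1..m} (d + t)" and le: "u \<le> v"
  shows "v = raise m t u \<or> lex_less (raise m t u) v"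
proof (cases "\<exists>j<m. u j < v j")
  case True
  then obtain j where "j < m" "u j < v j" by blast
  then have "lex_less (raise m t u) v" using le
    by (intro lex_lessI[of _ j]) (auto simp: raise_def le_fun_def)
  then show ?thesis ..
next
  case False
  then have eq: "v j = u j" if "j < m" for j using le that by (metis le_fun_def not_less antisym)
  have "sum v {1..<m} = sum u {1..<m}" using eq by (intro sum.cong) auto
  then have "v m = u m + t" using u v sum_last[OF m, of u] sum_last[OF m, of v] by (simp add: mon_def)
  then have "v j = raise m t u j" for j
    using eq[of j] mon_zero[OF u, of j] mon_zero[OF v, of j] by (cases j m rule: linorder_cases) (auto simp: raise_def)
  then show ?thesis by blast
qed

text \<open>The upset of the generators up to \<open>w\<close> contains in the next degree all monomials above \<open>next_gen m w\<close>.\<close>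

lemma above_next_gen:
  assumes m: "1 \<le> m" and w: "w \<in> mon {1..m} d" and ex: "\<exists>j\<in>{1..<m}. 0 < w j"
    and u: "u \<in> mon {1..m} (Suc d)" and lt: "lex_less (next_gen m w) u"
  shows "\<exists>u'\<in>mon {1..m} d. (u' = w \<or> lex_less w u') \<and> u' \<le> u"
proof -
  let ?p = "pivot m w"
  let ?v = "next_gen m w"
  note p = pivot[OF ex]
  have V: "finite {1..m}" by simp
  define k where "k = last_var u"
  have k: "0 < u k" "\<And>l. k < l \<Longrightarrow> u l = 0" "\<And>l. 0 < u l \<Longrightarrow> l \<le> k"
    using last_var[OF V u] last_var_ge[OF V u] by (auto simp: k_def)
  define u' where "u' = dec k u"
  have u'm: "u' \<in> mon {1..m} d" unfolding u'_def by (rule dec_in_mon[OF V u k(1)])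
  obtain i where i: "?v i < u i" "\<And>l. l < i \<Longrightarrow> ?v l = u l" using lt by (auto simp: lex_less_def)
  \<comment> \<open>After the pivot \<open>?v\<close> is concentrated in one variable; a first
    difference there would put it pointwise below \<open>u\<close> in the same degree.\<close>
  have ip: "i \<le> ?p"
  proof (rule ccontr)
    assume ni: "\<not> i \<le> ?p"
    have le: "?v l \<le> u l" for l
    proof (cases l i rule: linorder_cases)
      case greater
      then have "?v l = 0" using ni by (auto simp: next_gen_def)
      then show ?thesis by simp
    qed (use i in auto)
    have "i \<in> {1..m}" using i(1) mon_zero[OF u, of i] by force
    then have "sum ?v {1..m} < sum u {1..m}" using le i(1) by (intro sum_strict_mono_ex1) auto
    then show False using u next_gen_in_mon[OF w ex] by (simp add: mon_def)
  qed
  have ik: "i \<le> k" using k(3) i(1) by simp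
  have pre: "w l = u l" if "l < i" for l using i(2)[OF that] that ip by (simp add: next_gen_def)
  have "u' = w \<or> lex_less w u'"
  proof (cases "w i < u i")
    case True
    show ?thesis
    proof (cases "i = k")
      case True': True
      show ?thesis
      proof (rule lex_le_of_prefix[OF V u'm w, of k])
        show "w l \<le> u' l" if "l \<le> k" for l
          using that True True' pre[of l] by (cases "l = k") (auto simp: u'_def dec_apply)
        show "u' l = 0" if "k < l" for l using that k by (simp add: u'_def dec_apply)
      qed
    next
      case False
      then have "lex_less w u'" using True ik pre
        by (intro lex_lessI[of _ i]) (auto simp: u'_def dec_apply)
      then show ?thesis ..
    qed
  next
    case False
    have "i = ?p"
    proof (rule ccontr)
      assume "i \<noteq> ?p"
      then have "?v i = w i" using ip by (simp add: next_gen_def)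
      then show False using i(1) False by simp
    qed
    have ui: "u i = w i" using False i(1) p by (simp add: next_gen_def \<open>i = ?p\<close>)
    have upre: "w l = u l" if "l \<le> ?p" for l
      using that pre[of l] ui \<open>i = ?p\<close> by (cases "l = ?p") auto
    have "i < k"
    proof (rule ccontr)
      assume "\<not> i < k"
      then have "u l \<le> w l" for l using upre[of l] k(2)[of l] \<open>i = ?p\<close> by (cases "l \<le> ?p") auto
      then have "sum u {1..m} \<le> sum w {1..m}" by (intro sum_mono)
      then show False using u w by (simp add: mon_def)
    qed
    \<comment> \<open>Stripped of its power of variable \<open>m\<close>, \<open>w\<close> divides
      \<open>u'\<close>, so \<open>raise_le_lex\<close> compares \<open>u'\<close> with
      \<open>w\<close>.\<close>
    define w0 where "w0 = w(m := 0)"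
    have w0: "raise m (w m) w0 = w" by (auto simp: raise_def w0_def)
    have "sum w {1..m} = w m + sum w ({1..m} - {m})" using m by (intro sum.remove) auto
    moreover have "sum w0 {1..m} = w0 m + sum w0 ({1..m} - {m})" using m by (intro sum.remove) auto
    moreover have "sum w0 ({1..m} - {m}) = sum w ({1..m} - {m})" by (rule sum.cong) (auto simp: w0_def)
    ultimately have "w0 \<in> mon {1..m} (d - w m)" "w m \<le> d" using w by (auto simp: mon_def w0_def)
    moreover have "w0 \<le> u'"
      unfolding le_fun_def
    proof
      fix l
      show "w0 l \<le> u' l"
      proof (cases "l \<le> ?p")
        case True
        then show ?thesis using upre[OF True] \<open>i < k\<close> \<open>i = ?p\<close> by (auto simp: w0_def u'_def dec_apply)
      next
        case False
        then have "w0 l = 0" using p(4)[of l] mon_zero[OF w, of l]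
          by (cases l m rule: linorder_cases) (auto simp: w0_def)
        then show ?thesis by simp
      qed
    qed
    ultimately show ?thesis using raise_le_lex[OF m, of w0 "d - w m" u' "w m"] u'm by (simp add: w0)
  qed
  then show ?thesis using u'm dec_le[of k u] by (auto simp: u'_def)
qed

section \<open>The sequence of generators\<close>

definition pure :: "nat \<Rightarrow> nat \<Rightarrow> nat" where
  "pure r = single 1 r"

definition gen :: "nat \<Rightarrow> nat \<Rightarrow> nat \<Rightarrow> nat \<Rightarrow> nat" where
  "gen m r k = (next_gen m ^^ k) (start r)"

text \<open>The degrees are \<open>r\<close>, then \<open>r\<close>, \<open>r + 1\<close> and so on
  up to \<open>limit m r - 1\<close>, which are the values of \<open>g_bound r\<close>.\<close>

definition extremal :: "nat \<Rightarrow> nat \<Rightarrow> (nat \<Rightarrow> nat) list" where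
  "extremal m r = pure r # map (gen m r) [0..<limit m r - r]"

lemma gen_0 [simp]: "gen m r 0 = start r"
  by (simp add: gen_def)

lemma gen_Suc: "gen m r (Suc k) = next_gen m (gen m r k)"
  by (simp add: gen_def)

context
  fixes m r :: nat
  assumes m: "2 \<le> m" and r: "1 \<le> r"
begin

lemma gen_weight:
  "r + k < limit m r \<Longrightarrow> gen m r k \<in> mon {1..m} (r + k) \<and> weight m (gen m r k) m = limit m r"
proof (induction k)
  case 0
  then show ?case using start_in_mon[OF m r] weight_start[OF m r] by simp
next
  case (Suc k)
  then have IH: "gen m r k \<in> mon {1..m} (r + k)" "weight m (gen m r k) m = limit m r" by auto
  have "\<exists>j\<in>{1..<m}. 0 < gen m r k j"
  proof (rule ccontr)
    assume "\<not> ?thesis"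
    then have "weight m (gen m r k) m = Suc (r + k)" using weight_pure[OF _ IH(1)] m by auto
    then show False using IH(2) Suc.prems by simp
  qed
  then show ?case using next_gen_in_mon[OF IH(1)] weight_next_gen[OF IH(1)] IH(2) by (simp add: gen_Suc)
qed

lemmas gen_in_mon = gen_weight[THEN conjunct1]

lemma gen_deg: "r + k < limit m r \<Longrightarrow> deg m (gen m r k) = r + k"
  using gen_in_mon by (simp add: mon_tuples)

lemma gen_pivot:
  assumes "Suc (r + k) < limit m r" shows "\<exists>j\<in>{1..<m}. 0 < gen m r k j"
proof (rule ccontr)
  assume "\<not> ?thesis"
  then have "weight m (gen m r k) m = Suc (r + k)" using weight_pure[OF _ gen_in_mon] m assms by auto
  then show False using gen_weight[of k] assms by simp
qed

text \<open>The generators so far generate the whole segment ending at the newest one;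
  \<open>above_next_gen\<close> supplies a divisor one degree lower.\<close>

lemma gen_above:
  "r + k < limit m r \<Longrightarrow> u \<in> mon {1..m} (r + k) \<Longrightarrow> u = gen m r k \<or> lex_less (gen m r k) u \<Longrightarrow>
    \<exists>\<beta>\<in>insert (pure r) (gen m r ` {..k}). \<beta> \<le> u"
proof (induction k arbitrary: u)
  case 0
  then have "u = start r \<or> u = pure r" using start_less_imp[OF m r, of u] by (auto simp: pure_def)
  then show ?case by auto
next
  case (Suc k)
  show ?case
  proof (cases "u = gen m r (Suc k)")
    case True
    then show ?thesis by auto
  next
    case False
    then have "lex_less (next_gen m (gen m r k)) u" using Suc.prems(3) by (simp add: gen_Suc)
    moreover have "gen m r k \<in> mon {1..m} (r + k)" "\<exists>j\<in>{1..<m}. 0 < gen m r k j"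
      using gen_in_mon gen_pivot Suc.prems(1) by auto
    ultimately obtain u' where u': "u' \<in> mon {1..m} (r + k)" "u' = gen m r k \<or> lex_less (gen m r k) u'" "u' \<le> u"
      using above_next_gen[of m "gen m r k" "r + k" u] m Suc.prems(2) by auto
    have "r + k < limit m r" using Suc.prems(1) by simp
    then obtain \<beta> where b: "\<beta> \<in> insert (pure r) (gen m r ` {..k})" "\<beta> \<le> u'"
      using Suc.IH[OF _ u'(1,2)] by blast
    have "\<beta> \<in> insert (pure r) (gen m r ` {..Suc k})" using b(1) by (auto simp: atMost_Suc)
    then show ?thesis using order_trans[OF b(2) u'(3)] by blast
  qed
qed

text \<open>By \<open>raise_le_lex\<close> this keeps a generator from dividing a later one.\<close>

lemma gen_less:
  "k < k' \<Longrightarrow> r + k' < limit m r \<Longrightarrow> lex_less (gen m r k') (raise m (k' - k) (gen m r k))"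
proof (induction k')
  case (Suc k')
  have lt: "lex_less (gen m r (Suc k')) (mult m (gen m r k'))"
    unfolding gen_Suc using Suc.prems(2) by (intro next_gen_less[OF gen_in_mon gen_pivot]) auto
  show ?case
  proof (cases "k = k'")
    case True
    then show ?thesis using lt raise_Suc[of m 0 "gen m r k"] by (simp add: Suc_diff_le One_nat_def)
  next
    case False
    then have "lex_less (gen m r k') (raise m (k' - k) (gen m r k))" using Suc by simp
    then have "lex_less (mult m (gen m r k')) (raise m (Suc (k' - k)) (gen m r k))"
      unfolding raise_Suc by (rule lex_less_mult)
    then show ?thesis using lex_less_trans[OF lt] False Suc.prems(1) by (simp add: Suc_diff_le)
  qed
qed simp

lemma pure_deg: "deg m (pure r) = r" and pure_tuples: "pure r \<in> tuples m"
  using pure_in_mon[of m r] m by (auto simp: pure_def mon_tuples)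

lemma gen_incomparable:
  assumes "k < k'" "r + k' < limit m r" shows "\<not> gen m r k \<le> gen m r k'" "\<not> gen m r k' \<le> gen m r k"
proof -
  have 1: "gen m r k \<in> mon {1..m} (r + k)" and 2: "gen m r k' \<in> mon {1..m} (r + k + (k' - k))"
    using gen_in_mon assms by auto
  show "\<not> gen m r k \<le> gen m r k'"
    using raise_le_lex[OF _ 1 2] gen_less[OF assms] m lex_less_asym by auto
  show "\<not> gen m r k' \<le> gen m r k"
    using deg_mono[of "gen m r k'" "gen m r k" m] gen_deg assms by auto
qed

lemma pure_incomparable:
  assumes k: "r + k < limit m r" shows "\<not> pure r \<le> gen m r k" "\<not> gen m r k \<le> pure r"
proof -
  have 0: "gen m r k 0 = 0" using mon_zero[OF gen_in_mon[OF k], of 0] by simp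
  \<comment> \<open>\<open>gen_less\<close> bounds the exponent of variable 1 by the one in
    \<open>start r\<close>, so \<open>pure r\<close> divides no generator.\<close>
  have "gen m r k 1 \<le> r - 1"
  proof (cases "k = 0")
    case False
    then have "lex_less (gen m r k) (raise m k (start r))" using gen_less[of 0 k] k by simp
    then obtain i where i: "gen m r k i < raise m k (start r) i" "\<And>j. j < i \<Longrightarrow> gen m r k j = raise m k (start r) j"
      by (auto simp: lex_less_def)
    have "raise m k (start r) 0 = 0" "raise m k (start r) 1 = r - 1" using m by (auto simp: raise_def start_def)
    then show ?thesis using i(1) i(2)[of 1] by (cases "i = 0"; cases "i = 1") auto
  qed (simp add: start_def)
  then show "\<not> pure r \<le> gen m r k" using r by (auto simp: pure_def le_fun_def intro!: exI[of _ 1])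
  show "\<not> gen m r k \<le> pure r"
  proof (cases "k = 0")
    case True
    then show ?thesis by (auto simp: pure_def start_def le_fun_def intro!: exI[of _ 2])
  next
    case False
    then show ?thesis using deg_mono[of "gen m r k" "pure r" m] gen_deg[OF k] pure_deg by auto
  qed
qed

lemma limit_gt: "r < limit m r"
  using weight_gt_deg[of m "start r"] weight_start[OF m r] start_in_mon[OF m r] by (simp add: mon_tuples)

lemma set_extremal: "set (extremal m r) = insert (pure r) (gen m r ` {..<limit m r - r})"
  by (auto simp: extremal_def)

lemma extremal_antichain: "antichain_seq m (extremal m r)"
  unfolding antichain_seq_def
proof (intro conjI allI impI)
  show "set (extremal m r) \<subseteq> tuples m"
    using gen_in_mon pure_tuples unfolding set_extremal by (auto simp: mon_tuples less_diff_conv add.commute)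
  fix i j assume ij: "i < length (extremal m r)" "j < length (extremal m r)" "i \<noteq> j"
  have nth: "extremal m r ! Suc k = gen m r k" "r + k < limit m r" if "Suc k < length (extremal m r)" for k
    using that by (auto simp: extremal_def)
  have nth0: "extremal m r ! 0 = pure r" by (simp add: extremal_def)
  show "\<not> extremal m r ! i \<le> extremal m r ! j"
  proof (cases i)
    case 0
    then obtain k where "j = Suc k" using ij(3) by (cases j) auto
    then show ?thesis using nth[of k] ij nth0 0 pure_incomparable by simp
  next
    case (Suc k)
    show ?thesis
    proof (cases j)
      case 0
      then show ?thesis using nth[of k] ij nth0 Suc pure_incomparable by simp
    next
      case Suc': (Suc k')
      then have "k < k' \<or> k' < k" using ij(3) Suc by auto
      then show ?thesis using nth[of k] nth[of k'] ij Suc Suc' gen_incomparable by auto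
    qed
  qed
qed

lemma extremal_bound:
  assumes "i \<in> {1..length (extremal m r)}" shows "deg m (extremal m r ! (i - 1)) \<le> g_bound r i"
proof -
  obtain k where k: "i = Suc k" using assms by (cases i) auto
  show ?thesis
  proof (cases k)
    case 0
    then show ?thesis using k by (simp add: extremal_def pure_deg g_bound_def One_nat_def)
  next
    case (Suc k')
    then have "r + k' < limit m r" using assms k by (auto simp: extremal_def)
    then show ?thesis using Suc k gen_deg[of k'] assms by (auto simp: extremal_def g_bound_def One_nat_def)
  qed
qed

text \<open>Prepares the least upper bound of degree \<open>r + k + 1\<close> at which the condition
  fails. For positive \<open>k\<close>, the newest generator times the preceding pivot variable is a
  multiple of a monomial in the segment already generated.\<close>

lemma gen_syzygy:
  assumes k: "r + k < limit m r"
  shows "\<exists>j\<in>{1..m}. \<exists>\<beta>\<in>insert (pure r) (gen m r ` {..<k}). \<beta> \<le> mult j (gen m r k)"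
proof (cases k)
  case 0
  have "pure r \<le> mult 1 (start r)" using r by (auto simp: pure_def start_def le_fun_def mult_apply)
  then show ?thesis using 0 m by (intro bexI[of _ 1]) auto
next
  case (Suc k')
  let ?z = "gen m r k'" and ?p = "pivot m (gen m r k')"
  have z: "?z \<in> mon {1..m} (r + k')" using gen_in_mon k Suc by simp
  have ex: "\<exists>j\<in>{1..<m}. 0 < ?z j" using gen_pivot k Suc by simp
  note p = pivot[OF ex]
  \<comment> \<open>The power of variable \<open>m\<close> in \<open>?z\<close> moves to the
    variable after the pivot, which does not lower the monomial.\<close>
  define u where "u = (\<lambda>l. if l \<le> ?p then ?z l else if l = Suc ?p then ?z m else 0)"
  have "deg m u = deg m ?z"
  proof -
    have "sum u {1..?p} = sum ?z {1..?p}" by (rule sum.cong) (auto simp: u_def)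
    moreover have "sum ?z {Suc ?p..m} = ?z m" using p by (simp add: sum.remove[of "{Suc ?p..m}" m])
    moreover have "sum u {Suc ?p..m} = ?z m"
      using p by (simp add: sum.remove[of "{Suc ?p..m}" "Suc ?p"] u_def)
    ultimately show ?thesis using next_gen_split[OF z ex, of u] next_gen_split[OF z ex, of ?z] by simp
  qed
  then have um: "u \<in> mon {1..m} (r + k')" using z p by (auto simp: mon_tuples tuples_def u_def)
  have "u = ?z \<or> lex_less ?z u"
  proof (cases "Suc ?p = m \<or> ?z m = 0")
    case True
    have "u l = ?z l" for l using p(2) p(4)[of l] True mon_zero[OF z, of l]
      by (cases l m rule: linorder_cases) (auto simp: u_def)
    then show ?thesis by blast
  next
    case False
    then have "lex_less ?z u" using p
      by (intro lex_lessI[of _ "Suc ?p"]) (auto simp: u_def)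
    then show ?thesis ..
  qed
  then obtain \<beta> where b: "\<beta> \<in> insert (pure r) (gen m r ` {..k'})" "\<beta> \<le> u"
    using gen_above[OF _ um] k Suc by auto
  have "u \<le> mult ?p (next_gen m ?z)" by (auto simp: u_def next_gen_def le_fun_def mult_apply)
  then have "\<beta> \<le> mult ?p (gen m r k)" using b(2) unfolding Suc gen_Suc by (rule order_trans[rotated])
  then show ?thesis using b(1) p Suc by (intro bexI[of _ ?p] bexI[of _ \<beta>]) (auto simp: less_Suc_eq_le)
qed

text \<open>The newest generator \<open>w\<close> is isolated, being incomparable to the others and of maximal degree, and it is
  the only generator below \<open>mult j w\<close> minus the unit at \<open>j\<close>.\<close>

lemma extremal_not_D_cond:
  assumes k: "r + k < limit m r" shows "\<not> D_cond m (extremal m r) (r + k)"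
proof
  assume D: "D_cond m (extremal m r) (r + k)"
  define w where "w = gen m r k"
  define N where "N = Gamma_in m (extremal m r) (r + k)"
  have wm: "w \<in> tuples m" "deg m w = r + k" using gen_in_mon[OF k] by (auto simp: w_def mon_tuples)
  have wN: "w \<in> N" using k wm by (auto simp: N_def Gamma_in_def set_extremal w_def)
  have NS: "N \<subseteq> set (extremal m r)" by (auto simp: N_def Gamma_in_def)
  have Nt: "N \<subseteq> tuples m" using NS extremal_antichain by (auto simp: antichain_seq_def)
  have anti: "x = y" if "x \<in> N" "y \<in> N" "x \<le> y" for x y
    using antichain_seqD[OF extremal_antichain] that NS by blast
  have dN: "deg m x \<le> r + k" if "x \<in> N" for x using that by (simp add: N_def Gamma_in_def)
  obtain j \<beta> where j: "j \<in> {1..m}" and b: "\<beta> \<in> insert (pure r) (gen m r ` {..<k})" "\<beta> \<le> mult j w"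
    using gen_syzygy[OF k] unfolding w_def by blast
  have "\<beta> \<in> N" using b(1) k pure_deg gen_deg by (auto simp: N_def Gamma_in_def set_extremal)
  have "gen m r x \<noteq> w" if "x < k" for x using gen_incomparable(1)[OF that k] by (auto simp: w_def)
  moreover have "pure r \<noteq> w" using pure_incomparable(1)[OF k] by (auto simp: w_def)
  ultimately have "\<beta> \<noteq> w" using b(1) by blast
  define \<tau> where "\<tau> = mult j w"
  have tm: "\<tau> \<in> tuples m" "deg m \<tau> = Suc (r + k)"
    using mult_in_mon[of "{1..m}" j w "r + k"] j wm by (auto simp: \<tau>_def mon_tuples)
  have other: "x j = \<tau> j" if x: "x \<in> N" "x \<le> \<tau>" "x \<noteq> w" for x
  proof (rule ccontr)
    assume "x j \<noteq> \<tau> j"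
    then have "x j < \<tau> j" using x(2) by (simp add: le_fun_def order_less_le)
    then have "x \<le> dec j \<tau>" using le_dec[OF x(2)] by blast
    then have "x \<le> w" by (simp add: \<tau>_def)
    then show False using anti[OF x(1) wN] x(3) by simp
  qed
  have sup: "sup w \<beta> = \<tau>"
  proof (rule deg_eq_imp_eq)
    show "sup w \<beta> \<in> tuples m" "\<tau> \<in> tuples m" using sup_tuples wm Nt \<open>\<beta> \<in> N\<close> tm by blast+
    show "sup w \<beta> \<le> \<tau>" using b(2) le_mult by (simp add: \<tau>_def)
    show "deg m \<tau> \<le> deg m (sup w \<beta>)"
    proof (rule ccontr)
      assume "\<not> ?thesis"
      then have "deg m (sup w \<beta>) \<le> deg m w" using tm wm by simp
      then have "w = sup w \<beta>" using deg_eq_imp_eq[of w m "sup w \<beta>"] sup_tuples[of w m \<beta>] wm Nt \<open>\<beta> \<in> N\<close> by auto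
      then show False using anti[OF \<open>\<beta> \<in> N\<close> wN] \<open>\<beta> \<noteq> w\<close> by (metis sup.cobounded2)
    qed
  qed
  then have t: "\<tau> \<in> lubs N - Gamma m (r + k)" using wN \<open>\<beta> \<in> N\<close> \<open>\<beta> \<noteq> w\<close> tm by (auto simp: lubs_def Gamma_def)
  have b\<tau>: "\<beta> \<le> \<tau>" using b(2) by (simp add: \<tau>_def)
  have wj: "le_minus_unit w \<tau> j" using le_mult[of w j] by (simp add: le_minus_unit_iff \<tau>_def mult_apply)
  have "\<not> \<tau> \<le> \<beta>" using deg_mono[of \<tau> \<beta> m] dN[OF \<open>\<beta> \<in> N\<close>] tm by auto
  then obtain i where i: "\<beta> i < \<tau> i" by (auto simp: le_fun_def not_le)
  then have bi: "le_minus_unit \<beta> \<tau> i" using b\<tau> by (simp add: le_minus_unit_iff)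
  have iU: "i \<in> {1..m}" using i tm(1) unfolding tuples_def by force
  have "i \<noteq> j" using other[OF \<open>\<beta> \<in> N\<close> b\<tau> \<open>\<beta> \<noteq> w\<close>] i by auto
  have only_w: "x = w" if "x \<in> N" "le_minus_unit x \<tau> j" for x
    using other[of x] that by (auto simp: le_minus_unit_iff)
  have not_w: "\<not> le_minus_unit w \<tau> i" using \<open>i \<noteq> j\<close> by (simp add: le_minus_unit_iff \<tau>_def mult_apply)
  \<comment> \<open>A least upper bound of \<open>w\<close> and \<open>y\<close> within degree
    \<open>r + k\<close> is \<open>w\<close> itself, and the antichain property gives
    \<open>y = w\<close>.\<close>
  have isolated: "x = w \<longleftrightarrow> y = w" if xy: "x \<in> N" "y \<in> N" "deg m (sup x y) \<le> r + k" for x y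
  proof -
    have *: "y = w" if "y \<in> N" "deg m (sup w y) \<le> r + k" for y
    proof -
      have "w = sup w y" using deg_eq_imp_eq[of w m "sup w y"] sup_tuples[of w m y] wm Nt that by auto
      then show ?thesis using anti[OF that(1) wN] by (metis sup.cobounded2)
    qed
    show ?thesis using *[of x] *[of y] xy by (auto simp: sup_commute)
  qed
  \<comment> \<open>Both orders of the ends are covered, since \<open>D_cond\<close> orders its two
    indices and either of \<open>i\<close> and \<open>j\<close> may be the smaller one.\<close>
  have no_path: False
    if s: "1 \<le> s" and h: "\<forall>l \<in> {1..s}. \<eta> l \<in> N \<and> \<kappa> l \<in> {1..m} \<and> le_minus_unit (\<eta> l) \<tau> (\<kappa> l)"
      and e: "(\<kappa> 1 = i \<and> \<kappa> s = j) \<or> (\<kappa> 1 = j \<and> \<kappa> s = i)"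
      and d: "\<forall>l \<in> {1..<s}. deg m (sup (\<eta> l) (\<eta> (l + 1))) \<le> r + k"
    for s :: nat and \<eta> :: "nat \<Rightarrow> nat \<Rightarrow> nat" and \<kappa>
  proof -
    have "\<eta> 1 = w \<longleftrightarrow> \<eta> l = w" if "1 \<le> l" "l \<le> s" for l
      using that
    proof (induction l rule: dec_induct)
      case (step l)
      then have "l \<in> {1..s}" "Suc l \<in> {1..s}" "l \<in> {1..<s}" by auto
      then have "\<eta> l = w \<longleftrightarrow> \<eta> (Suc l) = w"
        using isolated[of "\<eta> l" "\<eta> (Suc l)"] h bspec[OF d, of l] by (metis Suc_eq_plus1)
      then show ?case using step by auto
    qed simp
    then have "\<eta> 1 = w \<longleftrightarrow> \<eta> s = w" using s by blast
    moreover have "1 \<in> {1..s}" "s \<in> {1..s}" using s by auto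
    ultimately show False using h e only_w not_w by metis
  qed
  have path: "\<exists>(s::nat) \<eta> \<kappa>. 1 \<le> s \<and>
           (\<forall>l \<in> {1..s}. \<eta> l \<in> N \<and> \<kappa> l \<in> {1..m} \<and> le_minus_unit (\<eta> l) \<tau> (\<kappa> l)) \<and>
           \<kappa> 1 = a \<and> \<kappa> s = b \<and>
           (\<forall>l \<in> {1..<s}. deg m (sup (\<eta> l) (\<eta> (l + 1))) \<le> r + k)"
    if "a \<in> {1..m}" "b \<in> {1..m}" "a < b" "x \<in> N" "y \<in> N" "le_minus_unit x \<tau> a" "le_minus_unit y \<tau> b" for a b x y
  proof -
    have *: "1 \<le> a \<and> a < b \<and> b \<le> m \<and> (\<exists>\<beta>1\<in>N. \<exists>\<beta>2\<in>N. le_minus_unit \<beta>1 \<tau> a \<and> le_minus_unit \<beta>2 \<tau> b)"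
      using that by auto
    show ?thesis
      using D[unfolded D_cond_def N_def[symmetric], THEN bspec, OF t, THEN spec, THEN spec, THEN mp, OF *] .
  qed
  show False
  proof (cases "i < j")
    case True
    then show False using path[OF iU j True \<open>\<beta> \<in> N\<close> wN bi wj] no_path by blast
  next
    case False
    then have "j < i" using \<open>i \<noteq> j\<close> by simp
    then show False using path[OF j iU _ wN \<open>\<beta> \<in> N\<close> wj bi] no_path by blast
  qed
qed

lemma D_num_extremal: "D_num m r (extremal m r) = limit m r"
proof -
  obtain p where p: "r \<le> p" "p \<le> limit m r" "D_cond m (extremal m r) p"
    using D_cond_exists[OF m r extremal_antichain] by blast
  have low: "limit m r \<le> q" if "r \<le> q" "D_cond m (extremal m r) q" for q
    using extremal_not_D_cond[of "q - r"] that by (cases "q < limit m r") auto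
  show ?thesis unfolding D_num_def
    by (rule Least_equality) (use p low in \<open>auto dest: le_antisym\<close>)
qed

lemma C_num_large: "finite (D_set r m) \<and> C_num r m = limit m r"
proof -
  have sub: "D_set r m \<subseteq> {..limit m r}" using D_num_le[OF m r] by (auto simp: D_set_def)
  then have fin: "finite (D_set r m)" by (rule finite_subset) simp
  moreover have "limit m r \<in> D_set r m"
    unfolding D_set_def using extremal_antichain D_num_extremal by (intro CollectI exI[of _ "extremal m r"]) auto
  ultimately show ?thesis unfolding C_num_def using sub by (auto intro!: Max_eqI)
qed

lemma L_num_large:
  "finite (antichain_lengths (g_bound r) m) \<and> L_num (g_bound r) m + r = Suc (limit m r)"
proof -
  have le: "l + r \<le> Suc (limit m r)" if "l \<in> antichain_lengths (g_bound r) m" for l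
  proof -
    obtain \<alpha> where a: "antichain_seq m \<alpha>" "l = length \<alpha>"
      "\<forall>i \<in> {1..length \<alpha>}. deg m (\<alpha> ! (i - 1)) \<le> g_bound r i"
      using \<open>l \<in> antichain_lengths (g_bound r) m\<close> by (auto simp: antichain_lengths_def)
    show ?thesis
      using antichain_length_le[OF m r a(1)] a limit_gt by (cases "2 \<le> length \<alpha>") auto
  qed
  have "antichain_lengths (g_bound r) m \<subseteq> {..Suc (limit m r)}" using le by fastforce
  then have fin: "finite (antichain_lengths (g_bound r) m)" by (rule finite_subset) simp
  have "Suc (limit m r - r) \<in> antichain_lengths (g_bound r) m"
    unfolding antichain_lengths_def using extremal_antichain extremal_bound
    by (intro CollectI exI[of _ "extremal m r"]) (auto simp: extremal_def)
  moreover have "l \<le> Suc (limit m r - r)" if "l \<in> antichain_lengths (g_bound r) m" for l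
    using le[OF that] by simp
  ultimately have "L_num (g_bound r) m = Suc (limit m r - r)"
    unfolding L_num_def using fin by (intro Max_eqI) auto
  then show ?thesis using fin limit_gt by simp
qed

end

section \<open>Degenerate cases: one variable or degree 0\<close>

lemma antichain_seq_Nil: "antichain_seq m []"
  by (simp add: antichain_seq_def)

lemma antichain_lengths_trivial:
  assumes "\<And>\<alpha>. antichain_seq m \<alpha> \<Longrightarrow> \<forall>i \<in> {1..length \<alpha>}. deg m (\<alpha> ! (i - 1)) \<le> f i \<Longrightarrow> length \<alpha> \<le> 1"
  shows "finite (antichain_lengths f m) \<and> L_num f m = 1"
proof -
  have sub: "antichain_lengths f m \<subseteq> {..1}" using assms by (auto simp: antichain_lengths_def)
  then have fin: "finite (antichain_lengths f m)" by (rule finite_subset) simp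
  have "1 \<in> antichain_lengths f m" unfolding antichain_lengths_def
    by (intro CollectI exI[of _ "[\<lambda>_. 0]"]) (auto simp: antichain_seq_def tuples_def deg_def One_nat_def)
  then show ?thesis unfolding L_num_def using fin sub by (auto intro!: Max_eqI)
qed

lemma D_set_trivial:
  assumes "\<And>\<alpha>. antichain_seq m \<alpha> \<Longrightarrow> D_cond m \<alpha> r"
  shows "finite (D_set r m) \<and> C_num r m = r"
proof -
  have "D_num m r \<alpha> = r" if "antichain_seq m \<alpha>" for \<alpha>
    unfolding D_num_def using assms[OF that] by (intro Least_equality) auto
  then have "D_set r m = {r}" using antichain_seq_Nil unfolding D_set_def by (auto intro!: exI[of _ "[]"])
  then show ?thesis by (simp add: C_num_def)
qed

lemma deg_0: "u \<in> tuples m \<Longrightarrow> deg m u = 0 \<Longrightarrow> u \<le> v"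
proof -
  assume "u \<in> tuples m" "deg m u = 0"
  then have "u l = 0" for l by (cases "l \<in> {1..m}") (auto simp: deg_def tuples_def)
  then show ?thesis by (simp add: le_fun_def)
qed

lemma C_L_num:
  assumes m: "1 \<le> m"
  shows "finite (D_set r m) \<and> C_num r m = limit m r"
    and "finite (antichain_lengths (g_bound r) m) \<and> L_num (g_bound r) m + r = Suc (limit m r)"
proof -
  consider "r = 0" | "m = 1" | "2 \<le> m" "1 \<le> r" using m by linarith
  then have "(finite (D_set r m) \<and> C_num r m = limit m r) \<and>
    (finite (antichain_lengths (g_bound r) m) \<and> L_num (g_bound r) m + r = Suc (limit m r))"
  proof cases
    case 1
    have "D_cond m \<alpha> 0" if a: "antichain_seq m \<alpha>" for \<alpha>
    proof -
      have "x = y" if "x \<in> Gamma_in m \<alpha> 0" "y \<in> Gamma_in m \<alpha> 0" for x y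
        using that a deg_0 by (auto simp: Gamma_in_def antichain_seq_def intro!: antisym)
      then have "lubs (Gamma_in m \<alpha> 0) = {}" unfolding lubs_def by blast
      then show ?thesis by (simp add: D_cond_def)
    qed
    moreover have "length \<alpha> \<le> 1" if a: "antichain_seq m \<alpha>"
      "\<forall>i \<in> {1..length \<alpha>}. deg m (\<alpha> ! (i - 1)) \<le> g_bound 0 i" for \<alpha>
    proof (rule ccontr)
      assume "\<not> length \<alpha> \<le> 1"
      then have l: "0 < length \<alpha>" "1 < length \<alpha>" by auto
      have "deg m (\<alpha> ! 0) = 0" using a(2)[THEN bspec, of 1] l by (simp add: g_bound_def)
      then have "\<alpha> ! 0 \<le> \<alpha> ! 1" using deg_0 a(1) l nth_mem[OF l(1)] unfolding antichain_seq_def by blast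
      then show False using a(1) l unfolding antichain_seq_def by (metis zero_neq_one)
    qed
    ultimately show ?thesis using D_set_trivial[of m 0] antichain_lengths_trivial[of m "g_bound 0"] 1
      by (auto simp: limit_def)
  next
    case 2
    have lim: "limit 1 r = r" by (simp add: limit_def funpow_ackermann_0)
    have "D_cond 1 \<alpha> r" for \<alpha> by (auto simp: D_cond_def)
    moreover have "length \<alpha> \<le> 1" if a: "antichain_seq 1 \<alpha>" for \<alpha>
    proof (rule ccontr)
      assume "\<not> length \<alpha> \<le> 1"
      then have l: "0 < length \<alpha>" "1 < length \<alpha>" by auto
      have t: "\<alpha> ! 0 \<in> tuples 1" "\<alpha> ! 1 \<in> tuples 1"
        using a nth_mem[OF l(1)] nth_mem[OF l(2)] by (auto simp: antichain_seq_def)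
      have le: "u \<le> v" if "u \<in> tuples 1" "u 1 \<le> v 1" for u v
        unfolding le_fun_def
      proof
        fix l show "u l \<le> v l" using that by (cases "l = 1") (auto simp: tuples_def)
      qed
      have "\<alpha> ! 0 \<le> \<alpha> ! 1 \<or> \<alpha> ! 1 \<le> \<alpha> ! 0" using le t nat_le_linear by blast
      then show False using a l unfolding antichain_seq_def by (metis zero_neq_one)
    qed
    ultimately show ?thesis using D_set_trivial[of 1 r] antichain_lengths_trivial[of 1 "g_bound r"] 2 lim by simp
  next
    case 3
    then show ?thesis using C_num_large L_num_large by blast
  qed
  then show "finite (D_set r m) \<and> C_num r m = limit m r"
    "finite (antichain_lengths (g_bound r) m) \<and> L_num (g_bound r) m + r = Suc (limit m r)" by auto
qed

section \<open>Comparison with Ackermann values\<close>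

lemma limit_Suc: "limit m (Suc r) = ackermann (m - 1) (limit m r)"
  by (simp add: limit_def)

lemma ackermann_limit: "1 \<le> m \<Longrightarrow> ackermann m r = (ackermann (m - 1) ^^ Suc r) 1"
  using ackermann_funpow[of "m - 1" r] by simp

text \<open>Both sides apply the same strictly increasing map \<open>Suc r\<close> times, starting
  from 0 and from 1.\<close>

lemma limit_less: "1 \<le> m \<Longrightarrow> limit m (Suc r) < ackermann m r"
proof -
  assume m: "1 \<le> m"
  have "(ackermann x ^^ n) 0 < (ackermann x ^^ n) 1" for x n
    by (induction n) (auto intro: ackermann_less)
  then show ?thesis unfolding ackermann_limit[OF m] limit_def .
qed

text \<open>The additional first application lifts the starting point 0 to at least 1.\<close>

lemma limit_greater: "1 \<le> m \<Longrightarrow> ackermann m r \<le> limit m (Suc (Suc r))"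
proof -
  assume m: "1 \<le> m"
  have "1 \<le> ackermann (m - 1) 0" using ackermann_gt[of 0 "m - 1"] by simp
  then have "(ackermann (m - 1) ^^ Suc r) 1 \<le> (ackermann (m - 1) ^^ Suc r) (ackermann (m - 1) 0)"
    by (rule funpow_mono_arg)
  then show ?thesis unfolding ackermann_limit[OF m] limit_def by (simp add: funpow_swap1)
qed

theorem theorem33:
  fixes m r :: nat
  assumes "m \<ge> 1"
  shows "finite (D_set r m) \<and> finite (antichain_lengths (g_bound r) m) \<and>
    int (C_num r m) = int (L_num (g_bound r) m) + int r - 1 \<and>
    (r \<ge> 1 \<longrightarrow>
       C_num r m = ackermann (m - 1) (C_num (r - 1) m) \<and>
       int (C_num r m) \<le> int (ackermann m (r - 1)) - 1) \<and>
    (r \<ge> 2 \<longrightarrow> ackermann m (r - 2) \<le> C_num r m)"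
proof (intro conjI impI)
  note C = C_L_num(1)[OF assms] and L = C_L_num(2)[OF assms]
  show "finite (D_set r m)" "finite (antichain_lengths (g_bound r) m)" using C L by auto
  show "int (C_num r m) = int (L_num (g_bound r) m) + int r - 1" using C[of r] L[of r] by linarith
  show "C_num r m = ackermann (m - 1) (C_num (r - 1) m)" if "r \<ge> 1"
    using C limit_Suc[of m "r - 1"] that by simp
  show "int (C_num r m) \<le> int (ackermann m (r - 1)) - 1" if "r \<ge> 1"
    using C[of r] limit_less[OF assms, of "r - 1"] that by simp
  show "ackermann m (r - 2) \<le> C_num r m" if "r \<ge> 2"
  proof -
    have "Suc (Suc (r - 2)) = r" using that by simp
    then show ?thesis using C[of r] limit_greater[OF assms, of "r - 2"] by metis
  qed
qed

end
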